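(* Let $(B,m_B,u_B,\Delta_B,\varepsilon_B,c_B)$ be a graded braided bialgebra over a field $K$ which is strongly $\mathbb N$-graded as an algebra. The following assertions are equivalent for $N\ge1$. (1) $S^{[\infty]}(B)^N=0$. (2) $S^{[\infty]}(B)^n=0$ for every $n\ge N$. (3) $S^{[N-1]}(B)^N=0$. (4) $S^{[N-1]}(B)^n=0$ for every $n\ge N$. If one of these conditions is fulfilled, then $\mathrm{sdeg}(B)\le N-1$.
   Context: $K$ is a field, vector spaces are over $K$, $\otimes=\otimes_K$, and the name of an object also denotes its identity map. A braided vector space $(V,c)$ is a vector space $V$ with a $K$-linear map $c:V\otimes V\to V\otimes V$ such that $(c\otimes V)(V\otimes c)(c\otimes V)=(V\otimes c)(c\otimes V)(V\otimes c)$. A braided algebra $(A,m,u,c)$ is an associative unital algebra with a braided vector space $(A,c)$ such that $c(m\otimes A)=(A\otimes m)(c\otimes A)(A\otimes c)$, $c(A\otimes m)=(m\otimes A)(A\otimes c)(c\otimes A)$, $c(u\otimes A)=A\otimes u$, $c(A\otimes u)=u\otimes A$; braided coalgebras are defined dually. A braided bialgebra is both a braided algebra and a braided coalgebra with $\Delta m=(m\otimes m)(B\otimes c\otimes B)(\Delta\otimes\Delta)$, with $\Delta,\varepsilon$ unital and $\varepsilon$ multiplicative. It is graded if $B=\bigoplus_{n\in\mathbb N}B^n$ with $m,\Delta$ graded, $c(B^a\otimes B^b)\subseteq B^b\otimes B^a$ and $\varepsilon|_{B^n}=0$ for $n>0$; $\Delta_B^{a,b}:B^{a+b}\to B^a\otimes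 B^b$ and $m_B^{a,b}:B^a\otimes B^b\to B^{a+b}$ are homogeneous components. A graded algebra $A$ is strongly $\mathbb N$-graded if $m_A^{i,j}$ is surjective for all $i,j\in\mathbb N$. Put $E_n(B)=\bigcap_{a,b\ge1,\ a+b=n}\ker(\Delta_B^{a,b})$ for $n\ge2$, $E(B)=\bigoplus_{n\ge2}E_n(B)$; $S(B)=B/(E(B))$ (quotient by the generated two-sided ideal) is again a graded braided bialgebra via the projection. Put $S^{[0]}(B)=B$, $S^{[n]}(B)=S(S^{[n-1]}(B))$, and let $S^{[\infty]}(B)=\varinjlim S^{[i]}(B)$ be the direct limit along the projections, a graded braided bialgebra. A superscript $n$ as in $S^{[i]}(B)^n$ denotes the degree-$n$ component. The strongness degree $\mathrm{sdeg}(B)$ is the least $t\in\mathbb N$ such that the projection $S^{[t]}(B)\to S^{[t+1]}(B)$ is an isomorphism ($\infty$ if none exists). *)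

theory Defs
  imports Complex_Main "HOL-Library.Poly_Mapping" "HOL-Library.Extended_Nat"
begin

section \<open>Subspaces, linear maps and quotients\<close>

text \<open>
  Throughout, the ground field is a type \<open>'k\<close> of class \<open>field\<close>.  A vector space is a linear subspace
  of an ambient vector space, the latter being a type together with a scalar multiplication.
  A linear map between two such subspaces is represented by a linear map of the ambient spaces;
  only its values on the subspace matter.  Every linear map on a subspace extends to the
  ambient space, so this is no restriction.
\<close>

definition linear_between ::
  "('k::field \<Rightarrow> 'a::ab_group_add \<Rightarrow> 'a) \<Rightarrow> ('k \<Rightarrow> 'b::ab_group_add \<Rightarrow> 'b)
    \<Rightarrow> 'a set \<Rightarrow> 'b set \<Rightarrow> ('a \<Rightarrow> 'b) \<Rightarrow> bool" where
  "linear_between s1 s2 V W f \<longleftrightarrow> Vector_Spaces.linear s1 s2 f \<and> f ` V \<subseteq> W"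

text \<open>
  For subspaces \<open>I \<subseteq> V\<close>, the quotient space \<open>V / I\<close> is realised on a linear complement of \<open>I\<close> in \<open>V\<close>:
  \<open>quot_proj s V I\<close> sends each \<open>x \<in> V\<close> to the representative of its coset \<open>x + I\<close> lying in the chosen
  complement.  It is the canonical projection, with kernel \<open>I\<close> (see \<open>quot_proj_kernel\<close> below), and
  the quotient is its image.  Unlike a space of cosets, this quotient lives in the same type as \<open>V\<close>,
  so that quotients can be iterated.
\<close>

definition quot_proj ::
  "('k::field \<Rightarrow> 'a::ab_group_add \<Rightarrow> 'a) \<Rightarrow> 'a set \<Rightarrow> 'a set \<Rightarrow> 'a \<Rightarrow> 'a" where
  "quot_proj s V I = (SOME p. Vector_Spaces.linear s s p \<and> p ` V \<subseteq> V \<and>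
      (\<forall>x\<in>V. x - p x \<in> I) \<and> (\<forall>x\<in>I. p x = 0))"

lemma quot_proj_spec:
  fixes s :: "'k::field \<Rightarrow> 'a::ab_group_add \<Rightarrow> 'a"
  assumes vs: "vector_space s" and V: "module.subspace s V" and I: "module.subspace s I"
    and IV: "I \<subseteq> V"
  shows "Vector_Spaces.linear s s (quot_proj s V I)"
    and "\<And>x. x \<in> V \<Longrightarrow> quot_proj s V I x \<in> V"
    and "\<And>x. x \<in> V \<Longrightarrow> x - quot_proj s V I x \<in> I"
    and "\<And>x. x \<in> I \<Longrightarrow> quot_proj s V I x = 0"
proof -
  interpret vector_space s by (rule vs)
  interpret vp: vector_space_pair s s by unfold_locales
  obtain A where A: "A \<subseteq> I" "independent A" "I \<subseteq> span A"
    using maximal_independent_subset[of I] by blast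
  obtain C where C: "A \<subseteq> C" "C \<subseteq> V" "independent C" "V \<subseteq> span C"
    using maximal_independent_subset_extend[of A V] A IV by blast
  define p where "p = vp.construct C (\<lambda>b. if b \<in> A then 0 else b)"
  have lin: "Vector_Spaces.linear s s p"
    unfolding p_def by (rule vp.linear_construct[OF C(3)])
  then interpret p: Vector_Spaces.linear s s p .
  have pb: "p b = (if b \<in> A then 0 else b)" if "b \<in> C" for b
    unfolding p_def by (rule vp.construct_basis[OF C(3) that])
  have 1: "p x = 0" if "x \<in> I" for x
  proof -
    have "x \<in> span A" using that A by blast
    then show ?thesis
      by (induction rule: span_induct_alt) (use pb C(1) in \<open>auto simp: p.zero p.add p.scale\<close>)
  qed
  have 2: "p x \<in> V \<and> x - p x \<in> I" if "x \<in> V" for x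
  proof -
    have "x \<in> span C" using that C by blast
    then show ?thesis
    proof (induction rule: span_induct_alt)
      case base
      then show ?case using subspace_0[OF V] subspace_0[OF I] by (simp add: p.zero)
    next
      case (step c b y)
      have b: "p b \<in> V" "b - p b \<in> I"
        using pb[OF step(1)] C(2) A(1) step(1) subspace_0[OF V] subspace_0[OF I] by auto
      have "s c b + y - p (s c b + y) = s c (b - p b) + (y - p y)"
        by (simp add: p.add p.scale scale_right_diff_distrib)
      also have "\<dots> \<in> I"
        using step b subspace_add[OF I] subspace_scale[OF I] by blast
      finally show ?case
        using step b subspace_add[OF V] subspace_scale[OF V] by (simp add: p.add p.scale)
    qed
  qed
  have "\<exists>p. Vector_Spaces.linear s s p \<and> p ` V \<subseteq> V \<and>
      (\<forall>x\<in>V. x - p x \<in> I) \<and> (\<forall>x\<in>I. p x = 0)"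
    using lin 1 2 by blast
  from someI_ex[OF this, folded quot_proj_def]
  show "Vector_Spaces.linear s s (quot_proj s V I)"
    and "\<And>x. x \<in> V \<Longrightarrow> quot_proj s V I x \<in> V"
    and "\<And>x. x \<in> V \<Longrightarrow> x - quot_proj s V I x \<in> I"
    and "\<And>x. x \<in> I \<Longrightarrow> quot_proj s V I x = 0"
    by blast+
qed

lemma quot_proj_kernel:
  fixes s :: "'k::field \<Rightarrow> 'a::ab_group_add \<Rightarrow> 'a"
  assumes "vector_space s" "module.subspace s V" "module.subspace s I" "I \<subseteq> V" "x \<in> V"
  shows "quot_proj s V I x = 0 \<longleftrightarrow> x \<in> I"
  using quot_proj_spec(3,4)[OF assms(1-4)] assms(5) by force

section \<open>Tensor products\<close>

text \<open>
  \<open>'x \<Rightarrow>\<^sub>0 'a\<close> is the direct sum of copies of \<open>'a\<close> indexed by \<open>'x\<close>; for \<open>'a = 'k\<close> it is the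
  free vector space on \<open>'x\<close>.
\<close>

definition pm_scale ::
  "('k::field \<Rightarrow> 'a::ab_group_add \<Rightarrow> 'a) \<Rightarrow> 'k \<Rightarrow> ('x \<Rightarrow>\<^sub>0 'a) \<Rightarrow> ('x \<Rightarrow>\<^sub>0 'a)" where
  "pm_scale s a = Poly_Mapping.map (s a)"

lemma lookup_pm_scale:
  assumes "vector_space s"
  shows "Poly_Mapping.lookup (pm_scale s a p) x = s a (Poly_Mapping.lookup p x)"
proof -
  interpret vector_space s by fact
  show ?thesis by (simp add: pm_scale_def Poly_Mapping.map.rep_eq when_def)
qed

lemma vector_space_pm_scale:
  assumes "vector_space s"
  shows "vector_space (pm_scale s)"
proof -
  interpret vector_space s by fact
  show ?thesis
    by unfold_locales
      (auto intro!: poly_mapping_eqI simp: lookup_pm_scale[OF assms] lookup_add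
        scale_right_distrib scale_left_distrib)
qed

lemma vector_space_mult: "vector_space ((*) :: 'k::field \<Rightarrow> 'k \<Rightarrow> 'k)"
  by unfold_locales (auto simp: algebra_simps)

type_synonym ('k, 'a, 'b) tensors = "('a \<times> 'b) \<Rightarrow>\<^sub>0 'k"

abbreviation tscale :: "'k::field \<Rightarrow> ('k, 'a, 'b) tensors \<Rightarrow> ('k, 'a, 'b) tensors" where
  "tscale \<equiv> pm_scale (*)"

definition tensor_relations ::
  "('k::field \<Rightarrow> 'a::ab_group_add \<Rightarrow> 'a) \<Rightarrow> ('k \<Rightarrow> 'b::ab_group_add \<Rightarrow> 'b)
    \<Rightarrow> ('k, 'a, 'b) tensors set" where
  "tensor_relations s1 s2 = module.span tscale (
      {Poly_Mapping.single (x + x', y) 1 - Poly_Mapping.single (x, y) 1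
        - Poly_Mapping.single (x', y) 1 | x x' y. True} \<union>
      {Poly_Mapping.single (x, y + y') 1 - Poly_Mapping.single (x, y) 1
        - Poly_Mapping.single (x, y') 1 | x y y'. True} \<union>
      {Poly_Mapping.single (s1 a x, y) 1 - Poly_Mapping.single (x, y) a | a x y. True} \<union>
      {Poly_Mapping.single (x, s2 a y) 1 - Poly_Mapping.single (x, y) a | a x y. True})"

definition tensor ::
  "('k::field \<Rightarrow> 'a::ab_group_add \<Rightarrow> 'a) \<Rightarrow> ('k \<Rightarrow> 'b::ab_group_add \<Rightarrow> 'b)
    \<Rightarrow> 'a \<Rightarrow> 'b \<Rightarrow> ('k, 'a, 'b) tensors" where
  "tensor s1 s2 x y =
    quot_proj tscale UNIV (tensor_relations s1 s2) (Poly_Mapping.single (x, y) 1)"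

text \<open>
  For subspaces \<open>V\<close>, \<open>W\<close> of the ambient spaces, \<open>V \<otimes> W\<close> is identified as usual (over a field) with
  a subspace of the tensor product of the ambient spaces.
\<close>

definition tensor_space ::
  "('k::field \<Rightarrow> 'a::ab_group_add \<Rightarrow> 'a) \<Rightarrow> ('k \<Rightarrow> 'b::ab_group_add \<Rightarrow> 'b)
    \<Rightarrow> 'a set \<Rightarrow> 'b set \<Rightarrow> ('k, 'a, 'b) tensors set" where
  "tensor_space s1 s2 V W = module.span tscale {tensor s1 s2 x y | x y. x \<in> V \<and> y \<in> W}"

text \<open>
  \<open>tensor_lift s f\<close> is the linear map on the tensor product induced by a bilinear map \<open>f\<close> into a space
  with scalar multiplication \<open>s\<close>.
\<close>

definition tensor_lift ::
  "('k::field \<Rightarrow> 'c::ab_group_add \<Rightarrow> 'c) \<Rightarrow> ('a \<Rightarrow> 'b \<Rightarrow> 'c) \<Rightarrow> ('k, 'a, 'b) tensors \<Rightarrow> 'c" where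
  "tensor_lift s f t = (\<Sum>(x, y)\<in>Poly_Mapping.keys t. s (Poly_Mapping.lookup t (x, y)) (f x y))"

text \<open>The two halves of the universal property:\<close>

lemma subspace_tensor_relations:
  fixes s1 :: "'k::field \<Rightarrow> 'a::ab_group_add \<Rightarrow> 'a" and s2 :: "'k \<Rightarrow> 'b::ab_group_add \<Rightarrow> 'b"
  shows "module.subspace tscale (tensor_relations s1 s2)"
proof -
  interpret vector_space "tscale :: 'k \<Rightarrow> ('k, 'a, 'b) tensors \<Rightarrow> _"
    by (intro vector_space_pm_scale vector_space_mult)
  show ?thesis unfolding tensor_relations_def by (rule subspace_span)
qed

lemma
  fixes s1 :: "'k::field \<Rightarrow> 'a::ab_group_add \<Rightarrow> 'a" and s2 :: "'k \<Rightarrow> 'b::ab_group_add \<Rightarrow> 'b"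
  shows tensor_add_left: "tensor s1 s2 (x + x') y = tensor s1 s2 x y + tensor s1 s2 x' y"
    and tensor_add_right: "tensor s1 s2 x (y + y') = tensor s1 s2 x y + tensor s1 s2 x y'"
    and tensor_scale_left: "tensor s1 s2 (s1 a x) y = tscale a (tensor s1 s2 x y)"
    and tensor_scale_right: "tensor s1 s2 x (s2 a y) = tscale a (tensor s1 s2 x y)"
proof -
  let ?sc = "tscale :: 'k \<Rightarrow> ('k, 'a, 'b) tensors \<Rightarrow> ('k, 'a, 'b) tensors"
  have vs: "vector_space ?sc" by (intro vector_space_pm_scale vector_space_mult)
  interpret vector_space ?sc by (rule vs)
  let ?R = "tensor_relations s1 s2"
  note q = quot_proj_spec[OF vs subspace_UNIV subspace_tensor_relations subset_UNIV]
  let ?q = "quot_proj ?sc UNIV ?R"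
  interpret q: Vector_Spaces.linear ?sc ?sc ?q by (rule q)
  have sc: "Poly_Mapping.single z a = ?sc a (Poly_Mapping.single z 1)" for z a
    by (simp add: pm_scale_def)
  have "Poly_Mapping.single (x + x', y) 1 - Poly_Mapping.single (x, y) 1
        - Poly_Mapping.single (x', y) 1 \<in> ?R"
    unfolding tensor_relations_def by (rule span_base) blast
  from q(4)[OF this] show "tensor s1 s2 (x + x') y = tensor s1 s2 x y + tensor s1 s2 x' y"
    unfolding tensor_def by (simp add: q.diff q.add algebra_simps)
  have "Poly_Mapping.single (x, y + y') 1 - Poly_Mapping.single (x, y) 1
        - Poly_Mapping.single (x, y') 1 \<in> ?R"
    unfolding tensor_relations_def by (rule span_base) blast
  from q(4)[OF this] show "tensor s1 s2 x (y + y') = tensor s1 s2 x y + tensor s1 s2 x y'"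
    unfolding tensor_def by (simp add: q.diff q.add algebra_simps)
  have "Poly_Mapping.single (s1 a x, y) 1 - Poly_Mapping.single (x, y) a \<in> ?R"
    unfolding tensor_relations_def by (rule span_base) blast
  from q(4)[OF this] show "tensor s1 s2 (s1 a x) y = tscale a (tensor s1 s2 x y)"
    unfolding tensor_def sc[of "(x, y)" a] by (simp add: q.diff q.scale)
  have "Poly_Mapping.single (x, s2 a y) 1 - Poly_Mapping.single (x, y) a \<in> ?R"
    unfolding tensor_relations_def by (rule span_base) blast
  from q(4)[OF this] show "tensor s1 s2 x (s2 a y) = tscale a (tensor s1 s2 x y)"
    unfolding tensor_def sc[of "(x, y)" a] by (simp add: q.diff q.scale)
qed

lemma linear_tensor_lift:
  fixes s :: "'k::field \<Rightarrow> 'c::ab_group_add \<Rightarrow> 'c" and f :: "'a \<Rightarrow> 'b \<Rightarrow> 'c"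
  assumes "vector_space s"
  shows "Vector_Spaces.linear tscale s (tensor_lift s f)"
proof -
  interpret s: vector_space s by fact
  interpret t: vector_space "tscale :: 'k \<Rightarrow> ('k, 'a, 'b) tensors \<Rightarrow> _"
    by (intro vector_space_pm_scale vector_space_mult)
  have eq: "tensor_lift s f t = (\<Sum>(x, y)\<in>A. s (Poly_Mapping.lookup t (x, y)) (f x y))"
    if "finite A" "Poly_Mapping.keys t \<subseteq> A" for t :: "('k, 'a, 'b) tensors" and A
    unfolding tensor_lift_def using that
    by (intro sum.mono_neutral_left) (auto simp: in_keys_iff)
  have add: "tensor_lift s f (t + u) = tensor_lift s f t + tensor_lift s f u" for t u
  proof -
    let ?A = "Poly_Mapping.keys t \<union> Poly_Mapping.keys u \<union> Poly_Mapping.keys (t + u)"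
    have "finite ?A" by simp
    then show ?thesis
      by (simp only: eq[of ?A t] eq[of ?A u] eq[of ?A "t + u"] Un_upper1 Un_upper2 le_supI1)
        (simp add: sum.distrib[symmetric] case_prod_unfold lookup_add s.scale_left_distrib)
  qed
  have scale: "tensor_lift s f (tscale a t) = s a (tensor_lift s f t)" for a t
  proof -
    let ?A = "Poly_Mapping.keys t \<union> Poly_Mapping.keys (tscale a t)"
    have "finite ?A" by simp
    then show ?thesis
      by (simp only: eq[of ?A t] eq[of ?A "tscale a t"] Un_upper1 Un_upper2)
        (simp add: s.scale_sum_right case_prod_unfold lookup_pm_scale[OF vector_space_mult])
  qed
  show ?thesis by unfold_locales (simp_all add: add scale)
qed

lemma tensor_lift_tensor:
  fixes s :: "'k::field \<Rightarrow> 'c::ab_group_add \<Rightarrow> 'c"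
    and s1 :: "'k \<Rightarrow> 'a::ab_group_add \<Rightarrow> 'a" and s2 :: "'k \<Rightarrow> 'b::ab_group_add \<Rightarrow> 'b"
  assumes vs: "vector_space s"
    and l: "\<And>y. Vector_Spaces.linear s1 s (\<lambda>x. f x y)"
    and r: "\<And>x. Vector_Spaces.linear s2 s (f x)"
  shows "tensor_lift s f (tensor s1 s2 x y) = f x y"
proof -
  let ?sc = "tscale :: 'k \<Rightarrow> ('k, 'a, 'b) tensors \<Rightarrow> ('k, 'a, 'b) tensors"
  have vt: "vector_space ?sc" by (intro vector_space_pm_scale vector_space_mult)
  interpret t: vector_space ?sc by (rule vt)
  interpret s: vector_space s by (rule vs)
  interpret L: Vector_Spaces.linear ?sc s "tensor_lift s f" by (rule linear_tensor_lift[OF vs])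
  have sing: "tensor_lift s f (Poly_Mapping.single (u, v) a) = s a (f u v)" for u v a
    by (cases "a = 0") (simp_all add: tensor_lift_def)
  interpret l: Vector_Spaces.linear s1 s "\<lambda>u. f u v" for v by (rule l)
  interpret r: Vector_Spaces.linear s2 s "f u" for u by (rule r)
  have ker: "tensor_lift s f w = 0" if "w \<in> tensor_relations s1 s2" for w
    using that unfolding tensor_relations_def
  proof (induction rule: t.span_induct_alt)
    case base
    then show ?case by (rule L.zero)
  next
    case (step c g w)
    then have "tensor_lift s f g = 0"
      by (elim UnE CollectE exE conjE)
        (simp_all add: L.diff sing l.add r.add l.scale r.scale)
    then show ?case using step by (simp add: L.add L.scale)
  qed
  let ?z = "Poly_Mapping.single (x, y) (1::'k)"
  have "?z - tensor s1 s2 x y \<in> tensor_relations s1 s2"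
    unfolding tensor_def
    by (rule quot_proj_spec(3)[OF vt t.subspace_UNIV subspace_tensor_relations subset_UNIV UNIV_I])
  from ker[OF this] have "tensor_lift s f ?z = tensor_lift s f (tensor s1 s2 x y)"
    by (simp add: L.diff)
  moreover have "tensor_lift s f ?z = f x y"
    by (simp add: sing)
  ultimately show ?thesis by simp
qed

text \<open>
  \<open>tensor_map s1 s2 f g\<close> is \<open>f \<otimes> g\<close>, where \<open>s1\<close> and \<open>s2\<close> are the scalar multiplications of the codomains.
\<close>

definition tensor_map ::
  "('k::field \<Rightarrow> 'c::ab_group_add \<Rightarrow> 'c) \<Rightarrow> ('k \<Rightarrow> 'd::ab_group_add \<Rightarrow> 'd)
    \<Rightarrow> ('a \<Rightarrow> 'c) \<Rightarrow> ('b \<Rightarrow> 'd) \<Rightarrow> ('k, 'a, 'b) tensors \<Rightarrow> ('k, 'c, 'd) tensors" where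
  "tensor_map s1 s2 f g = tensor_lift tscale (\<lambda>x y. tensor s1 s2 (f x) (g y))"

text \<open>The associativity isomorphism \<open>(U \<otimes> V) \<otimes> W \<rightarrow> U \<otimes> (V \<otimes> W)\<close> and its inverse:\<close>

definition assoc ::
  "('k::field \<Rightarrow> 'a::ab_group_add \<Rightarrow> 'a) \<Rightarrow> ('k \<Rightarrow> 'b::ab_group_add \<Rightarrow> 'b)
    \<Rightarrow> ('k \<Rightarrow> 'c::ab_group_add \<Rightarrow> 'c)
    \<Rightarrow> ('k, ('k, 'a, 'b) tensors, 'c) tensors \<Rightarrow> ('k, 'a, ('k, 'b, 'c) tensors) tensors" where
  "assoc s1 s2 s3 = tensor_lift tscale (\<lambda>t z.
      tensor_lift tscale (\<lambda>x y. tensor s1 tscale x (tensor s2 s3 y z)) t)"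

definition assoc_inv ::
  "('k::field \<Rightarrow> 'a::ab_group_add \<Rightarrow> 'a) \<Rightarrow> ('k \<Rightarrow> 'b::ab_group_add \<Rightarrow> 'b)
    \<Rightarrow> ('k \<Rightarrow> 'c::ab_group_add \<Rightarrow> 'c)
    \<Rightarrow> ('k, 'a, ('k, 'b, 'c) tensors) tensors \<Rightarrow> ('k, ('k, 'a, 'b) tensors, 'c) tensors" where
  "assoc_inv s1 s2 s3 = tensor_lift tscale (\<lambda>x t.
      tensor_lift tscale (\<lambda>y z. tensor tscale s3 (tensor s1 s2 x y) z) t)"

text \<open>The identifications \<open>K \<otimes> V = V\<close> and \<open>V \<otimes> K = V\<close>:\<close>

definition left_unitor ::
  "('k::field \<Rightarrow> 'a::ab_group_add \<Rightarrow> 'a) \<Rightarrow> ('k, 'k, 'a) tensors \<Rightarrow> 'a" where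
  "left_unitor s = tensor_lift s (\<lambda>a x. s a x)"

definition right_unitor ::
  "('k::field \<Rightarrow> 'a::ab_group_add \<Rightarrow> 'a) \<Rightarrow> ('k, 'a, 'k) tensors \<Rightarrow> 'a" where
  "right_unitor s = tensor_lift s (\<lambda>x a. s a x)"

section \<open>Braided bialgebras\<close>

text \<open>
  A triple tensor power is bracketed as \<open>(V \<otimes> V) \<otimes> V\<close>; \<open>on12 s f\<close> and \<open>on23 s f\<close> are \<open>f \<otimes> V\<close> and
  \<open>V \<otimes> f\<close> for \<open>f : V \<otimes> V \<rightarrow> V \<otimes> V\<close>.
\<close>

definition on12 ::
  "('k::field \<Rightarrow> 'a::ab_group_add \<Rightarrow> 'a) \<Rightarrow> (('k, 'a, 'a) tensors \<Rightarrow> ('k, 'a, 'a) tensors)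
    \<Rightarrow> ('k, ('k, 'a, 'a) tensors, 'a) tensors \<Rightarrow> ('k, ('k, 'a, 'a) tensors, 'a) tensors" where
  "on12 s f = tensor_map tscale s f id"

definition on23 ::
  "('k::field \<Rightarrow> 'a::ab_group_add \<Rightarrow> 'a) \<Rightarrow> (('k, 'a, 'a) tensors \<Rightarrow> ('k, 'a, 'a) tensors)
    \<Rightarrow> ('k, ('k, 'a, 'a) tensors, 'a) tensors \<Rightarrow> ('k, ('k, 'a, 'a) tensors, 'a) tensors" where
  "on23 s f = assoc_inv s s s \<circ> tensor_map s tscale id f \<circ> assoc s s s"

text \<open>\<open>middle s f\<close> is \<open>V \<otimes> f \<otimes> V\<close>, on \<open>(V \<otimes> V) \<otimes> (V \<otimes> V)\<close>.\<close>

definition middle ::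
  "('k::field \<Rightarrow> 'a::ab_group_add \<Rightarrow> 'a) \<Rightarrow> (('k, 'a, 'a) tensors \<Rightarrow> ('k, 'a, 'a) tensors)
    \<Rightarrow> ('k, ('k, 'a, 'a) tensors, ('k, 'a, 'a) tensors) tensors
    \<Rightarrow> ('k, ('k, 'a, 'a) tensors, ('k, 'a, 'a) tensors) tensors" where
  "middle s f =
      assoc tscale s s \<circ> tensor_map tscale s (on23 s f) id \<circ> assoc_inv tscale s s"

definition braided_vector_space ::
  "('k::field \<Rightarrow> 'a::ab_group_add \<Rightarrow> 'a) \<Rightarrow> 'a set
    \<Rightarrow> (('k, 'a, 'a) tensors \<Rightarrow> ('k, 'a, 'a) tensors) \<Rightarrow> bool" where
  "braided_vector_space s V c \<longleftrightarrow>
    (let VV = tensor_space s s V V; VVV = tensor_space tscale s VV V in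
      vector_space s \<and> module.subspace s V \<and> linear_between tscale tscale VV VV c \<and>
      (\<forall>t\<in>VVV. on12 s c (on23 s c (on12 s c t)) = on23 s c (on12 s c (on23 s c t))))"

definition braided_algebra ::
  "('k::field \<Rightarrow> 'a::ab_group_add \<Rightarrow> 'a) \<Rightarrow> 'a set \<Rightarrow> (('k, 'a, 'a) tensors \<Rightarrow> 'a)
    \<Rightarrow> ('k \<Rightarrow> 'a) \<Rightarrow> (('k, 'a, 'a) tensors \<Rightarrow> ('k, 'a, 'a) tensors) \<Rightarrow> bool" where
  "braided_algebra s A m u c \<longleftrightarrow>
    (let AA = tensor_space s s A A; AAA = tensor_space tscale s AA A in
      braided_vector_space s A c \<and>
      linear_between tscale s AA A m \<and> linear_between (*) s UNIV A u \<and>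
      (\<forall>t\<in>AAA. m (tensor_map s s m id t) = m (tensor_map s s id m (assoc s s s t))) \<and>
      (\<forall>x\<in>A. m (tensor s s (u 1) x) = x \<and> m (tensor s s x (u 1)) = x) \<and>
      (\<forall>t\<in>AAA. c (tensor_map s s m id t) =
          tensor_map s s id m (assoc s s s (on12 s c (on23 s c t)))) \<and>
      (\<forall>t\<in>AAA. c (tensor_map s s id m (assoc s s s t)) =
          tensor_map s s m id (on23 s c (on12 s c t))) \<and>
      (\<forall>a. \<forall>x\<in>A. c (tensor s s (u a) x) = tensor s s x (u a)) \<and>
      (\<forall>a. \<forall>x\<in>A. c (tensor s s x (u a)) = tensor s s (u a) x))"

definition braided_coalgebra ::
  "('k::field \<Rightarrow> 'a::ab_group_add \<Rightarrow> 'a) \<Rightarrow> 'a set \<Rightarrow> ('a \<Rightarrow> ('k, 'a, 'a) tensors)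
    \<Rightarrow> ('a \<Rightarrow> 'k) \<Rightarrow> (('k, 'a, 'a) tensors \<Rightarrow> ('k, 'a, 'a) tensors) \<Rightarrow> bool" where
  "braided_coalgebra s C D e c \<longleftrightarrow>
    (let CC = tensor_space s s C C in
      braided_vector_space s C c \<and>
      linear_between s tscale C CC D \<and> linear_between s (*) C UNIV e \<and>
      (\<forall>x\<in>C. assoc s s s (tensor_map tscale s D id (D x)) = tensor_map s tscale id D (D x)) \<and>
      (\<forall>x\<in>C. left_unitor s (tensor_map (*) s e id (D x)) = x \<and>
             right_unitor s (tensor_map s (*) id e (D x)) = x) \<and>
      (\<forall>t\<in>CC. tensor_map tscale s D id (c t) =
          on23 s c (on12 s c (assoc_inv s s s (tensor_map s tscale id D t)))) \<and>
      (\<forall>t\<in>CC. assoc_inv s s s (tensor_map s tscale id D (c t)) =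
          on12 s c (on23 s c (tensor_map tscale s D id t))) \<and>
      (\<forall>t\<in>CC. left_unitor s (tensor_map (*) s e id (c t)) =
          right_unitor s (tensor_map s (*) id e t)) \<and>
      (\<forall>t\<in>CC. right_unitor s (tensor_map s (*) id e (c t)) =
          left_unitor s (tensor_map (*) s e id t)))"

record (overloaded) ('k::field, 'a) gr_brd_bialg =
  scale :: "'k \<Rightarrow> 'a \<Rightarrow> 'a"
  carrier :: "'a set"
  mult :: "('k, 'a, 'a) tensors \<Rightarrow> 'a"
  unit_map :: "'k \<Rightarrow> 'a"
  comult :: "'a \<Rightarrow> ('k, 'a, 'a) tensors"
  counit :: "'a \<Rightarrow> 'k"
  braiding :: "('k, 'a, 'a) tensors \<Rightarrow> ('k, 'a, 'a) tensors"
  component :: "nat \<Rightarrow> 'a set"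

abbreviation btensor ::
  "('k::field, 'a::ab_group_add) gr_brd_bialg \<Rightarrow> 'a \<Rightarrow> 'a \<Rightarrow> ('k, 'a, 'a) tensors" where
  "btensor B \<equiv> tensor (scale B) (scale B)"

abbreviation btensor_space ::
  "('k::field, 'a::ab_group_add) gr_brd_bialg \<Rightarrow> 'a set \<Rightarrow> 'a set \<Rightarrow> ('k, 'a, 'a) tensors set" where
  "btensor_space B \<equiv> tensor_space (scale B) (scale B)"

definition braided_bialgebra :: "('k::field, 'a::ab_group_add) gr_brd_bialg \<Rightarrow> bool" where
  "braided_bialgebra B \<longleftrightarrow>
    braided_algebra (scale B) (carrier B) (mult B) (unit_map B) (braiding B) \<and>
    braided_coalgebra (scale B) (carrier B) (comult B) (counit B) (braiding B) \<and>
    (\<forall>t\<in>btensor_space B (carrier B) (carrier B). comult B (mult B t) =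
        tensor_map (scale B) (scale B) (mult B) (mult B)
          (middle (scale B) (braiding B) (tensor_map tscale tscale (comult B) (comult B) t))) \<and>
    comult B (unit_map B 1) = btensor B (unit_map B 1) (unit_map B 1) \<and>
    counit B (unit_map B 1) = 1 \<and>
    (\<forall>x\<in>carrier B. \<forall>y\<in>carrier B. counit B (mult B (btensor B x y)) = counit B x * counit B y)"

definition internal_direct_sum ::
  "('k::field \<Rightarrow> 'a::ab_group_add \<Rightarrow> 'a) \<Rightarrow> 'a set \<Rightarrow> (nat \<Rightarrow> 'a set) \<Rightarrow> bool" where
  "internal_direct_sum s V W \<longleftrightarrow>
    (\<forall>n. module.subspace s (W n) \<and> W n \<subseteq> V) \<and>
    (\<forall>x\<in>V. \<exists>!f. (\<forall>n. f n \<in> W n) \<and> finite {n. f n \<noteq> 0} \<and> x = (\<Sum>n | f n \<noteq> 0. f n))"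

definition graded_braided_bialgebra :: "('k::field, 'a::ab_group_add) gr_brd_bialg \<Rightarrow> bool" where
  "graded_braided_bialgebra B \<longleftrightarrow>
    braided_bialgebra B \<and>
    internal_direct_sum (scale B) (carrier B) (component B) \<and>
    (\<forall>a b. mult B ` btensor_space B (component B a) (component B b) \<subseteq> component B (a + b)) \<and>
    (\<forall>n. comult B ` component B n \<subseteq>
      module.span tscale (\<Union>a\<le>n. btensor_space B (component B a) (component B (n - a)))) \<and>
    (\<forall>a b. braiding B ` btensor_space B (component B a) (component B b)
        \<subseteq> btensor_space B (component B b) (component B a)) \<and>
    (\<forall>n>0. \<forall>x\<in>component B n. counit B x = 0)"

definition strongly_graded :: "('k::field, 'a::ab_group_add) gr_brd_bialg \<Rightarrow> bool" where
  "strongly_graded B \<longleftrightarrow>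
    (\<forall>i j. mult B ` btensor_space B (component B i) (component B j) = component B (i + j))"

text \<open>Homomorphisms and isomorphisms of graded braided bialgebras:\<close>

definition gbb_hom ::
  "('k::field, 'a::ab_group_add) gr_brd_bialg \<Rightarrow> ('k, 'b::ab_group_add) gr_brd_bialg
    \<Rightarrow> ('a \<Rightarrow> 'b) \<Rightarrow> bool" where
  "gbb_hom A B f \<longleftrightarrow>
    (let ff = tensor_map (scale B) (scale B) f f;
         AA = btensor_space A (carrier A) (carrier A) in
      linear_between (scale A) (scale B) (carrier A) (carrier B) f \<and>
      (\<forall>t\<in>AA. f (mult A t) = mult B (ff t)) \<and>
      (\<forall>a. f (unit_map A a) = unit_map B a) \<and>
      (\<forall>x\<in>carrier A. ff (comult A x) = comult B (f x)) \<and>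
      (\<forall>x\<in>carrier A. counit B (f x) = counit A x) \<and>
      (\<forall>t\<in>AA. ff (braiding A t) = braiding B (ff t)) \<and>
      (\<forall>n. f ` component A n \<subseteq> component B n))"

definition gbb_iso ::
  "('k::field, 'a::ab_group_add) gr_brd_bialg \<Rightarrow> ('k, 'b::ab_group_add) gr_brd_bialg
    \<Rightarrow> ('a \<Rightarrow> 'b) \<Rightarrow> bool" where
  "gbb_iso A B f \<longleftrightarrow> gbb_hom A B f \<and> bij_betw f (carrier A) (carrier B)"

section \<open>The functor S\<close>

text \<open>The projection of \<open>B\<close> onto its homogeneous component of degree \<open>n\<close>:\<close>

definition hom_proj :: "('k::field, 'a::ab_group_add) gr_brd_bialg \<Rightarrow> nat \<Rightarrow> 'a \<Rightarrow> 'a" where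
  "hom_proj B n = (SOME f. Vector_Spaces.linear (scale B) (scale B) f \<and>
      (\<forall>x\<in>component B n. f x = x) \<and> (\<forall>m x. m \<noteq> n \<longrightarrow> x \<in> component B m \<longrightarrow> f x = 0))"

definition comult_comp ::
  "('k::field, 'a::ab_group_add) gr_brd_bialg \<Rightarrow> nat \<Rightarrow> nat \<Rightarrow> 'a \<Rightarrow> ('k, 'a, 'a) tensors" where
  "comult_comp B a b x =
    tensor_map (scale B) (scale B) (hom_proj B a) (hom_proj B b) (comult B x)"

definition E_comp :: "('k::field, 'a::ab_group_add) gr_brd_bialg \<Rightarrow> nat \<Rightarrow> 'a set" where
  "E_comp B n =
    {x \<in> component B n. \<forall>a b. a \<ge> 1 \<longrightarrow> b \<ge> 1 \<longrightarrow> a + b = n \<longrightarrow> comult_comp B a b x = 0}"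

definition E_space :: "('k::field, 'a::ab_group_add) gr_brd_bialg \<Rightarrow> 'a set" where
  "E_space B = module.span (scale B) (\<Union>n\<in>{2..}. E_comp B n)"

definition two_sided_ideal :: "('k::field, 'a::ab_group_add) gr_brd_bialg \<Rightarrow> 'a set \<Rightarrow> bool" where
  "two_sided_ideal B I \<longleftrightarrow> module.subspace (scale B) I \<and> I \<subseteq> carrier B \<and>
    (\<forall>x\<in>I. \<forall>y\<in>carrier B. mult B (btensor B x y) \<in> I \<and> mult B (btensor B y x) \<in> I)"

definition ideal_generated :: "('k::field, 'a::ab_group_add) gr_brd_bialg \<Rightarrow> 'a set \<Rightarrow> 'a set" where
  "ideal_generated B X = \<Inter>{I. two_sided_ideal B I \<and> X \<subseteq> I}"

definition S_proj :: "('k::field, 'a::ab_group_add) gr_brd_bialg \<Rightarrow> 'a \<Rightarrow> 'a" where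
  "S_proj B = quot_proj (scale B) (carrier B) (ideal_generated B (E_space B))"

text \<open>
  The structure maps of \<open>S(B) = B / (E(B))\<close> are those making the projection a homomorphism.  As elements
  of the quotient are their own representatives in \<open>B\<close>, they are computed by applying the structure
  map of \<open>B\<close> and projecting the result.
\<close>

definition S_bialg ::
  "('k::field, 'a::ab_group_add) gr_brd_bialg \<Rightarrow> ('k, 'a) gr_brd_bialg" where
  "S_bialg B = (let p = S_proj B; pp = tensor_map (scale B) (scale B) p p in
    \<lparr> scale = scale B,
      carrier = p ` carrier B,
      mult = p \<circ> mult B,
      unit_map = p \<circ> unit_map B,
      comult = pp \<circ> comult B,
      counit = counit B,
      braiding = pp \<circ> braiding B,
      component = (\<lambda>n. p ` component B n) \<rparr>)"

definition S_iter ::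
  "nat \<Rightarrow> ('k::field, 'a::ab_group_add) gr_brd_bialg \<Rightarrow> ('k, 'a) gr_brd_bialg" where
  "S_iter n B = (S_bialg ^^ n) B"

definition sdeg :: "('k::field, 'a::ab_group_add) gr_brd_bialg \<Rightarrow> enat" where
  "sdeg B = Inf {enat t | t. gbb_iso (S_iter t B) (S_iter (Suc t) B) (S_proj (S_iter t B))}"

section \<open>The direct limit\<close>

text \<open>
  The direct limit of \<open>A 0 \<rightarrow> A 1 \<rightarrow> \<dots>\<close> along \<open>f i : A i \<rightarrow> A (i + 1)\<close> is the direct sum of the \<open>A i\<close> modulo
  the elements \<open>x - f i x\<close> for \<open>x\<close> in the \<open>i\<close>-th summand.  The direct sum is formed inside
  \<open>nat \<Rightarrow>\<^sub>0 'a\<close>; all \<open>A i\<close> are assumed to share the ambient space of \<open>A 0\<close>.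
\<close>

definition dirlim_sum ::
  "(nat \<Rightarrow> ('k::field, 'a::ab_group_add) gr_brd_bialg) \<Rightarrow> (nat \<Rightarrow>\<^sub>0 'a) set" where
  "dirlim_sum A = {p. \<forall>i. Poly_Mapping.lookup p i \<in> carrier (A i)}"

definition dirlim_relations ::
  "(nat \<Rightarrow> ('k::field, 'a::ab_group_add) gr_brd_bialg) \<Rightarrow> (nat \<Rightarrow> 'a \<Rightarrow> 'a) \<Rightarrow> (nat \<Rightarrow>\<^sub>0 'a) set" where
  "dirlim_relations A f = module.span (pm_scale (scale (A 0)))
     {Poly_Mapping.single i x - Poly_Mapping.single (Suc i) (f i x) | i x. x \<in> carrier (A i)}"

definition dirlim_proj ::
  "(nat \<Rightarrow> ('k::field, 'a::ab_group_add) gr_brd_bialg) \<Rightarrow> (nat \<Rightarrow> 'a \<Rightarrow> 'a)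
    \<Rightarrow> (nat \<Rightarrow>\<^sub>0 'a) \<Rightarrow> (nat \<Rightarrow>\<^sub>0 'a)" where
  "dirlim_proj A f =
    quot_proj (pm_scale (scale (A 0))) (dirlim_sum A) (dirlim_relations A f)"

definition dirlim_inj ::
  "(nat \<Rightarrow> ('k::field, 'a::ab_group_add) gr_brd_bialg) \<Rightarrow> (nat \<Rightarrow> 'a \<Rightarrow> 'a)
    \<Rightarrow> nat \<Rightarrow> 'a \<Rightarrow> (nat \<Rightarrow>\<^sub>0 'a)" where
  "dirlim_inj A f i x = dirlim_proj A f (Poly_Mapping.single i x)"

text \<open>
  The structure maps on the direct limit are the ones, unique on the carrier, for which all the
  canonical maps from the \<open>A i\<close> are homomorphisms.
\<close>

definition dirlim ::
  "(nat \<Rightarrow> ('k::field, 'a::ab_group_add) gr_brd_bialg) \<Rightarrow> (nat \<Rightarrow> 'a \<Rightarrow> 'a)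
    \<Rightarrow> ('k, nat \<Rightarrow>\<^sub>0 'a) gr_brd_bialg" where
  "dirlim A f =
    (let s = pm_scale (scale (A 0)); j = dirlim_inj A f;
         jj = (\<lambda>i. tensor_map s s (j i) (j i));
         AA = (\<lambda>i. btensor_space (A i) (carrier (A i)) (carrier (A i))) in
    \<lparr> scale = s,
      carrier = dirlim_proj A f ` dirlim_sum A,
      mult = (SOME h. Vector_Spaces.linear tscale s h \<and>
        (\<forall>i. \<forall>t\<in>AA i. h (jj i t) = j i (mult (A i) t))),
      unit_map = j 0 \<circ> unit_map (A 0),
      comult = (SOME h. Vector_Spaces.linear s tscale h \<and>
        (\<forall>i. \<forall>x\<in>carrier (A i). h (j i x) = jj i (comult (A i) x))),
      counit = (SOME h. Vector_Spaces.linear s (*) h \<and>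
        (\<forall>i. \<forall>x\<in>carrier (A i). h (j i x) = counit (A i) x)),
      braiding = (SOME h. Vector_Spaces.linear tscale tscale h \<and>
        (\<forall>i. \<forall>t\<in>AA i. h (jj i t) = jj i (braiding (A i) t))),
      component = (\<lambda>n. \<Union>i. j i ` component (A i) n) \<rparr>)"

definition S_infinity ::
  "('k::field, 'a::ab_group_add) gr_brd_bialg \<Rightarrow> ('k, nat \<Rightarrow>\<^sub>0 'a) gr_brd_bialg" where
  "S_infinity B = dirlim (\<lambda>i. S_iter i B) (\<lambda>i. S_proj (S_iter i B))"

end

theory Submission
  imports Defs
begin

text \<open>
  Write \<open>B\<^sub>k\<close> for the \<open>k\<close>-th iterate of \<open>S\<close> on \<open>B\<close>. The theorem rests on one fact: \<open>E\<^sub>n(B\<^sub>k) = 0\<close>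
  for \<open>2 \<le> n \<le> k + 1\<close>. It follows by induction on \<open>k\<close> from \<open>E_S_zero\<close>: if \<open>E\<^sub>m(B) = 0\<close> whenever
  \<open>2 \<le> m < d\<close>, then the ideal \<open>I\<close> generated by \<open>E(B)\<close> vanishes in degrees below \<open>d\<close>, and in degree
  \<open>d\<close> it consists of \<open>E\<^sub>d(B)\<close> alone, because \<open>E\<^sub>d(B)\<close> is stable under multiplication by degree \<open>0\<close>
  (\<open>I_low_degree\<close>). The components of the coproduct that define \<open>E\<^sub>n\<close> for \<open>n \<le> d\<close> take values in
  tensor products of components of degree below \<open>d\<close>, on which the projection to \<open>B/I\<close> is
  injective. Hence an element of \<open>E\<^sub>n(B/I)\<close> lifts to \<open>E\<^sub>n(B)\<close>, and so is zero in \<open>B/I\<close>.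

  Consequently the projection \<open>B\<^sub>k \<rightarrow> B\<^sub>k\<^sub>+\<^sub>1\<close> is injective in degree \<open>N\<close> as soon as \<open>N \<le> k + 1\<close>,
  so that the component of degree \<open>N\<close> of the direct limit is already that of \<open>B\<^sub>N\<^sub>-\<^sub>1\<close>. This gives
  the equivalence of the first and the third condition. In a strongly graded algebra a vanishing
  component of degree \<open>N\<close> forces all higher ones to vanish, since these are products with it. If
  they do vanish for \<open>B\<^sub>N\<^sub>-\<^sub>1\<close>, then \<open>E(B\<^sub>N\<^sub>-\<^sub>1) = 0\<close>: in degrees up to \<open>N\<close> by the fact above, in
  higher degrees trivially. The next projection is then an isomorphism, which bounds the
  strongness degree.

  To iterate, the quotient by \<open>I\<close> must inherit the structure. For this \<open>I\<close> has to be a graded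
  coideal that the braiding moves past \<open>B\<close> (\<open>I_graded\<close>, \<open>comult_I\<close>, \<open>braiding_I\<close>). For the
  generators this comes from coassociativity and from the compatibility of braiding and coproduct.
\<close>

section \<open>Linear maps and tensor products of subspaces\<close>

abbreviation lin where "lin \<equiv> Vector_Spaces.linear"

lemma vs_tensors: "vector_space (tscale :: 'k::field \<Rightarrow> ('k, 'a, 'b) tensors \<Rightarrow> _)"
  by (intro vector_space_pm_scale vector_space_mult)

lemma
  assumes "lin s1 s2 f"
  shows lin_add: "f (x + y) = f x + f y"
    and lin_diff: "f (x - y) = f x - f y"
    and lin_scale: "f (s1 a x) = s2 a (f x)"
    and lin_zero: "f 0 = 0"
    and lin_dom: "vector_space s1"
    and lin_cod: "vector_space s2"
proof -
  interpret Vector_Spaces.linear s1 s2 f by fact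
  show "f (x + y) = f x + f y" "f (x - y) = f x - f y" "f (s1 a x) = s2 a (f x)" "f 0 = 0"
    by (rule add diff scale zero)+
  show "vector_space s1" "vector_space s2" by unfold_locales
qed

lemma lin_ident: "vector_space s \<Longrightarrow> lin s s (\<lambda>x. x)"
  by (rule vector_space.linear_ident)

lemma lin_id: "vector_space s \<Longrightarrow> lin s s id"
  by (rule vector_space.linear_id)

lemma lin_comp: "lin s2 s3 g \<Longrightarrow> lin s1 s2 f \<Longrightarrow> lin s1 s3 (\<lambda>x. g (f x))"
  by (simp add: Vector_Spaces.linear_iff)

lemma span_mapI:
  assumes f: "lin s1 s2 f" and Z: "module.subspace s2 Z"
    and X: "\<And>x. x \<in> X \<Longrightarrow> f x \<in> Z" and x: "x \<in> module.span s1 X"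
  shows "f x \<in> Z"
proof -
  interpret Vector_Spaces.linear s1 s2 f by fact
  from x show ?thesis
    by (induction rule: vs1.span_induct_alt)
      (auto simp: add scale zero intro!: X vs2.subspace_add[OF Z] vs2.subspace_scale[OF Z]
        vs2.subspace_0[OF Z])
qed

lemma span_eqI:
  assumes f: "lin s1 s2 f" and g: "lin s1 s2 g"
    and X: "\<And>x. x \<in> X \<Longrightarrow> f x = g x" and x: "x \<in> module.span s1 X"
  shows "f x = g x"
proof -
  interpret f: Vector_Spaces.linear s1 s2 f by fact
  interpret g: Vector_Spaces.linear s1 s2 g by fact
  from x show ?thesis
    by (induction rule: f.vs1.span_induct_alt) (auto simp: f.add f.scale f.zero g.add g.scale g.zero X)
qed

lemma lin_subspace_vimage:
  assumes f: "lin s1 s2 f" and Z: "module.subspace s2 Z"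
  shows "module.subspace s1 {x. f x \<in> Z}"
proof -
  interpret Vector_Spaces.linear s1 s2 f by fact
  show ?thesis
    using vs2.subspace_add[OF Z] vs2.subspace_scale[OF Z] vs2.subspace_0[OF Z]
    by (auto simp: vs1.subspace_def add scale zero)
qed

lemma lin_subspace_image:
  assumes f: "lin s1 s2 f" and Z: "module.subspace s1 Z"
  shows "module.subspace s2 (f ` Z)"
proof -
  interpret Vector_Spaces.linear s1 s2 f by fact
  show ?thesis by (rule subspace_image[OF Z])
qed

lemma subspace_Ball:
  assumes "vector_space s" "module.subspace s I" "\<And>i. i \<in> A \<Longrightarrow> module.subspace s {x. P i x}"
  shows "module.subspace s {x\<in>I. \<forall>i\<in>A. P i x}"
proof -
  interpret vector_space s by fact
  show ?thesis using assms(2,3) by (auto simp: subspace_def)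
qed

lemma subspace_Int2: "vector_space s \<Longrightarrow> module.subspace s X \<Longrightarrow> module.subspace s Y \<Longrightarrow>
  module.subspace s (X \<inter> Y)"
  by (metis module.subspace_inter module_iff_vector_space)

lemma subspace_triv: "vector_space s \<Longrightarrow> module.subspace s {0}"
  by (metis module.subspace_single_0 module_iff_vector_space)

lemma subspace_tensor_space: "module.subspace tscale (tensor_space s1 s2 V W)"
  unfolding tensor_space_def by (rule module.subspace_span) (simp add: module_iff_vector_space
    vs_tensors)

lemma tensor_in [intro]: "x \<in> V \<Longrightarrow> y \<in> W \<Longrightarrow> tensor s1 s2 x y \<in> tensor_space s1 s2 V W"
  unfolding tensor_space_def
  by (rule module.span_base) (auto simp: module_iff_vector_space vs_tensors)

lemma lin_tensor_right:
  fixes s2 :: "'k::field \<Rightarrow> 'b::ab_group_add \<Rightarrow> 'b"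
  shows "lin s s2 h \<Longrightarrow> lin s tscale (\<lambda>y. tensor s1 s2 x (h y))"
  by (simp add: Vector_Spaces.linear_iff vs_tensors tensor_add_right tensor_scale_right)

lemma lin_tensor_left:
  fixes s1 :: "'k::field \<Rightarrow> 'b::ab_group_add \<Rightarrow> 'b"
  shows "lin s s1 h \<Longrightarrow> lin s tscale (\<lambda>x. tensor s1 s2 (h x) y)"
  by (simp add: Vector_Spaces.linear_iff vs_tensors tensor_add_left tensor_scale_left)

lemma lin_lift: "vector_space s' \<Longrightarrow> lin s tscale h \<Longrightarrow> lin s s' (\<lambda>x. tensor_lift s' f (h x))"
  by (rule lin_comp[OF linear_tensor_lift])

lemma lin_tensor_map: "lin s tscale h \<Longrightarrow> lin s tscale (\<lambda>x. tensor_map s1 s2 f g (h x))"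
  unfolding tensor_map_def by (rule lin_lift[OF vs_tensors])

lemma lin_assoc: "lin s tscale h \<Longrightarrow> lin s tscale (\<lambda>x. assoc s1 s2 s3 (h x))"
  unfolding assoc_def by (rule lin_lift[OF vs_tensors])

lemma lin_assoc_inv: "lin s tscale h \<Longrightarrow> lin s tscale (\<lambda>x. assoc_inv s1 s2 s3 (h x))"
  unfolding assoc_inv_def by (rule lin_lift[OF vs_tensors])

lemma lin_on12: "lin s tscale h \<Longrightarrow> lin s tscale (\<lambda>x. on12 s1 f (h x))"
  unfolding on12_def by (rule lin_tensor_map)

lemma lin_on23: "lin s tscale h \<Longrightarrow> lin s tscale (\<lambda>x. on23 s1 f (h x))"
  unfolding on23_def comp_def by (intro lin_assoc lin_assoc_inv lin_tensor_map)

lemma lin_middle: "lin s tscale h \<Longrightarrow> lin s tscale (\<lambda>x. middle s1 f (h x))"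
  unfolding middle_def comp_def by (intro lin_assoc lin_assoc_inv lin_tensor_map)

lemmas lin_intros = lin_tensor_right lin_tensor_left lin_tensor_map lin_assoc lin_assoc_inv
  lin_on12 lin_on23 lin_middle

lemma tensor_map_tensor:
  assumes "lin s1 s1' f" "lin s2 s2' g"
  shows "tensor_map s1' s2' f g (tensor s1 s2 x y) = tensor s1' s2' (f x) (g y)"
  unfolding tensor_map_def
  by (rule tensor_lift_tensor) (intro vs_tensors lin_tensor_left lin_tensor_right assms)+

lemma tensor_zero_left: "vector_space s1 \<Longrightarrow> tensor s1 s2 0 y = 0"
  by (rule lin_zero[OF lin_tensor_left[OF lin_ident]])

lemma tensor_zero_right: "vector_space s2 \<Longrightarrow> tensor s1 s2 x 0 = 0"
  by (rule lin_zero[OF lin_tensor_right[OF lin_ident]])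

lemma tensor_space_zero_left: "vector_space s1 \<Longrightarrow> tensor_space s1 s2 {0} W \<subseteq> {0}"
  unfolding tensor_space_def
  by (rule module.span_minimal) (auto simp: tensor_zero_left module_iff_vector_space vs_tensors
    subspace_triv)

lemma tensor_space_mono: "V \<subseteq> V' \<Longrightarrow> W \<subseteq> W' \<Longrightarrow> tensor_space s1 s2 V W \<subseteq> tensor_space s1 s2 V' W'"
  unfolding tensor_space_def
  by (rule module.span_mono) (auto simp: module_iff_vector_space vs_tensors)

lemma tensor_space_mapI:
  assumes "lin tscale s' h" "module.subspace s' X"
    and "\<And>x y. x \<in> V \<Longrightarrow> y \<in> W \<Longrightarrow> h (tensor s1 s2 x y) \<in> X" "t \<in> tensor_space s1 s2 V W"
  shows "h t \<in> X"
  using span_mapI[OF assms(1,2) _ assms(4)[unfolded tensor_space_def]] assms(3) by blast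

lemma tensor_space_eqI:
  assumes "lin tscale s' h" "lin tscale s' h'"
    and "\<And>x y. x \<in> V \<Longrightarrow> y \<in> W \<Longrightarrow> h (tensor s1 s2 x y) = h' (tensor s1 s2 x y)"
    and "t \<in> tensor_space s1 s2 V W"
  shows "h t = h' t"
  using span_eqI[OF assms(1,2) _ assms(4)[unfolded tensor_space_def]] assms(3) by blast

lemma tensor_space_span:
  assumes "vector_space s1" "vector_space s2"
  shows "tensor_space s1 s2 (module.span s1 X) (module.span s2 Y) = tensor_space s1 s2 X Y"
proof
  have m: "module s1" "module s2" using assms by (auto simp: module_iff_vector_space)
  have "tensor s1 s2 x y \<in> tensor_space s1 s2 X Y"
    if "x \<in> module.span s1 X" "y \<in> module.span s2 Y" for x y
    by (rule span_mapI[OF lin_tensor_left[OF lin_ident[OF assms(1)]] subspace_tensor_space _ that(1)])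
      (rule span_mapI[OF lin_tensor_right[OF lin_ident[OF assms(2)]] subspace_tensor_space _
        that(2)], blast)
  then show "tensor_space s1 s2 (module.span s1 X) (module.span s2 Y) \<subseteq> tensor_space s1 s2 X Y"
    unfolding tensor_space_def[of s1 s2 "module.span s1 X"]
    by (intro module.span_minimal subspace_tensor_space) (auto simp: module_iff_vector_space vs_tensors)
  show "tensor_space s1 s2 X Y \<subseteq> tensor_space s1 s2 (module.span s1 X) (module.span s2 Y)"
    by (intro tensor_space_mono module.span_superset m)
qed

lemma tensor_map_in:
  assumes "lin s1 s1' f" "lin s2 s2' g" "\<And>x. x \<in> V \<Longrightarrow> f x \<in> V'" "\<And>y. y \<in> W \<Longrightarrow> g y \<in> W'"
    and "t \<in> tensor_space s1 s2 V W"
  shows "tensor_map s1' s2' f g t \<in> tensor_space s1' s2' V' W'"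
  by (rule tensor_space_mapI[OF lin_tensor_map[OF lin_ident[OF vs_tensors]] subspace_tensor_space _
    assms(5)])
    (auto simp: tensor_map_tensor[OF assms(1,2)] assms)

lemma tensor_map_square:
  assumes "lin s1 r1 f'" "lin r1 q1 f" "lin s1 r1' h'" "lin r1' q1 h"
    and "lin s2 r2 g'" "lin r2 q2 g" "lin s2 r2' k'" "lin r2' q2 k"
    and "\<And>x. x \<in> V \<Longrightarrow> f (f' x) = h (h' x)" "\<And>y. y \<in> W \<Longrightarrow> g (g' y) = k (k' y)"
    and "t \<in> tensor_space s1 s2 V W"
  shows "tensor_map q1 q2 f g (tensor_map r1 r2 f' g' t) = tensor_map q1 q2 h k (tensor_map r1' r2'
    h' k' t)"
  by (rule tensor_space_eqI[where s'=tscale, OF _ _ _ assms(11)]; (intro lin_intros lin_ident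
    vs_tensors)?)
    (simp add: tensor_map_tensor[OF assms(1) assms(5)] tensor_map_tensor[OF assms(2) assms(6)]
      tensor_map_tensor[OF assms(3) assms(7)] tensor_map_tensor[OF assms(4) assms(8)] assms(9,10))

lemma tensor_map_comp:
  assumes "lin s1 r1 f'" "lin r1 q1 f" "lin s2 r2 g'" "lin r2 q2 g" "lin s1 q1 h" "lin s2 q2 k"
    and "\<And>x. x \<in> V \<Longrightarrow> f (f' x) = h x" "\<And>y. y \<in> W \<Longrightarrow> g (g' y) = k y"
    and "t \<in> tensor_space s1 s2 V W"
  shows "tensor_map q1 q2 f g (tensor_map r1 r2 f' g' t) = tensor_map q1 q2 h k t"
  by (rule tensor_space_eqI[where s'=tscale, OF _ _ _ assms(9)]; (intro lin_intros lin_ident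
    vs_tensors)?)
    (simp add: tensor_map_tensor[OF assms(1) assms(3)] tensor_map_tensor[OF assms(2) assms(4)]
      tensor_map_tensor[OF assms(5) assms(6)] assms(7,8))

lemma tensor_map_eq:
  assumes "lin s1 r1 f" "lin s1 r1 f'" "lin s2 r2 g" "lin s2 r2 g'"
    and "\<And>x. x \<in> V \<Longrightarrow> f x = f' x" "\<And>y. y \<in> W \<Longrightarrow> g y = g' y"
    and "t \<in> tensor_space s1 s2 V W"
  shows "tensor_map r1 r2 f g t = tensor_map r1 r2 f' g' t"
  by (rule tensor_space_eqI[where s'=tscale, OF _ _ _ assms(7)]; (intro lin_intros lin_ident
    vs_tensors)?)
    (simp add: tensor_map_tensor[OF assms(1) assms(3)] tensor_map_tensor[OF assms(2) assms(4)]
      assms(5,6))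

lemma tensor_map_ident:
  assumes "lin s1 s1 f" "lin s2 s2 g" "\<And>x. x \<in> V \<Longrightarrow> f x = x" "\<And>y. y \<in> W \<Longrightarrow> g y = y"
    and "t \<in> tensor_space s1 s2 V W"
  shows "tensor_map s1 s2 f g t = t"
  by (rule tensor_space_eqI[where s'=tscale, OF _ _ _ assms(5)]; (intro lin_intros lin_ident
    vs_tensors)?)
    (simp add: tensor_map_tensor[OF assms(1,2)] assms(3,4))

lemma tensor_map_image:
  assumes "lin s1 s1' f" "lin s2 s2' g"
  shows "tensor_space s1' s2' (f ` V) (g ` W) = tensor_map s1' s2' f g ` tensor_space s1 s2 V W"
proof
  show "tensor_map s1' s2' f g ` tensor_space s1 s2 V W \<subseteq> tensor_space s1' s2' (f ` V) (g ` W)"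
    using tensor_map_in[OF assms] by blast
  have "module.subspace tscale (tensor_map s1' s2' f g ` tensor_space s1 s2 V W)"
    by (rule lin_subspace_image[OF lin_tensor_map[OF lin_ident[OF vs_tensors]] subspace_tensor_space])
  then show "tensor_space s1' s2' (f ` V) (g ` W) \<subseteq> tensor_map s1' s2' f g ` tensor_space s1 s2 V W"
    unfolding tensor_space_def[of s1']
    by (intro module.span_minimal)
      (auto simp: module_iff_vector_space vs_tensors tensor_map_tensor[OF assms, symmetric])
qed

lemma tensor_map_zero:
  assumes "lin s1 r1 f" "lin s2 r2 g" "(\<forall>x\<in>V. f x = 0) \<or> (\<forall>y\<in>W. g y = 0)"
    and "t \<in> tensor_space s1 s2 V W"
  shows "tensor_map r1 r2 f g t = 0"
proof -
  have "tensor_map r1 r2 f g t \<in> {0}"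
    by (rule tensor_space_mapI[OF lin_tensor_map[OF lin_ident[OF vs_tensors]]
      subspace_triv[OF vs_tensors] _ assms(4)])
      (use assms(3) in \<open>auto simp: tensor_map_tensor[OF assms(1,2)]
        tensor_zero_left[OF lin_cod[OF assms(1)]]
        tensor_zero_right[OF lin_cod[OF assms(2)]]\<close>)
  then show ?thesis by simp
qed

text \<open>
  A linear map has a left inverse modulo its kernel. This replaces exactness of the tensor product
  in the next two lemmas.
\<close>

lemma factor_through_kernel:
  assumes f: "lin s1 s2 f" and V: "module.subspace s1 V"
  obtains q g where "lin s1 s1 q" "lin s2 s1 g" "\<And>x. x \<in> V \<Longrightarrow> g (f x) = q x"
    "\<And>x. x \<in> V \<Longrightarrow> x - q x \<in> V" "\<And>x. x \<in> V \<Longrightarrow> f (x - q x) = 0"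
proof -
  interpret Vector_Spaces.linear s1 s2 f by fact
  interpret vp: vector_space_pair s1 s2 ..
  define I where "I = V \<inter> {x. f x \<in> {0}}"
  have I: "vs1.subspace I" unfolding I_def
    by (intro subspace_Int2 vs1.vector_space_axioms V lin_subspace_vimage[OF f] vs2.subspace_single_0)
  note q = quot_proj_spec[OF vs1.vector_space_axioms V I]
  let ?q = "quot_proj s1 V I"
  have IV: "I \<subseteq> V" unfolding I_def by auto
  have lq: "lin s1 s1 ?q" using q(1)[OF IV] .
  have I_iff: "x \<in> I \<longleftrightarrow> x \<in> V \<and> f x = 0" for x unfolding I_def by auto
  have fq: "f (?q x) = f x" if "x \<in> V" for x
    using q(3)[OF IV that] by (simp add: I_iff diff)
  have "inj_on f (?q ` V)"
  proof (rule inj_onI, clarify)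
    fix x y assume xy: "x \<in> V" "y \<in> V" "f (?q x) = f (?q y)"
    then have "x - y \<in> I" using vs1.subspace_diff[OF V] by (simp add: I_iff diff fq)
    then have "?q (x - y) = 0" using q(4)[OF IV] by blast
    then show "?q x = ?q y" by (simp add: lin_diff[OF lq])
  qed
  then obtain g where g: "lin s2 s1 g" "\<forall>v\<in>?q ` V. g (f v) = v"
    using vp.linear_exists_left_inverse_on[OF f lin_subspace_image[OF lq V]] by blast
  show ?thesis
  proof (rule that[OF lq g(1)])
    fix x assume x: "x \<in> V"
    show "x - ?q x \<in> V" "f (x - ?q x) = 0" using q(3)[OF IV x] by (simp_all add: I_iff)
    show "g (f x) = ?q x" using g fq[OF x] x by force
  qed
qed

text \<open>
  With \<open>q\<close> and \<open>g\<close> as above, \<open>(id \<otimes> q) t = (id \<otimes> g) ((id \<otimes> f) t) = 0\<close>, so \<open>t\<close> equals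
  \<open>t - (id \<otimes> q) t\<close>, and \<open>id - q\<close> maps into the kernel of \<open>f\<close>.
\<close>

lemma tensor_kernel_right:
  assumes f: "lin s2 s f" and V: "module.subspace s2 W" and s1: "vector_space s1"
    and t: "t \<in> tensor_space s1 s2 V W" "tensor_map s1 s id f t = 0"
  shows "t \<in> tensor_space s1 s2 V {y\<in>W. f y = 0}"
proof -
  note s2 = lin_dom[OF f] and tt = tensor_map_tensor[OF lin_ident[OF s1]]
  obtain q g where q: "lin s2 s2 q" "lin s s2 g" "\<And>x. x \<in> W \<Longrightarrow> g (f x) = q x"
    "\<And>x. x \<in> W \<Longrightarrow> x - q x \<in> W" "\<And>x. x \<in> W \<Longrightarrow> f (x - q x) = 0"
    using factor_through_kernel[OF f V] by metis
  have "tensor_map s1 s2 id q t = tensor_map s1 s2 id g (tensor_map s1 s id f t)"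
    by (rule tensor_space_eqI[where s'=tscale, OF _ _ _ t(1)]; (intro lin_intros lin_ident vs_tensors)?)
      (simp add: tt[OF q(1)] tt[OF q(2)] tt[OF f] id_def q(3))
  also have "\<dots> = 0"
    unfolding t(2) by (rule lin_zero[OF lin_tensor_map[OF lin_ident[OF vs_tensors]]])
  finally have "t = t - tensor_map s1 s2 id q t" by simp
  also have "\<dots> \<in> tensor_space s1 s2 V {y\<in>W. f y = 0}"
  proof (rule tensor_space_mapI[OF _ subspace_tensor_space _ t(1)])
    show "lin tscale tscale (\<lambda>t. t - tensor_map s1 s2 id q t)"
      using lin_tensor_map[OF lin_ident[OF vs_tensors], of s1 s2 id q]
      by (auto simp: Vector_Spaces.linear_iff algebra_simps module.scale_right_diff_distrib
        module_iff_vector_space)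
    fix x y assume "x \<in> V" "y \<in> W"
    then have "tensor s1 s2 x (y - q y) \<in> tensor_space s1 s2 V {y\<in>W. f y = 0}"
      using q by auto
    then show "tensor s1 s2 x y - tensor_map s1 s2 id q (tensor s1 s2 x y)
      \<in> tensor_space s1 s2 V {y\<in>W. f y = 0}"
      by (simp add: tt[OF q(1)] id_def lin_diff[OF lin_tensor_right[OF lin_ident[OF s2]]])
  qed
  finally show ?thesis .
qed

lemma tensor_kernel_left:
  assumes f: "lin s1 s f" and V: "module.subspace s1 V" and s2: "vector_space s2"
    and t: "t \<in> tensor_space s1 s2 V W" "tensor_map s s2 f id t = 0"
  shows "t \<in> tensor_space s1 s2 {x\<in>V. f x = 0} W"
proof -
  note s1 = lin_dom[OF f] and tt = tensor_map_tensor[OF _ lin_ident[OF s2]]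
  obtain q g where q: "lin s1 s1 q" "lin s s1 g" "\<And>x. x \<in> V \<Longrightarrow> g (f x) = q x"
    "\<And>x. x \<in> V \<Longrightarrow> x - q x \<in> V" "\<And>x. x \<in> V \<Longrightarrow> f (x - q x) = 0"
    using factor_through_kernel[OF f V] by metis
  have "tensor_map s1 s2 q id t = tensor_map s1 s2 g id (tensor_map s s2 f id t)"
    by (rule tensor_space_eqI[where s'=tscale, OF _ _ _ t(1)]; (intro lin_intros lin_ident vs_tensors)?)
      (simp add: tt[OF q(1)] tt[OF q(2)] tt[OF f] id_def q(3))
  also have "\<dots> = 0"
    unfolding t(2) by (rule lin_zero[OF lin_tensor_map[OF lin_ident[OF vs_tensors]]])
  finally have "t = t - tensor_map s1 s2 q id t" by simp
  also have "\<dots> \<in> tensor_space s1 s2 {x\<in>V. f x = 0} W"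
  proof (rule tensor_space_mapI[OF _ subspace_tensor_space _ t(1)])
    show "lin tscale tscale (\<lambda>t. t - tensor_map s1 s2 q id t)"
      using lin_tensor_map[OF lin_ident[OF vs_tensors], of s1 s2 q id]
      by (auto simp: Vector_Spaces.linear_iff algebra_simps module.scale_right_diff_distrib
        module_iff_vector_space)
    fix x y assume "x \<in> V" "y \<in> W"
    then have "tensor s1 s2 (x - q x) y \<in> tensor_space s1 s2 {x\<in>V. f x = 0} W"
      using q by auto
    then show "tensor s1 s2 x y - tensor_map s1 s2 q id (tensor s1 s2 x y)
      \<in> tensor_space s1 s2 {x\<in>V. f x = 0} W"
      by (simp add: tt[OF q(1)] id_def lin_diff[OF lin_tensor_left[OF lin_ident[OF s1]]])
  qed
  finally show ?thesis .
qed

lemma tensor_map_injective: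
  assumes f: "lin s1 r1 f" "module.subspace s1 V" "\<And>x. x \<in> V \<Longrightarrow> f x = 0 \<Longrightarrow> x = 0"
    and g: "lin s2 r2 g" "module.subspace s2 W" "\<And>y. y \<in> W \<Longrightarrow> g y = 0 \<Longrightarrow> y = 0"
    and t: "t \<in> tensor_space s1 s2 V W" "tensor_map r1 r2 f g t = 0"
  shows "t = 0"
proof -
  note s1 = lin_dom[OF f(1)] and s2 = lin_dom[OF g(1)]
    and r1 = lin_cod[OF f(1)] and r2 = lin_cod[OF g(1)]
  interpret a: vector_space_pair s1 r1 using s1 r1 by (simp add: vector_space_pair_def)
  interpret b: vector_space_pair s2 r2 using s2 r2 by (simp add: vector_space_pair_def)
  have "inj_on f V"
    by (rule inj_onI) (metis f(3) a.vs1.subspace_diff[OF f(2)] lin_diff[OF f(1)] eq_iff_diff_eq_0)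
  moreover have "inj_on g W"
    by (rule inj_onI) (metis g(3) b.vs1.subspace_diff[OF g(2)] lin_diff[OF g(1)] eq_iff_diff_eq_0)
  ultimately obtain f' g' where f': "lin r1 s1 f'" "\<forall>v\<in>V. f' (f v) = v"
    and g': "lin r2 s2 g'" "\<forall>v\<in>W. g' (g v) = v"
    using a.linear_exists_left_inverse_on[OF f(1,2)] b.linear_exists_left_inverse_on[OF g(1,2)] by metis
  have "tensor_map s1 s2 f' g' (tensor_map r1 r2 f g t) = t"
    by (rule tensor_space_eqI[where s'=tscale, OF _ _ _ t(1)]; (intro lin_intros lin_ident vs_tensors)?)
      (simp add: tensor_map_tensor[OF f(1) g(1)] tensor_map_tensor[OF f'(1) g'(1)] f' g')
  then show ?thesis
    using t(2) lin_zero[OF lin_tensor_map[OF lin_ident[OF vs_tensors]], of s1 s2 f' g'] by simp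
qed

section \<open>Associators and braidings on iterated tensor products\<close>

lemma tensor3_eqI:
  assumes h: "lin tscale s' h" "lin tscale s' h'" and s3: "vector_space s3"
    and e: "\<And>x y z. x \<in> U \<Longrightarrow> y \<in> V \<Longrightarrow> z \<in> W \<Longrightarrow>
      h (tensor tscale s3 (tensor s1 s2 x y) z) = h' (tensor tscale s3 (tensor s1 s2 x y) z)"
    and t: "t \<in> tensor_space tscale s3 (tensor_space s1 s2 U V) W"
  shows "h t = h' t"
proof (rule tensor_space_eqI[OF h _ t])
  fix u z assume u: "u \<in> tensor_space s1 s2 U V" and z: "z \<in> W"
  show "h (tensor tscale s3 u z) = h' (tensor tscale s3 u z)"
    by (rule tensor_space_eqI[OF _ _ _ u, of s' "\<lambda>u. h (tensor tscale s3 u z)"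
      "\<lambda>u. h' (tensor tscale s3 u z)"])
      (intro lin_comp[OF h(1)] lin_comp[OF h(2)] lin_intros lin_ident vs_tensors | simp add: e z)+
qed

lemma tensor3'_eqI:
  assumes h: "lin tscale s' h" "lin tscale s' h'" and s3: "vector_space s1"
    and e: "\<And>x y z. x \<in> U \<Longrightarrow> y \<in> V \<Longrightarrow> z \<in> W \<Longrightarrow>
      h (tensor s1 tscale x (tensor s2 s3 y z)) = h' (tensor s1 tscale x (tensor s2 s3 y z))"
    and t: "t \<in> tensor_space s1 tscale U (tensor_space s2 s3 V W)"
  shows "h t = h' t"
proof (rule tensor_space_eqI[OF h _ t])
  fix u x assume u: "u \<in> tensor_space s2 s3 V W" and x: "x \<in> U"
  show "h (tensor s1 tscale x u) = h' (tensor s1 tscale x u)"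
    by (rule tensor_space_eqI[OF _ _ _ u, of s' "\<lambda>u. h (tensor s1 tscale x u)"
      "\<lambda>u. h' (tensor s1 tscale x u)"])
      (intro lin_comp[OF h(1)] lin_comp[OF h(2)] lin_intros lin_ident vs_tensors | simp add: e x)+
qed

lemma lin_lift_param:
  assumes s: "vector_space s" and s': "vector_space s'"
    and f: "\<And>x y. lin s s' (\<lambda>z. f z x y)"
  shows "lin s s' (\<lambda>z. tensor_lift s' (f z) t)"
proof -
  interpret s': vector_space s' by fact
  show ?thesis
    unfolding Vector_Spaces.linear_iff tensor_lift_def case_prod_unfold
    by (simp add: s s' lin_add[OF f] lin_scale[OF f] s'.scale_right_distrib sum.distrib
        s'.scale_sum_right mult.commute)
qed

lemma assoc_tensor:
  assumes s: "vector_space s1" "vector_space s2" "vector_space s3"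
  shows "assoc s1 s2 s3 (tensor tscale s3 (tensor s1 s2 x y) z) = tensor s1 tscale x (tensor s2 s3 y z)"
proof -
  have "assoc s1 s2 s3 (tensor tscale s3 (tensor s1 s2 x y) z)
      = tensor_lift tscale (\<lambda>x y. tensor s1 tscale x (tensor s2 s3 y z)) (tensor s1 s2 x y)"
    unfolding assoc_def
    by (rule tensor_lift_tensor) (intro lin_lift_param lin_lift lin_intros lin_ident s vs_tensors)+
  also have "\<dots> = tensor s1 tscale x (tensor s2 s3 y z)"
    by (rule tensor_lift_tensor) (intro lin_intros lin_ident s vs_tensors)+
  finally show ?thesis .
qed

lemma assoc_inv_tensor:
  assumes s: "vector_space s1" "vector_space s2" "vector_space s3"
  shows "assoc_inv s1 s2 s3 (tensor s1 tscale x (tensor s2 s3 y z)) = tensor tscale s3 (tensor s1 s2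
    x y) z"
proof -
  have "assoc_inv s1 s2 s3 (tensor s1 tscale x (tensor s2 s3 y z))
      = tensor_lift tscale (\<lambda>y z. tensor tscale s3 (tensor s1 s2 x y) z) (tensor s2 s3 y z)"
    unfolding assoc_inv_def
    by (rule tensor_lift_tensor) (intro lin_lift_param lin_lift lin_intros lin_ident s vs_tensors)+
  also have "\<dots> = tensor tscale s3 (tensor s1 s2 x y) z"
    by (rule tensor_lift_tensor) (intro lin_intros lin_ident s vs_tensors)+
  finally show ?thesis .
qed

lemma tensor3_mapI:
  assumes h: "lin tscale s' h" and X: "module.subspace s' X" and s3: "vector_space s3"
    and e: "\<And>x y z. x \<in> U \<Longrightarrow> y \<in> V \<Longrightarrow> z \<in> W \<Longrightarrow> h (tensor tscale s3 (tensor s1 s2 x y) z) \<in> X"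
    and t: "t \<in> tensor_space tscale s3 (tensor_space s1 s2 U V) W"
  shows "h t \<in> X"
proof (rule tensor_space_mapI[OF h X _ t])
  fix u z assume u: "u \<in> tensor_space s1 s2 U V" and z: "z \<in> W"
  show "h (tensor tscale s3 u z) \<in> X"
    by (rule tensor_space_mapI[OF _ X _ u, of "\<lambda>u. h (tensor tscale s3 u z)"])
      (intro lin_comp[OF h] lin_intros lin_ident vs_tensors | simp add: e z)+
qed

lemma tensor3'_mapI:
  assumes h: "lin tscale s' h" and X: "module.subspace s' X" and s3: "vector_space s1"
    and e: "\<And>x y z. x \<in> U \<Longrightarrow> y \<in> V \<Longrightarrow> z \<in> W \<Longrightarrow> h (tensor s1 tscale x (tensor s2 s3 y z)) \<in> X"
    and t: "t \<in> tensor_space s1 tscale U (tensor_space s2 s3 V W)"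
  shows "h t \<in> X"
proof (rule tensor_space_mapI[OF h X _ t])
  fix u x assume u: "u \<in> tensor_space s2 s3 V W" and x: "x \<in> U"
  show "h (tensor s1 tscale x u) \<in> X"
    by (rule tensor_space_mapI[OF _ X _ u, of "\<lambda>u. h (tensor s1 tscale x u)"])
      (intro lin_comp[OF h] lin_intros lin_ident vs_tensors | simp add: e x)+
qed

lemma assoc_in:
  assumes s: "vector_space s1" "vector_space s2" "vector_space s3"
    and t: "t \<in> tensor_space tscale s3 (tensor_space s1 s2 U V) W"
  shows "assoc s1 s2 s3 t \<in> tensor_space s1 tscale U (tensor_space s2 s3 V W)"
  by (rule tensor3_mapI[OF lin_assoc[OF lin_ident[OF vs_tensors]] subspace_tensor_space s(3) _ t])
    (simp add: assoc_tensor[OF s] tensor_in)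

lemma assoc_inv_in:
  assumes s: "vector_space s1" "vector_space s2" "vector_space s3"
    and t: "t \<in> tensor_space s1 tscale U (tensor_space s2 s3 V W)"
  shows "assoc_inv s1 s2 s3 t \<in> tensor_space tscale s3 (tensor_space s1 s2 U V) W"
  by (rule tensor3'_mapI[OF lin_assoc_inv[OF lin_ident[OF vs_tensors]] subspace_tensor_space s(1) _ t])
    (simp add: assoc_inv_tensor[OF s] tensor_in)

lemma assoc_assoc_inv:
  assumes s: "vector_space s1" "vector_space s2" "vector_space s3"
    and t: "t \<in> tensor_space s1 tscale U (tensor_space s2 s3 V W)"
  shows "assoc s1 s2 s3 (assoc_inv s1 s2 s3 t) = t"
  by (rule tensor3'_eqI[where s'=tscale, OF _ _ s(1) _ t]; (intro lin_intros lin_ident vs_tensors)?)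
    (simp add: assoc_tensor[OF s] assoc_inv_tensor[OF s])

lemma assoc_inv_assoc:
  assumes s: "vector_space s1" "vector_space s2" "vector_space s3"
    and t: "t \<in> tensor_space tscale s3 (tensor_space s1 s2 U V) W"
  shows "assoc_inv s1 s2 s3 (assoc s1 s2 s3 t) = t"
  by (rule tensor3_eqI[where s'=tscale, OF _ _ s(3) _ t]; (intro lin_intros lin_ident vs_tensors)?)
    (simp add: assoc_tensor[OF s] assoc_inv_tensor[OF s])

lemma assoc_natural:
  assumes f: "lin s1 r1 f" and g: "lin s2 r2 g" and h: "lin s3 r3 h"
    and t: "t \<in> tensor_space tscale s3 (tensor_space s1 s2 U V) W"
  shows "assoc r1 r2 r3 (tensor_map tscale r3 (tensor_map r1 r2 f g) h t)
    = tensor_map r1 tscale f (tensor_map r2 r3 g h) (assoc s1 s2 s3 t)"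
proof -
  note s = lin_dom[OF f] lin_dom[OF g] lin_dom[OF h] and r = lin_cod[OF f] lin_cod[OF g] lin_cod[OF h]
  show ?thesis
    by (rule tensor3_eqI[where s'=tscale, OF _ _ s(3) _ t]; (intro lin_intros lin_ident vs_tensors)?)
      (simp add: assoc_tensor[OF s] assoc_tensor[OF r] tensor_map_tensor[OF f g]
        tensor_map_tensor[OF g h]
        tensor_map_tensor[OF lin_tensor_map[OF lin_ident[OF vs_tensors]] h]
        tensor_map_tensor[OF f lin_tensor_map[OF lin_ident[OF vs_tensors]]])
qed

lemma assoc_inv_natural:
  assumes f: "lin s1 r1 f" and g: "lin s2 r2 g" and h: "lin s3 r3 h"
    and t: "t \<in> tensor_space s1 tscale U (tensor_space s2 s3 V W)"
  shows "assoc_inv r1 r2 r3 (tensor_map r1 tscale f (tensor_map r2 r3 g h) t)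
    = tensor_map tscale r3 (tensor_map r1 r2 f g) h (assoc_inv s1 s2 s3 t)"
proof -
  note s = lin_dom[OF f] lin_dom[OF g] lin_dom[OF h] and r = lin_cod[OF f] lin_cod[OF g] lin_cod[OF h]
  show ?thesis
    by (rule tensor3'_eqI[where s'=tscale, OF _ _ s(1) _ t]; (intro lin_intros lin_ident vs_tensors)?)
      (simp add: assoc_inv_tensor[OF s] assoc_inv_tensor[OF r] tensor_map_tensor[OF f g]
        tensor_map_tensor[OF g h]
        tensor_map_tensor[OF lin_tensor_map[OF lin_ident[OF vs_tensors]] h]
        tensor_map_tensor[OF f lin_tensor_map[OF lin_ident[OF vs_tensors]]])
qed

context
  fixes s :: "'k::field \<Rightarrow> 'a::ab_group_add \<Rightarrow> 'a"
    and c :: "('k, 'a, 'a) tensors \<Rightarrow> ('k, 'a, 'a) tensors"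
  assumes s: "vector_space s" and c: "lin tscale tscale c"
begin

lemma on12_in:
  assumes "\<And>u. u \<in> tensor_space s s U V \<Longrightarrow> c u \<in> tensor_space s s V' U'"
    and "t \<in> tensor_space tscale s (tensor_space s s U V) W"
  shows "on12 s c t \<in> tensor_space tscale s (tensor_space s s V' U') W"
  unfolding on12_def by (rule tensor_map_in[OF c lin_id[OF s] _ _ assms(2)]) (simp_all add: assms(1))

lemma on23_in:
  assumes "\<And>u. u \<in> tensor_space s s V W \<Longrightarrow> c u \<in> tensor_space s s W' V'"
    and "t \<in> tensor_space tscale s (tensor_space s s U V) W"
  shows "on23 s c t \<in> tensor_space tscale s (tensor_space s s U W') V'"
  unfolding on23_def comp_def
  by (intro assoc_inv_in s tensor_map_in[OF lin_id[OF s] c _ _ assoc_in[OF s s s assms(2)]])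
    (simp_all add: assms(1))

lemma middle_in:
  assumes "\<And>u. u \<in> tensor_space s s V W \<Longrightarrow> c u \<in> tensor_space s s W' V'"
    and "t \<in> tensor_space tscale tscale (tensor_space s s U V) (tensor_space s s W Z)"
  shows "middle s c t \<in> tensor_space tscale tscale (tensor_space s s U W') (tensor_space s s V' Z)"
  unfolding middle_def comp_def
proof (intro assoc_in s vs_tensors)
  have "lin tscale tscale (on23 s c)" by (intro lin_intros lin_ident vs_tensors)
  from tensor_map_in[OF this lin_id[OF s] on23_in[OF assms(1)] _
    assoc_inv_in[OF vs_tensors s s assms(2)]]
  show "tensor_map tscale s (on23 s c) id (assoc_inv tscale s s t)
    \<in> tensor_space tscale s (tensor_space tscale s (tensor_space s s U W') V') Z" by simp
qed

end

context
  fixes s :: "'k::field \<Rightarrow> 'a::ab_group_add \<Rightarrow> 'a" and p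
    and c c' :: "('k, 'a, 'a) tensors \<Rightarrow> ('k, 'a, 'a) tensors"
  assumes c: "lin tscale tscale c" and c': "lin tscale tscale c'" and p: "lin s s p"
begin

private abbreviation (input) "pp \<equiv> tensor_map s s p p"

private lemma lpp: "lin tscale tscale pp" "lin tscale tscale (on23 s c)" "lin tscale tscale (on23 s c')"
    "lin tscale tscale (tensor_map tscale s pp p)"
  by (intro lin_intros lin_ident vs_tensors)+

lemma on12_natural:
  assumes "\<And>u. u \<in> tensor_space s s U V \<Longrightarrow> c' (tensor_map s s p p u) = tensor_map s s p p (c u)"
    and "t \<in> tensor_space tscale s (tensor_space s s U V) W"
  shows "on12 s c' (tensor_map tscale s (tensor_map s s p p) p t)
    = tensor_map tscale s (tensor_map s s p p) p (on12 s c t)"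
  unfolding on12_def
  by (rule tensor_map_square[OF lpp(1) c' c lpp(1) p lin_id lin_id p _ _ assms(2)])
    (simp_all add: lin_dom[OF p] assms(1))

text \<open>
  Only the values of \<open>c\<close> on the given subspaces are controlled, so the lemmas on \<open>V \<otimes> c\<close> have to
  track in which subspace the intermediate tensors lie: this is the second hypothesis.
\<close>

lemma on23_natural:
  assumes "\<And>u. u \<in> tensor_space s s V W \<Longrightarrow> c' (tensor_map s s p p u) = tensor_map s s p p (c u)"
    and "\<And>u. u \<in> tensor_space s s V W \<Longrightarrow> c u \<in> tensor_space s s W' V'"
    and t: "t \<in> tensor_space tscale s (tensor_space s s U V) W"
  shows "on23 s c' (tensor_map tscale s (tensor_map s s p p) p t)
    = tensor_map tscale s (tensor_map s s p p) p (on23 s c t)"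
proof -
  note s = lin_dom[OF p]
  let ?t = "assoc s s s t"
  have t': "?t \<in> tensor_space s tscale U (tensor_space s s V W)" by (rule assoc_in[OF s s s t])
  have "on23 s c' (tensor_map tscale s pp p t)
      = assoc_inv s s s (tensor_map s tscale id c' (tensor_map s tscale p pp ?t))"
    unfolding on23_def comp_def assoc_natural[OF p p p t] ..
  also have "tensor_map s tscale id c' (tensor_map s tscale p pp ?t)
      = tensor_map s tscale p pp (tensor_map s tscale id c ?t)"
    by (rule tensor_map_square[OF p lin_id[OF s] lin_id[OF s] p lpp(1) c' c lpp(1) _ _ t'])
      (simp_all add: assms(1))
  also have "assoc_inv s s s \<dots> = tensor_map tscale s pp p (assoc_inv s s s (tensor_map s tscale id c
    ?t))"
    by (rule assoc_inv_natural[OF p p p tensor_map_in[OF lin_id[OF s] c _ assms(2) t']]) simp_all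
  finally show ?thesis unfolding on23_def comp_def .
qed

lemma middle_natural:
  assumes "\<And>u. u \<in> tensor_space s s V W \<Longrightarrow> c' (tensor_map s s p p u) = tensor_map s s p p (c u)"
    and "\<And>u. u \<in> tensor_space s s V W \<Longrightarrow> c u \<in> tensor_space s s W' V'"
    and t: "t \<in> tensor_space tscale tscale (tensor_space s s U V) (tensor_space s s W Z)"
  shows "middle s c' (tensor_map tscale tscale (tensor_map s s p p) (tensor_map s s p p) t)
    = tensor_map tscale tscale (tensor_map s s p p) (tensor_map s s p p) (middle s c t)"
proof -
  note s = lin_dom[OF p]
  let ?t = "assoc_inv tscale s s t"
  have t': "?t \<in> tensor_space tscale s (tensor_space tscale s (tensor_space s s U V) W) Z"
    by (rule assoc_inv_in[OF vs_tensors s s t])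
  have "middle s c' (tensor_map tscale tscale pp pp t)
      = assoc tscale s s (tensor_map tscale s (on23 s c') id (tensor_map tscale s (tensor_map tscale
        s pp p) p ?t))"
    unfolding middle_def comp_def assoc_inv_natural[OF lpp(1) p p t] ..
  also have "tensor_map tscale s (on23 s c') id (tensor_map tscale s (tensor_map tscale s pp p) p ?t)
      = tensor_map tscale s (tensor_map tscale s pp p) p (tensor_map tscale s (on23 s c) id ?t)"
    by (rule tensor_map_square[OF lpp(4) lpp(3) lpp(2) lpp(4) p lin_id[OF s] lin_id[OF s] p _ _ t'])
      (simp_all add: on23_natural[OF assms(1,2)])
  also have "assoc tscale s s \<dots>
      = tensor_map tscale tscale pp pp (assoc tscale s s (tensor_map tscale s (on23 s c) id ?t))"
    by (rule assoc_natural[OF lpp(1) p p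
      tensor_map_in[OF lpp(2) lin_id[OF s] on23_in[OF s c assms(2)] _ t']])
      simp_all
  finally show ?thesis unfolding middle_def comp_def .
qed

end

section \<open>Strongly graded bialgebras\<close>

text \<open>
  The structure that the induction carries along. Each equation is an identity of linear maps on a
  tensor power of the carrier, hence is inherited by the image under a linear map that is
  compatible with the operations. The projections onto the components are postulated as maps of
  the ambient space, as this is the form in which \<open>hom_proj\<close> uses the direct sum decomposition.
\<close>

locale strong_core =
  fixes B :: "('k::field, 'a::ab_group_add) gr_brd_bialg"
  assumes vs: "vector_space (scale B)"
    and component_subspace: "\<And>n. module.subspace (scale B) (component B n)"
    and carrier_eq: "carrier B = module.span (scale B) (\<Union>n. component B n)"
    and projections: "\<And>n. \<exists>f. lin (scale B) (scale B) f \<and> (\<forall>x\<in>component B n. f x = x) \<and>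
          (\<forall>m x. m \<noteq> n \<longrightarrow> x \<in> component B m \<longrightarrow> f x = 0)"
    and lin_mult: "lin tscale (scale B) (mult B)"
    and lin_comult: "lin (scale B) tscale (comult B)"
    and lin_braiding: "lin tscale tscale (braiding B)"
    and mult_strong: "\<And>i j.
          mult B ` btensor_space B (component B i) (component B j) = component B (i + j)"
    and comult_graded: "\<And>n x. x \<in> component B n \<Longrightarrow> comult B x \<in>
          module.span tscale (\<Union>a\<le>n. btensor_space B (component B a) (component B (n - a)))"
    and braiding_graded: "\<And>a b t. t \<in> btensor_space B (component B a) (component B b) \<Longrightarrow>
          braiding B t \<in> btensor_space B (component B b) (component B a)"
    and braiding_mult_left: "\<And>t.
          t \<in> tensor_space tscale (scale B) (btensor_space B (carrier B) (carrier B)) (carrier B) \<Longrightarrow>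
          braiding B (tensor_map (scale B) (scale B) (mult B) id t) =
          tensor_map (scale B) (scale B) id (mult B) (assoc (scale B) (scale B) (scale B)
            (on12 (scale B) (braiding B) (on23 (scale B) (braiding B) t)))"
    and braiding_mult_right: "\<And>t.
          t \<in> tensor_space tscale (scale B) (btensor_space B (carrier B) (carrier B)) (carrier B) \<Longrightarrow>
          braiding B (tensor_map (scale B) (scale B) id (mult B) (assoc (scale B) (scale B) (scale
            B) t)) =
          tensor_map (scale B) (scale B) (mult B) id
            (on23 (scale B) (braiding B) (on12 (scale B) (braiding B) t))"
    and coassociative: "\<And>x. x \<in> carrier B \<Longrightarrow>
          assoc (scale B) (scale B) (scale B) (tensor_map tscale (scale B) (comult B) id (comult B x)) =
          tensor_map (scale B) tscale id (comult B) (comult B x)"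
    and comult_braiding_left: "\<And>t. t \<in> btensor_space B (carrier B) (carrier B) \<Longrightarrow>
          tensor_map tscale (scale B) (comult B) id (braiding B t) =
          on23 (scale B) (braiding B) (on12 (scale B) (braiding B)
            (assoc_inv (scale B) (scale B) (scale B) (tensor_map (scale B) tscale id (comult B) t)))"
    and comult_braiding_right: "\<And>t. t \<in> btensor_space B (carrier B) (carrier B) \<Longrightarrow>
          assoc_inv (scale B) (scale B) (scale B) (tensor_map (scale B) tscale id (comult B)
            (braiding B t)) =
          on12 (scale B) (braiding B) (on23 (scale B) (braiding B)
            (tensor_map tscale (scale B) (comult B) id t))"
    and comult_mult: "\<And>t. t \<in> btensor_space B (carrier B) (carrier B) \<Longrightarrow>
          comult B (mult B t) = tensor_map (scale B) (scale B) (mult B) (mult B)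
            (middle (scale B) (braiding B) (tensor_map tscale tscale (comult B) (comult B) t))"
begin

abbreviation (input) "s \<equiv> scale B"
abbreviation (input) "V \<equiv> carrier B"
abbreviation (input) "W \<equiv> component B"
abbreviation (input) "m \<equiv> mult B"
abbreviation (input) "D \<equiv> comult B"
abbreviation (input) "c \<equiv> braiding B"
abbreviation (input) "\<pi> \<equiv> hom_proj B"
abbreviation (input) ten (infixr "\<otimes>" 70) where "x \<otimes> y \<equiv> btensor B x y"
abbreviation (input) tens (infixr "\<otimes>\<otimes>" 70) where "X \<otimes>\<otimes> Y \<equiv> btensor_space B X Y"
abbreviation (input) "tspan \<equiv> (module.span tscale :: ('k,'a,'a) tensors set \<Rightarrow> _)"

sublocale vs: vector_space s by (rule vs)
sublocale ts: vector_space "tscale :: 'k \<Rightarrow> ('k, 'a, 'a) tensors \<Rightarrow> _" by (rule vs_tensors)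

lemma carrier_subspace: "vs.subspace V"
  unfolding carrier_eq by (rule vs.subspace_span)

lemma component_in_carrier: "x \<in> W n \<Longrightarrow> x \<in> V"
  unfolding carrier_eq by (rule vs.span_base) blast

lemma component_le_carrier: "W n \<subseteq> V"
  using component_in_carrier by blast

lemma carrier_tensor_eq: "V \<otimes>\<otimes> V = (\<Union>n. W n) \<otimes>\<otimes> (\<Union>n. W n)"
  unfolding carrier_eq by (rule tensor_space_span[OF vs vs])

lemma carrier_tensor_mapI:
  assumes "lin tscale s' h" "module.subspace s' X"
    and "\<And>i j x y. x \<in> W i \<Longrightarrow> y \<in> W j \<Longrightarrow> h (x \<otimes> y) \<in> X" "t \<in> V \<otimes>\<otimes> V"
  shows "h t \<in> X"
  by (rule tensor_space_mapI[OF assms(1,2) _ assms(4)[unfolded carrier_tensor_eq]]) (auto intro: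
    assms(3))

lemma mult_graded: "t \<in> W i \<otimes>\<otimes> W j \<Longrightarrow> m t \<in> W (i + j)"
  using mult_strong by blast

lemma mult_carrier: "t \<in> V \<otimes>\<otimes> V \<Longrightarrow> m t \<in> V"
  by (rule carrier_tensor_mapI[OF lin_mult carrier_subspace])
    (auto intro: component_in_carrier mult_graded)

lemma tens_carrier: "W i \<otimes>\<otimes> W j \<subseteq> V \<otimes>\<otimes> V"
  by (rule tensor_space_mono) (auto intro: component_in_carrier)

lemma braiding_carrier: "t \<in> V \<otimes>\<otimes> V \<Longrightarrow> c t \<in> V \<otimes>\<otimes> V"
  by (rule carrier_tensor_mapI[OF lin_braiding subspace_tensor_space])
    (use braiding_graded tens_carrier in blast)+

lemma comult_carrier:
  assumes "x \<in> V" shows "D x \<in> V \<otimes>\<otimes> V"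
proof (rule span_mapI[OF lin_comult subspace_tensor_space _ assms[unfolded carrier_eq]], clarify)
  fix n x assume "x \<in> W n"
  from comult_graded[OF this] show "D x \<in> V \<otimes>\<otimes> V"
    by (rule subsetD[OF ts.span_minimal[OF _ subspace_tensor_space], rotated])
      (intro UN_least tens_carrier)
qed

lemma
  shows lin_proj: "lin s s (\<pi> n)"
    and proj_same: "x \<in> W n \<Longrightarrow> \<pi> n x = x"
    and proj_other: "k \<noteq> n \<Longrightarrow> x \<in> W k \<Longrightarrow> \<pi> n x = 0"
  using someI_ex[OF projections, of n] unfolding hom_proj_def by blast+

lemma proj_zero_or_same: "x \<in> W k \<Longrightarrow> \<pi> n x = (if k = n then x else 0)"
  by (cases "k = n") (simp_all add: proj_same proj_other)

lemma proj_component: "x \<in> V \<Longrightarrow> \<pi> n x \<in> W n"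
proof (rule span_mapI[OF lin_proj component_subspace])
  fix y assume "y \<in> (\<Union>n. W n)"
  then obtain k where "y \<in> W k" by blast
  then show "\<pi> n y \<in> W n"
    by (cases "k = n") (simp_all add: proj_same proj_other vs.subspace_0[OF component_subspace])
qed (simp add: carrier_eq)

lemma proj_unique:
  assumes f: "lin s s f" and "\<And>x. x \<in> W n \<Longrightarrow> f x = x" "\<And>k x. k \<noteq> n \<Longrightarrow> x \<in> W k \<Longrightarrow> f x = 0" and "x \<in> V"
  shows "f x = \<pi> n x"
  by (rule span_eqI[OF f lin_proj _ assms(4)[unfolded carrier_eq]])
    (use assms(2,3) proj_zero_or_same in auto)

lemma proj_mult_left:
  assumes "x \<in> V" "y \<in> W j"
  shows "\<pi> n (m (x \<otimes> y)) = (if j \<le> n then m (\<pi> (n - j) x \<otimes> y) else 0)"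
proof -
  have l: "lin s s (\<lambda>x. m (x \<otimes> y))" "lin s s (\<lambda>x. \<pi> n (m (x \<otimes> y)))" "lin s s (\<lambda>x. m (\<pi> (n - j) x \<otimes> y))"
    by (intro lin_comp[OF lin_proj] lin_comp[OF lin_mult] lin_intros lin_ident vs lin_proj)+
  show ?thesis
  proof (cases "j \<le> n")
    case True
    have "\<pi> n (m (x \<otimes> y)) = m (\<pi> (n - j) x \<otimes> y)"
    proof (rule span_eqI[OF l(2,3) _ assms(1)[unfolded carrier_eq]], clarify)
      fix i x assume x: "x \<in> W i"
      then have "m (x \<otimes> y) \<in> W (i + j)" using assms(2) by (intro mult_graded) blast
      then show "\<pi> n (m (x \<otimes> y)) = m (\<pi> (n - j) x \<otimes> y)"
        using True by (auto simp: proj_zero_or_same[OF x] proj_zero_or_same[of "m _"]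
          tensor_zero_left[OF vs] lin_zero[OF lin_mult])
    qed
    then show ?thesis using True by simp
  next
    case False
    have "\<pi> n (m (x \<otimes> y)) \<in> {0}"
    proof (rule span_mapI[OF l(2) vs.subspace_single_0 _ assms(1)[unfolded carrier_eq]], clarify)
      fix i x assume x: "x \<in> W i"
      then have "m (x \<otimes> y) \<in> W (i + j)" using assms(2) by (intro mult_graded) blast
      then show "\<pi> n (m (x \<otimes> y)) = 0" using False by (auto simp: proj_zero_or_same)
    qed
    then show ?thesis using False by simp
  qed
qed

lemma proj_mult_right:
  assumes "x \<in> V" "y \<in> W j"
  shows "\<pi> n (m (y \<otimes> x)) = (if j \<le> n then m (y \<otimes> \<pi> (n - j) x) else 0)"
proof -
  have l: "lin s s (\<lambda>x. m (y \<otimes> x))" "lin s s (\<lambda>x. \<pi> n (m (y \<otimes> x)))" "lin s s (\<lambda>x. m (y \<otimes> \<pi> (n - j) x))"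
    by (intro lin_comp[OF lin_proj] lin_comp[OF lin_mult] lin_intros lin_ident vs lin_proj)+
  show ?thesis
  proof (cases "j \<le> n")
    case True
    have "\<pi> n (m (y \<otimes> x)) = m (y \<otimes> \<pi> (n - j) x)"
    proof (rule span_eqI[OF l(2,3) _ assms(1)[unfolded carrier_eq]], clarify)
      fix i x assume x: "x \<in> W i"
      then have "m (y \<otimes> x) \<in> W (j + i)" using assms(2) by (intro mult_graded) blast
      then show "\<pi> n (m (y \<otimes> x)) = m (y \<otimes> \<pi> (n - j) x)"
        using True by (auto simp: proj_zero_or_same[OF x] proj_zero_or_same[of "m _"]
          tensor_zero_right[OF vs] lin_zero[OF lin_mult])
    qed
    then show ?thesis using True by simp
  next
    case False
    have "\<pi> n (m (y \<otimes> x)) \<in> {0}"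
    proof (rule span_mapI[OF l(2) vs.subspace_single_0 _ assms(1)[unfolded carrier_eq]], clarify)
      fix i x assume x: "x \<in> W i"
      then have "m (y \<otimes> x) \<in> W (j + i)" using assms(2) by (intro mult_graded) blast
      then show "\<pi> n (m (y \<otimes> x)) = 0" using False by (auto simp: proj_zero_or_same)
    qed
    then show ?thesis using False by simp
  qed
qed

subsection \<open>The subspaces \<open>E\<^sub>n\<close>\<close>

text \<open>
  The homogeneous tensors of degree \<open>n\<close> without components in bidegrees \<open>(a, b)\<close>, \<open>a, b \<ge> 1\<close>.
\<close>

definition outer :: "nat \<Rightarrow> ('k, 'a, 'a) tensors set" where
  "outer n = tspan (W 0 \<otimes>\<otimes> W n \<union> W n \<otimes>\<otimes> W 0)"

lemma outer_subspace: "ts.subspace (outer n)"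
  unfolding outer_def by (rule ts.subspace_span)

lemma outerI: "t \<in> W 0 \<otimes>\<otimes> W n \<Longrightarrow> t \<in> outer n" "t \<in> W n \<otimes>\<otimes> W 0 \<Longrightarrow> t \<in> outer n"
  unfolding outer_def by (auto intro: ts.span_base)

lemma lin_tensor_map2: "lin tscale tscale (tensor_map s s f g)"
  by (rule lin_tensor_map[OF lin_ident[OF vs_tensors]])

lemma proj_proj_zero:
  assumes "t \<in> W i \<otimes>\<otimes> W j" "a \<noteq> i \<or> b \<noteq> j"
  shows "tensor_map s s (\<pi> a) (\<pi> b) t = 0"
  by (rule tensor_map_zero[OF lin_proj lin_proj _ assms(1)]) (use assms(2) proj_other in metis)

lemma comult_sum:
  assumes "x \<in> W n"
  shows "D x = (\<Sum>a\<le>n. comult_comp B a (n - a) x)"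
  unfolding comult_comp_def
proof (rule span_eqI[OF lin_ident[OF vs_tensors] _ _ comult_graded[OF assms]])
  interpret p: vector_space_pair "tscale :: 'k \<Rightarrow> ('k, 'a, 'a) tensors \<Rightarrow> _"
    "tscale :: 'k \<Rightarrow> ('k, 'a, 'a) tensors \<Rightarrow> _" ..
  show "lin tscale tscale (\<lambda>t. \<Sum>a\<le>n. tensor_map s s (\<pi> a) (\<pi> (n - a)) t)"
    by (rule p.linear_compose_sum) (simp add: lin_tensor_map2)
  fix t assume "t \<in> (\<Union>a\<le>n. W a \<otimes>\<otimes> W (n - a))"
  then obtain i where i: "i \<le> n" "t \<in> W i \<otimes>\<otimes> W (n - i)" by blast
  have "tensor_map s s (\<pi> a) (\<pi> (n - a)) t = (if i = a then t else 0)" for a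
    using tensor_map_ident[OF lin_proj lin_proj _ _ i(2), of i "n - i"]
      proj_proj_zero[OF i(2), of a "n - a"]
    by (auto simp: proj_same)
  then show "t = (\<Sum>a\<le>n. tensor_map s s (\<pi> a) (\<pi> (n - a)) t)"
    using i(1) by simp
qed

text \<open>
  This form of the definition of \<open>E\<^sub>n\<close> can be combined with the gradedness of the other operations
  without decomposing the coproduct any further.
\<close>

lemma E_comp_iff:
  assumes "n \<ge> 2"
  shows "x \<in> E_comp B n \<longleftrightarrow> x \<in> W n \<and> D x \<in> outer n"
proof safe
  assume x: "x \<in> E_comp B n"
  then show xW: "x \<in> W n" by (simp add: E_comp_def)
  have "comult_comp B a (n - a) x \<in> outer n" if "a \<le> n" for a
  proof -
    have *: "comult_comp B a (n - a) x \<in> W a \<otimes>\<otimes> W (n - a)"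
      unfolding comult_comp_def
      by (rule tensor_map_in[OF lin_proj lin_proj _ _ comult_carrier[OF component_in_carrier[OF xW]]])
        (auto intro: proj_component)
    consider "a = 0" | "a = n" | "1 \<le> a" "1 \<le> n - a" using \<open>a \<le> n\<close> by linarith
    then show ?thesis
    proof cases
      case 3
      then have "comult_comp B a (n - a) x = 0" using x \<open>a \<le> n\<close> by (auto simp: E_comp_def)
      then show ?thesis using ts.subspace_0[OF outer_subspace] by simp
    qed (use * in \<open>auto intro: outerI\<close>)
  qed
  then show "D x \<in> outer n"
    unfolding comult_sum[OF xW] by (intro ts.subspace_sum outer_subspace) auto
next
  assume x: "x \<in> W n" "D x \<in> outer n"
  have "comult_comp B a b x = 0" if ab: "a \<ge> 1" "b \<ge> 1" for a b
  proof -
    have "tensor_map s s (\<pi> a) (\<pi> b) (D x) \<in> {0}"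
      by (rule span_mapI[OF lin_tensor_map2 ts.subspace_single_0 _ x(2)[unfolded outer_def]])
        (use ab proj_proj_zero[of _ 0 n a b] proj_proj_zero[of _ n 0 a b] in auto)
    then show ?thesis by (simp add: comult_comp_def)
  qed
  then show "x \<in> E_comp B n" using x by (simp add: E_comp_def)
qed

lemma lin_comult_comp: "lin s tscale (comult_comp B a b)"
  unfolding comult_comp_def[abs_def] by (intro lin_intros lin_comult)

lemma E_comp_subspace: "vs.subspace (E_comp B n)"
proof -
  have "E_comp B n = {x \<in> W n. \<forall>(a,b)\<in>{(a,b). a \<ge> 1 \<and> b \<ge> 1 \<and> a + b = n}. comult_comp B a b x \<in> {0}}"
    unfolding E_comp_def by auto
  also have "vs.subspace \<dots>"
    by (rule subspace_Ball[OF vs component_subspace])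
      (auto intro!: lin_subspace_vimage[OF lin_comult_comp ts.subspace_single_0, simplified])
  finally show ?thesis .
qed

lemma comult_comp_carrier: "x \<in> V \<Longrightarrow> comult_comp B a b x \<in> W a \<otimes>\<otimes> W b"
  unfolding comult_comp_def
  by (rule tensor_map_in[OF lin_proj lin_proj _ _ comult_carrier]) (auto intro: proj_component)

lemma finite_splittings: "finite {(a, b). (a::nat) \<ge> 1 \<and> b \<ge> 1 \<and> a + b = n}"
  by (rule finite_subset[of _ "{..n} \<times> {..n}"]) auto

text \<open>
  \<open>E\<^sub>n\<close> is a finite intersection of kernels; they are imposed one at a time.
\<close>

lemma tensor_E_right:
  assumes t: "t \<in> U \<otimes>\<otimes> W n"
    and z: "\<And>a b. a \<ge> 1 \<Longrightarrow> b \<ge> 1 \<Longrightarrow> a + b = n \<Longrightarrow> tensor_map s tscale id (comult_comp B a b) t = 0"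
  shows "t \<in> U \<otimes>\<otimes> E_comp B n"
proof -
  have "t \<in> U \<otimes>\<otimes> {x \<in> W n. \<forall>(a,b)\<in>F. comult_comp B a b x = 0}"
    if "finite F" "F \<subseteq> {(a, b). (a::nat) \<ge> 1 \<and> b \<ge> 1 \<and> a + b = n}" for F
    using that
  proof (induction F rule: finite_induct)
    case empty
    then show ?case using t by simp
  next
    case (insert f F)
    obtain a b where f: "f = (a, b)" by fastforce
    let ?X = "{x \<in> W n. \<forall>(a,b)\<in>F. comult_comp B a b x = 0}"
    have sub: "vs.subspace ?X"
      by (rule subspace_Ball[OF vs component_subspace])
        (auto intro!: lin_subspace_vimage[OF lin_comult_comp ts.subspace_single_0, simplified])
    have "{y \<in> ?X. comult_comp B a b y = 0} = {x \<in> W n. \<forall>(a,b)\<in>insert f F. comult_comp B a b x = 0}"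
      by (auto simp: f)
    moreover have "t \<in> U \<otimes>\<otimes> {y \<in> ?X. comult_comp B a b y = 0}"
      using insert z f by (intro tensor_kernel_right[OF lin_comult_comp sub vs]) auto
    ultimately show ?case by simp
  qed
  from this[OF finite_splittings subset_refl] have "t \<in> U \<otimes>\<otimes>
    {x \<in> W n. \<forall>(a,b)\<in>{(a, b). (a::nat) \<ge> 1 \<and> b \<ge> 1 \<and> a + b = n}. comult_comp B a b x = 0}" .
  moreover have "\<dots> = U \<otimes>\<otimes> E_comp B n"
    by (rule arg_cong[where f="\<lambda>X. U \<otimes>\<otimes> X"]) (auto simp: E_comp_def)
  ultimately show ?thesis by simp
qed

lemma tensor_E_left:
  assumes t: "t \<in> W n \<otimes>\<otimes> U"
    and z: "\<And>a b. a \<ge> 1 \<Longrightarrow> b \<ge> 1 \<Longrightarrow> a + b = n \<Longrightarrow> tensor_map tscale s (comult_comp B a b) id t = 0"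
  shows "t \<in> E_comp B n \<otimes>\<otimes> U"
proof -
  have "t \<in> {x \<in> W n. \<forall>(a,b)\<in>F. comult_comp B a b x = 0} \<otimes>\<otimes> U"
    if "finite F" "F \<subseteq> {(a, b). (a::nat) \<ge> 1 \<and> b \<ge> 1 \<and> a + b = n}" for F
    using that
  proof (induction F rule: finite_induct)
    case empty
    then show ?case using t by simp
  next
    case (insert f F)
    obtain a b where f: "f = (a, b)" by fastforce
    let ?X = "{x \<in> W n. \<forall>(a,b)\<in>F. comult_comp B a b x = 0}"
    have sub: "vs.subspace ?X"
      by (rule subspace_Ball[OF vs component_subspace])
        (auto intro!: lin_subspace_vimage[OF lin_comult_comp ts.subspace_single_0, simplified])
    have "{y \<in> ?X. comult_comp B a b y = 0} = {x \<in> W n. \<forall>(a,b)\<in>insert f F. comult_comp B a b x = 0}"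
      by (auto simp: f)
    moreover have "t \<in> {y \<in> ?X. comult_comp B a b y = 0} \<otimes>\<otimes> U"
      using insert z f by (intro tensor_kernel_left[OF lin_comult_comp sub vs]) auto
    ultimately show ?case by simp
  qed
  from this[OF finite_splittings subset_refl] have "t \<in>
    {x \<in> W n. \<forall>(a,b)\<in>{(a, b). (a::nat) \<ge> 1 \<and> b \<ge> 1 \<and> a + b = n}. comult_comp B a b x = 0} \<otimes>\<otimes> U" .
  moreover have "\<dots> = E_comp B n \<otimes>\<otimes> U"
    by (rule arg_cong[where f="\<lambda>X. X \<otimes>\<otimes> U"]) (auto simp: E_comp_def)
  ultimately show ?thesis by simp
qed

subsection \<open>The ideal generated by \<open>E(B)\<close>\<close>

definition I where "I = ideal_generated B (E_space B)"

lemma two_sided_idealI: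
  assumes J: "vs.subspace J" "J \<subseteq> V"
    and m: "\<And>x j y. x \<in> J \<Longrightarrow> y \<in> W j \<Longrightarrow> m (x \<otimes> y) \<in> J" "\<And>x j y. x \<in> J \<Longrightarrow> y \<in> W j \<Longrightarrow> m (y \<otimes> x) \<in> J"
  shows "two_sided_ideal B J"
  unfolding two_sided_ideal_def
proof (intro conjI J ballI)
  fix x y assume x: "x \<in> J" and y: "y \<in> V"
  show "m (x \<otimes> y) \<in> J"
    by (rule span_mapI[OF _ J(1) _ y[unfolded carrier_eq], of "\<lambda>y. m (x \<otimes> y)"])
      (intro lin_comp[OF lin_mult] lin_intros lin_ident vs | use m(1) x in blast)+
  show "m (y \<otimes> x) \<in> J"
    by (rule span_mapI[OF _ J(1) _ y[unfolded carrier_eq], of "\<lambda>y. m (y \<otimes> x)"])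
      (intro lin_comp[OF lin_mult] lin_intros lin_ident vs | use m(2) x in blast)+
qed

lemma E_in_carrier: "E_comp B n \<subseteq> V"
  by (auto simp: E_comp_def intro: component_in_carrier)

lemma carrier_ideal: "two_sided_ideal B V"
  by (rule two_sided_idealI) (auto intro!: carrier_subspace mult_carrier tensor_in intro:
    component_in_carrier)

text \<open>
  A property of all elements of \<open>I\<close> is proved below by showing that the elements of \<open>I\<close> that have
  it form a two-sided ideal and include the generators.
\<close>

lemma I_minimal:
  assumes "two_sided_ideal B J" "\<And>n. n \<ge> 2 \<Longrightarrow> E_comp B n \<subseteq> J"
  shows "I \<subseteq> J"
proof -
  have "E_space B \<subseteq> J"
    unfolding E_space_def using assms by (intro vs.span_minimal) (auto simp: two_sided_ideal_def)
  then show ?thesis using assms(1) unfolding I_def ideal_generated_def by blast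
qed

lemma E_subset_I: "n \<ge> 2 \<Longrightarrow> E_comp B n \<subseteq> I"
  unfolding I_def ideal_generated_def E_space_def by (auto intro: vs.span_base)

lemma I_carrier: "I \<subseteq> V"
  by (rule I_minimal[OF carrier_ideal E_in_carrier])

lemma I_subspace: "vs.subspace I"
  unfolding I_def ideal_generated_def by (rule vs.subspace_Inter) (auto simp: two_sided_ideal_def)

lemma
  shows mult_I_elem_left: "x \<in> I \<Longrightarrow> y \<in> V \<Longrightarrow> m (x \<otimes> y) \<in> I"
    and mult_I_elem_right: "x \<in> I \<Longrightarrow> y \<in> V \<Longrightarrow> m (y \<otimes> x) \<in> I"
  unfolding I_def ideal_generated_def two_sided_ideal_def by blast+

lemma mult_I_left: "t \<in> I \<otimes>\<otimes> V \<Longrightarrow> m t \<in> I"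
  by (rule tensor_space_mapI[OF lin_mult I_subspace mult_I_elem_left])

lemma mult_I_right: "t \<in> V \<otimes>\<otimes> I \<Longrightarrow> m t \<in> I"
  by (rule tensor_space_mapI[OF lin_mult I_subspace mult_I_elem_right])

lemma I_graded:
  assumes "x \<in> I" shows "\<pi> n x \<in> I"
proof -
  let ?J = "{x \<in> I. \<forall>n\<in>UNIV. \<pi> n x \<in> I}"
  have "I \<subseteq> ?J"
  proof (rule I_minimal[OF two_sided_idealI])
    show "vs.subspace ?J"
      by (rule subspace_Ball[OF vs I_subspace lin_subspace_vimage[OF lin_proj I_subspace]])
    show "?J \<subseteq> V" using I_carrier by blast
    fix x j y assume x: "x \<in> ?J" and y: "y \<in> W j"
    then have V: "x \<in> V" "y \<in> V" using I_carrier component_in_carrier by auto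
    have xI: "x \<in> I" "\<And>n. \<pi> n x \<in> I" using x by auto
    show "m (x \<otimes> y) \<in> ?J" "m (y \<otimes> x) \<in> ?J"
      using mult_I_elem_left[OF _ V(2)] mult_I_elem_right[OF _ V(2)] xI vs.subspace_0[OF I_subspace]
      by (simp_all add: proj_mult_left[OF V(1) y] proj_mult_right[OF V(1) y])
  next
    fix n :: nat assume "n \<ge> 2"
    then show "E_comp B n \<subseteq> ?J"
      using E_subset_I[of n] vs.subspace_0[OF I_subspace]
      by (auto simp: E_comp_def proj_zero_or_same)
  qed
  then show ?thesis using assms by blast
qed

text \<open>
  The coproduct of \<open>y\<close> lies in \<open>B\<^sup>0 \<otimes> B\<^sup>0\<close>, and the braiding only exchanges degrees, so
  multiplying by it preserves the bidegrees \<open>(0, n)\<close> and \<open>(n, 0)\<close>.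
\<close>

lemma E_mult_degree_0:
  assumes x: "x \<in> E_comp B n" and n: "n \<ge> 2" and y: "y \<in> W 0"
  shows "m (x \<otimes> y) \<in> E_comp B n" "m (y \<otimes> x) \<in> E_comp B n"
proof -
  have xW: "x \<in> W n" and Dx: "D x \<in> outer n" using x E_comp_iff[OF n] by auto
  have V: "x \<in> V" "y \<in> V" using xW y component_in_carrier by auto
  have "ts.span (W 0 \<otimes>\<otimes> W 0) \<subseteq> W 0 \<otimes>\<otimes> W 0"
    by (rule ts.span_minimal[OF subset_refl subspace_tensor_space])
  then have Dy: "D y \<in> W 0 \<otimes>\<otimes> W 0"
    using comult_graded[OF y] by auto
  have lmid: "lin s' tscale h \<Longrightarrow> lin s' tscale (\<lambda>u. tensor_map s s m m (middle s c (h u)))"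
    for s' and h :: "('k,'a,'a) tensors \<Rightarrow> _"
    by (intro lin_intros)
  have comp: "tensor_map s s m m (middle s c u) \<in> W (i+i') \<otimes>\<otimes> W (j+j')"
    if "u \<in> tensor_space tscale tscale (W i \<otimes>\<otimes> W j) (W i' \<otimes>\<otimes> W j')" for u i j i' j'
    by (rule tensor_map_in[OF lin_mult lin_mult _ _ middle_in[OF vs lin_braiding _ that]])
      (auto intro: mult_graded braiding_graded)
  have "D (m (x \<otimes> y)) = tensor_map s s m m (middle s c (tensor tscale tscale (D x) (D y)))"
    using V by (simp add: comult_mult tensor_in tensor_map_tensor[OF lin_comult lin_comult])
  also have "\<dots> \<in> outer n"
  proof (rule span_mapI[OF _ outer_subspace _ Dx[unfolded outer_def]])
    fix u assume "u \<in> W 0 \<otimes>\<otimes> W n \<union> W n \<otimes>\<otimes> W 0"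
    then show "tensor_map s s m m (middle s c (tensor tscale tscale u (D y))) \<in> outer n"
      using comp[of "tensor tscale tscale u (D y)" 0 n 0 0] comp[of "tensor tscale tscale u (D y)" n
        0 0 0]
        Dy by (auto intro: outerI)
  qed (intro lmid lin_intros lin_ident vs_tensors)
  finally show "m (x \<otimes> y) \<in> E_comp B n"
    using mult_graded[of "x \<otimes> y" n 0] xW y by (auto simp: E_comp_iff[OF n])
  have "D (m (y \<otimes> x)) = tensor_map s s m m (middle s c (tensor tscale tscale (D y) (D x)))"
    using V by (simp add: comult_mult tensor_in tensor_map_tensor[OF lin_comult lin_comult])
  also have "\<dots> \<in> outer n"
  proof (rule span_mapI[OF _ outer_subspace _ Dx[unfolded outer_def]])
    fix u assume "u \<in> W 0 \<otimes>\<otimes> W n \<union> W n \<otimes>\<otimes> W 0"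
    then show "tensor_map s s m m (middle s c (tensor tscale tscale (D y) u)) \<in> outer n"
      using comp[of "tensor tscale tscale (D y) u" 0 0 0 n] comp[of "tensor tscale tscale (D y) u" 0
        0 n 0]
        Dy by (auto intro: outerI)
  qed (intro lmid lin_intros lin_ident vs_tensors)
  finally show "m (y \<otimes> x) \<in> E_comp B n"
    using mult_graded[of "y \<otimes> x" 0 n] xW y by (auto simp: E_comp_iff[OF n])
qed

text \<open>
  Multiplication by elements of positive degree moves the lowest part of the ideal into degrees
  above \<open>d\<close>, and multiplication by degree \<open>0\<close> keeps \<open>E\<^sub>d\<close>.
\<close>

lemma I_low_degree:
  assumes d: "d \<ge> 2" and E: "\<And>k. 2 \<le> k \<Longrightarrow> k < d \<Longrightarrow> E_comp B k \<subseteq> {0}" and x: "x \<in> I"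
  shows "n < d \<Longrightarrow> \<pi> n x = 0" "\<pi> d x \<in> E_comp B d"
proof -
  let ?X = "\<lambda>n. if n < d then {0} else E_comp B d"
  let ?J = "{x \<in> I. \<forall>n\<in>{..d}. \<pi> n x \<in> ?X n}"
  have X: "vs.subspace (?X n)" for n by (simp add: E_comp_subspace)
  have "I \<subseteq> ?J"
  proof (rule I_minimal[OF two_sided_idealI])
    show "vs.subspace ?J"
      by (rule subspace_Ball[OF vs I_subspace lin_subspace_vimage[OF lin_proj X]])
    show "?J \<subseteq> V" using I_carrier by blast
    fix x j y assume x: "x \<in> ?J" and y: "y \<in> W j"
    then have V: "x \<in> V" "y \<in> V" using I_carrier component_in_carrier by auto
    have 0: "\<pi> k x = 0" if "k < d" for k
    proof -
      from that have "k \<in> {..d}" by simp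
      with x have "\<pi> k x \<in> ?X k" by blast
      then show ?thesis using that by simp
    qed
    have "\<pi> n (m (x \<otimes> y)) \<in> ?X n \<and> \<pi> n (m (y \<otimes> x)) \<in> ?X n" if "n \<le> d" for n
    proof (cases "n = d \<and> j = 0")
      case True
      have "d \<in> {..d}" by simp
      with x have "\<pi> d x \<in> ?X d" by blast
      then have "\<pi> d x \<in> E_comp B d" by simp
      then show ?thesis
        using E_mult_degree_0[OF _ d, of "\<pi> d x" y] True y
        by (simp add: proj_mult_left[OF V(1) y] proj_mult_right[OF V(1) y])
    next
      case False
      then have "j \<le> n \<Longrightarrow> \<pi> (n - j) x = 0" using that by (intro 0) auto
      then show ?thesis
        using vs.subspace_0[OF X[of n]]
        by (auto simp: proj_mult_left[OF V(1) y] proj_mult_right[OF V(1) y] tensor_zero_left[OF vs]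
          tensor_zero_right[OF vs] lin_zero[OF lin_mult])
    qed
    then show "m (x \<otimes> y) \<in> ?J" "m (y \<otimes> x) \<in> ?J"
      using x mult_I_elem_left[OF _ V(2)] mult_I_elem_right[OF _ V(2)] by blast+
  next
    fix k :: nat assume k: "k \<ge> 2"
    have "\<pi> n x \<in> ?X n" if "x \<in> E_comp B k" "n \<le> d" for x n
    proof (cases "k < d")
      case True
      then have "x = 0" using E k that by blast
      then show ?thesis using vs.subspace_0[OF X[of n]] by (simp only: lin_zero[OF lin_proj])
    next
      case False
      then show ?thesis
        using that vs.subspace_0[OF E_comp_subspace] by (auto simp: E_comp_def proj_zero_or_same)
    qed
    then show "E_comp B k \<subseteq> ?J" using E_subset_I[OF k] by blast
  qed
  with x have *: "\<pi> n x \<in> ?X n" if "n \<le> d" for n using that by blast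
  show "n < d \<Longrightarrow> \<pi> n x = 0" "\<pi> d x \<in> E_comp B d" using *[of n] *[of d] by auto
qed

lemma comult_comp_zero:
  assumes "x \<in> W k" "a + b \<noteq> k" shows "comult_comp B a b x = 0"
proof -
  have "comult_comp B a b x \<in> {0}"
    unfolding comult_comp_def
  proof (rule span_mapI[OF lin_tensor_map2 ts.subspace_single_0 _ comult_graded[OF assms(1)]])
    fix t assume "t \<in> (\<Union>i\<le>k. W i \<otimes>\<otimes> W (k - i))"
    then obtain i where "i \<le> k" "t \<in> W i \<otimes>\<otimes> W (k - i)" by blast
    moreover from this have "a \<noteq> i \<or> b \<noteq> k - i" using assms(2) by auto
    ultimately show "tensor_map s s (\<pi> a) (\<pi> b) t \<in> {0}"
      using proj_proj_zero by simp
  qed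
  then show ?thesis by simp
qed

text \<open>
  Apply the coproduct to the factor of \<open>c (y \<otimes> x)\<close> that comes from \<open>x\<close>. Since the braiding is
  compatible with the coproduct, the result is obtained from \<open>y \<otimes> \<Delta> x\<close> by moving \<open>y\<close> past both
  factors. The bidegrees of \<open>\<Delta> x\<close> do not change, so they remain outer.
\<close>

lemma braiding_E:
  assumes x: "x \<in> E_comp B n" and n: "n \<ge> 2" and y: "y \<in> W j"
  shows "c (y \<otimes> x) \<in> E_comp B n \<otimes>\<otimes> W j" "c (x \<otimes> y) \<in> W j \<otimes>\<otimes> E_comp B n"
proof -
  have xW: "x \<in> W n" and Dx: "D x \<in> outer n" using x E_comp_iff[OF n] by auto
  have V: "x \<in> V" "y \<in> V" using xW y component_in_carrier by auto
  note lid = lin_id[OF vs] and vst = vs_tensors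
  show "c (y \<otimes> x) \<in> E_comp B n \<otimes>\<otimes> W j"
  proof (rule tensor_E_left)
    show t: "c (y \<otimes> x) \<in> W n \<otimes>\<otimes> W j" using xW y by (intro braiding_graded) auto
    fix a b :: nat assume ab: "a \<ge> 1" "b \<ge> 1" "a + b = n"
    let ?H = "\<lambda>u. tensor_map tscale s (tensor_map s s (\<pi> a) (\<pi> b)) id
      (on23 s c (on12 s c (assoc_inv s s s (tensor s tscale y u))))"
    have "tensor_map tscale s (comult_comp B a b) id (c (y \<otimes> x))
      = tensor_map tscale s (tensor_map s s (\<pi> a) (\<pi> b)) id (tensor_map tscale s D id (c (y \<otimes> x)))"
      by (rule tensor_map_comp[symmetric, OF lin_comult lin_tensor_map2 lid lid lin_comult_comp lid
        _ _ t])
        (simp_all add: comult_comp_def)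
    also have "\<dots> = ?H (D x)"
      using V by (simp add: comult_braiding_left tensor_in tensor_map_tensor[OF lid lin_comult])
    also have "\<dots> \<in> {0}"
    proof (rule span_mapI[OF _ subspace_triv[OF vs_tensors] _ Dx[unfolded outer_def]])
      have *: "?H u = 0" if "u \<in> W i \<otimes>\<otimes> W k" "i = 0 \<or> k = 0" for u i k
        by (rule tensor_map_zero[OF lin_tensor_map2 lid _ on23_in[OF vs lin_braiding braiding_graded
              on12_in[OF vs lin_braiding braiding_graded
                assoc_inv_in[OF vs vs vs tensor_in[OF y that(1)]]]]])
          (use that(2) ab proj_proj_zero[where i=i and j=k and a=a and b=b] in auto)
      show "?H u \<in> {0}" if "u \<in> W 0 \<otimes>\<otimes> W n \<union> W n \<otimes>\<otimes> W 0" for u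
        using that *[of u 0 n] *[of u n 0] by auto
    qed (intro lin_intros lin_ident vst)
    finally show "tensor_map tscale s (comult_comp B a b) id (c (y \<otimes> x)) = 0" by (rule singletonD)
  qed
  show "c (x \<otimes> y) \<in> W j \<otimes>\<otimes> E_comp B n"
  proof (rule tensor_E_right)
    show t: "c (x \<otimes> y) \<in> W j \<otimes>\<otimes> W n" using xW y by (intro braiding_graded) auto
    fix a b :: nat assume ab: "a \<ge> 1" "b \<ge> 1" "a + b = n"
    let ?H = "\<lambda>u. tensor_map s tscale id (tensor_map s s (\<pi> a) (\<pi> b))
      (assoc s s s (on12 s c (on23 s c (tensor tscale s u y))))"
    let ?u = "tensor_map s tscale id D (c (x \<otimes> y))"
    have u: "?u \<in> tensor_space s tscale (W j) (V \<otimes>\<otimes> V)"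
      by (rule tensor_map_in[OF lid lin_comult _ _ t]) (auto intro: comult_carrier component_in_carrier)
    have "tensor_map s tscale id (comult_comp B a b) (c (x \<otimes> y))
      = tensor_map s tscale id (tensor_map s s (\<pi> a) (\<pi> b)) ?u"
      by (rule tensor_map_comp[symmetric, OF lid lid lin_comult lin_tensor_map2 lid lin_comult_comp
        _ _ t])
        (simp_all add: comult_comp_def)
    also have "?u = assoc s s s (assoc_inv s s s ?u)"
      by (rule assoc_assoc_inv[symmetric, OF vs vs vs u])
    also have "tensor_map s tscale id (tensor_map s s (\<pi> a) (\<pi> b)) \<dots> = ?H (D x)"
      using V by (simp add: comult_braiding_right tensor_in tensor_map_tensor[OF lin_comult lid])
    also have "\<dots> \<in> {0}"
    proof (rule span_mapI[OF _ subspace_triv[OF vs_tensors] _ Dx[unfolded outer_def]])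
      have *: "?H u = 0" if "u \<in> W i \<otimes>\<otimes> W k" "i = 0 \<or> k = 0" for u i k
        by (rule tensor_map_zero[OF lid lin_tensor_map2 _
          assoc_in[OF vs vs vs on12_in[OF vs lin_braiding braiding_graded
              on23_in[OF vs lin_braiding braiding_graded tensor_in[OF that(1) y]]]]])
          (use that(2) ab proj_proj_zero[where i=i and j=k and a=a and b=b] in auto)
      show "?H u \<in> {0}" if "u \<in> W 0 \<otimes>\<otimes> W n \<union> W n \<otimes>\<otimes> W 0" for u
        using that *[of u 0 n] *[of u n 0] by auto
    qed (intro lin_intros lin_ident vst)
    finally show "tensor_map s tscale id (comult_comp B a b) (c (x \<otimes> y)) = 0" by (rule singletonD)
  qed
qed

text \<open>
  The product of an element of \<open>I\<close> with another one is braided past \<open>z\<close> one factor at a time, by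
  the compatibility of braiding and multiplication. Each step keeps one tensor factor in \<open>I\<close>.
\<close>

lemma braiding_I:
  shows "t \<in> I \<otimes>\<otimes> V \<Longrightarrow> c t \<in> V \<otimes>\<otimes> I" "t \<in> V \<otimes>\<otimes> I \<Longrightarrow> c t \<in> I \<otimes>\<otimes> V"
proof -
  let ?J = "{x \<in> I. \<forall>y\<in>V. c (x \<otimes> y) \<in> V \<otimes>\<otimes> I \<and> c (y \<otimes> x) \<in> I \<otimes>\<otimes> V}"
  note lid = lin_id[OF vs] and br = vs lin_braiding
  have J1: "c t \<in> V \<otimes>\<otimes> I" if "t \<in> ?J \<otimes>\<otimes> V" for t
    by (rule tensor_space_mapI[OF lin_braiding subspace_tensor_space _ that]) auto
  have coideal_sum: "c t \<in> I \<otimes>\<otimes> V" if "t \<in> V \<otimes>\<otimes> ?J" for t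
    by (rule tensor_space_mapI[OF lin_braiding subspace_tensor_space _ that]) auto
  note J = J1 coideal_sum
  have "I \<subseteq> ?J"
  proof (rule I_minimal[OF two_sided_idealI])
    have "vs.subspace {x. c (x \<otimes> y) \<in> V \<otimes>\<otimes> I \<and> c (y \<otimes> x) \<in> I \<otimes>\<otimes> V}" for y
      unfolding Collect_conj_eq
      by (intro vs.subspace_inter lin_subspace_vimage[OF lin_comp[OF lin_braiding]
        subspace_tensor_space]
          lin_intros lin_ident vs)
    then show "vs.subspace ?J" by (intro subspace_Ball[OF vs I_subspace])
    show "?J \<subseteq> V" using I_carrier by blast
    fix x j y assume x: "x \<in> ?J" and "y \<in> W j"
    then have V: "x \<in> V" "y \<in> V" and xI: "x \<in> I" using I_carrier component_in_carrier by auto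
    have IV: "I \<otimes>\<otimes> V \<subseteq> V \<otimes>\<otimes> V" "V \<otimes>\<otimes> I \<subseteq> V \<otimes>\<otimes> V"
      by (intro tensor_space_mono I_carrier subset_refl)+
    have 1: "c (m (x \<otimes> y) \<otimes> z) \<in> V \<otimes>\<otimes> I" "c (m (y \<otimes> x) \<otimes> z) \<in> V \<otimes>\<otimes> I" if z: "z \<in> V" for z
    proof -
      have "c (m (x \<otimes> y) \<otimes> z) = tensor_map s s id m (assoc s s s (on12 s c (on23 s c (tensor tscale
        s (x \<otimes> y) z))))"
        using V z by (simp add: tensor_in braiding_mult_left[symmetric]
          tensor_map_tensor[OF lin_mult lid])
      also have "\<dots> \<in> V \<otimes>\<otimes> I"
        by (rule tensor_map_in[OF lid lin_mult _ mult_I_left assoc_in[OF vs vs vs on12_in[OF br J(1)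
              on23_in[OF br braiding_carrier tensor_in[OF tensor_in[OF x V(2)] z]]]]]) simp_all
      finally show "c (m (x \<otimes> y) \<otimes> z) \<in> V \<otimes>\<otimes> I" .
      have "c (m (y \<otimes> x) \<otimes> z) = tensor_map s s id m (assoc s s s (on12 s c (on23 s c (tensor tscale
        s (y \<otimes> x) z))))"
        using V z by (simp add: tensor_in braiding_mult_left[symmetric]
          tensor_map_tensor[OF lin_mult lid])
      also have "\<dots> \<in> V \<otimes>\<otimes> I"
        by (rule tensor_map_in[OF lid lin_mult _ mult_I_right
          assoc_in[OF vs vs vs on12_in[OF br braiding_carrier
              on23_in[OF br J(1) tensor_in[OF tensor_in[OF V(2) x] z]]]]]) simp_all
      finally show "c (m (y \<otimes> x) \<otimes> z) \<in> V \<otimes>\<otimes> I" .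
    qed
    have 2: "c (z \<otimes> m (x \<otimes> y)) \<in> I \<otimes>\<otimes> V" "c (z \<otimes> m (y \<otimes> x)) \<in> I \<otimes>\<otimes> V" if z: "z \<in> V" for z
    proof -
      have *: "c (z \<otimes> m (u \<otimes> v)) = tensor_map s s m id (on23 s c (on12 s c (tensor tscale s (z \<otimes> u)
        v)))"
        if "u \<in> V" "v \<in> V" for u v
        using that z by (simp add: tensor_in braiding_mult_right[symmetric] assoc_tensor[OF vs vs vs]
            tensor_map_tensor[OF lid lin_mult])
      show "c (z \<otimes> m (x \<otimes> y)) \<in> I \<otimes>\<otimes> V"
        unfolding *[OF V]
        by (rule tensor_map_in[OF lin_mult lid mult_I_left _
          on23_in[OF br braiding_carrier on12_in[OF br J(2)
              tensor_in[OF tensor_in[OF z x] V(2)]]]]) simp_all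
      show "c (z \<otimes> m (y \<otimes> x)) \<in> I \<otimes>\<otimes> V"
        unfolding *[OF V(2,1)]
        by (rule tensor_map_in[OF lin_mult lid mult_I_right _
          on23_in[OF br J(2) on12_in[OF br braiding_carrier
              tensor_in[OF tensor_in[OF z V(2)] x]]]]) simp_all
    qed
    show "m (x \<otimes> y) \<in> ?J" "m (y \<otimes> x) \<in> ?J"
      using 1 2 xI V by (auto intro: mult_I_elem_left mult_I_elem_right)
  next
    fix n :: nat assume n: "n \<ge> 2"
    have "c (x \<otimes> y) \<in> V \<otimes>\<otimes> I \<and> c (y \<otimes> x) \<in> I \<otimes>\<otimes> V" if x: "x \<in> E_comp B n" and y: "y \<in> V" for x y
    proof -
      have "vs.subspace {y. c (x \<otimes> y) \<in> V \<otimes>\<otimes> I \<and> c (y \<otimes> x) \<in> I \<otimes>\<otimes> V}"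
        unfolding Collect_conj_eq
        by (intro vs.subspace_inter lin_subspace_vimage[OF lin_comp[OF lin_braiding]
          subspace_tensor_space]
            lin_intros lin_ident vs)
      moreover have "W j \<subseteq> {y. c (x \<otimes> y) \<in> V \<otimes>\<otimes> I \<and> c (y \<otimes> x) \<in> I \<otimes>\<otimes> V}" for j
        using braiding_E[OF x n] tensor_space_mono[OF component_le_carrier E_subset_I[OF n]]
          tensor_space_mono[OF E_subset_I[OF n] component_le_carrier] by blast
      ultimately have "V \<subseteq> {y. c (x \<otimes> y) \<in> V \<otimes>\<otimes> I \<and> c (y \<otimes> x) \<in> I \<otimes>\<otimes> V}"
        unfolding carrier_eq by (intro vs.span_minimal) auto
      then show ?thesis using y by blast
    qed
    then show "E_comp B n \<subseteq> ?J" using E_subset_I[OF n] by blast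
  qed
  then have eq: "?J = I" by blast
  show "t \<in> I \<otimes>\<otimes> V \<Longrightarrow> c t \<in> V \<otimes>\<otimes> I" "t \<in> V \<otimes>\<otimes> I \<Longrightarrow> c t \<in> I \<otimes>\<otimes> V"
    using J1[unfolded eq] coideal_sum[unfolded eq] by blast+
qed

lemma outerE:
  assumes "t \<in> outer n"
  obtains t1 t2 where "t = t1 + t2" "t1 \<in> W 0 \<otimes>\<otimes> W n" "t2 \<in> W n \<otimes>\<otimes> W 0"
proof -
  have *: "ts.span (W i \<otimes>\<otimes> W j) = W i \<otimes>\<otimes> W j" for i j
    using subspace_tensor_space by simp
  show ?thesis using assms that unfolding outer_def ts.span_Un * by auto
qed

text \<open>
  This is the kernel of \<open>p \<otimes> p\<close> on \<open>V \<otimes> V\<close>, for the projection \<open>p\<close> with kernel \<open>I\<close> introduced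
  below; see \<open>pp_coideal_sum\<close> and \<open>pp_diff\<close>.
\<close>

definition coideal_sum :: "('k, 'a, 'a) tensors set" where
  "coideal_sum = tspan (I \<otimes>\<otimes> V \<union> V \<otimes>\<otimes> I)"

lemma coideal_sum_subspace: "ts.subspace coideal_sum"
  unfolding coideal_sum_def by (rule ts.subspace_span)

lemma coideal_sumI: "t \<in> I \<otimes>\<otimes> V \<Longrightarrow> t \<in> coideal_sum" "t \<in> V \<otimes>\<otimes> I \<Longrightarrow> t \<in> coideal_sum"
  unfolding coideal_sum_def by (auto intro: ts.span_base)

text \<open>
  Write \<open>\<Delta> x = t1 + t2\<close> with \<open>t1 = \<Delta>\<^sup>0\<^sup>,\<^sup>n x\<close> and \<open>t2 = \<Delta>\<^sup>n\<^sup>,\<^sup>0 x\<close>. By coassociativity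
  \<open>(id \<otimes> \<Delta>\<^sup>a\<^sup>,\<^sup>b) t1 = (\<Delta>\<^sup>0\<^sup>,\<^sup>a \<otimes> id) \<Delta>\<^sup>a\<^sup>,\<^sup>b x = 0\<close>, so \<open>t1\<close> lies in \<open>B\<^sup>0 \<otimes> E\<^sub>n\<close>; symmetrically
  \<open>t2\<close> lies in \<open>E\<^sub>n \<otimes> B\<^sup>0\<close>.
\<close>

lemma comult_E:
  assumes x: "x \<in> E_comp B n" and n: "n \<ge> 2"
  shows "D x \<in> coideal_sum"
proof -
  have xW: "x \<in> W n" and Dx: "D x \<in> outer n" using x E_comp_iff[OF n] by auto
  have xV: "x \<in> V" using xW component_in_carrier by auto
  obtain t1 t2 where t: "D x = t1 + t2" "t1 \<in> W 0 \<otimes>\<otimes> W n" "t2 \<in> W n \<otimes>\<otimes> W 0"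
    by (rule outerE[OF Dx])
  note lid = lin_id[OF vs] and lcc = lin_comult_comp
  have DxV: "D x \<in> V \<otimes>\<otimes> V" using comult_carrier[OF xV] .
  let ?L = "tensor_map tscale s D id (D x)" and ?R = "tensor_map s tscale id D (D x)"
  have L: "?L \<in> tensor_space tscale s (V \<otimes>\<otimes> V) V"
    by (rule tensor_map_in[OF lin_comult lid comult_carrier _ DxV]) simp_all
  have R: "?R \<in> tensor_space s tscale V (V \<otimes>\<otimes> V)"
    by (rule tensor_map_in[OF lid lin_comult _ comult_carrier DxV]) simp_all
  have LR: "assoc s s s ?L = ?R" by (rule coassociative[OF xV])
  have RL: "assoc_inv s s s ?R = ?L" unfolding LR[symmetric] by (rule assoc_inv_assoc[OF vs vs vs L])
  have split: "h (D x) = h t1 + h t2" if "lin tscale tscale h" for h :: "_ \<Rightarrow> ('k, _, _) tensors"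
    unfolding t(1) by (rule lin_add[OF that])
  have ltm: "lin tscale tscale (tensor_map r1 r2 f g)"
    for r1 :: "'k \<Rightarrow> 'x::ab_group_add \<Rightarrow> 'x" and r2 :: "'k \<Rightarrow> 'y::ab_group_add \<Rightarrow> 'y"
      and f :: "'u \<Rightarrow> 'x" and g :: "'v \<Rightarrow> 'y"
    by (intro lin_intros lin_ident vs_tensors)
  have z1: "tensor_map r1 r2 f g t1 = 0"
    if "lin s r1 f" "lin s r2 g" "(\<forall>x\<in>W 0. f x = 0) \<or> (\<forall>x\<in>W n. g x = 0)"
    for r1 :: "'k \<Rightarrow> 'x::ab_group_add \<Rightarrow> 'x" and r2 :: "'k \<Rightarrow> 'y::ab_group_add \<Rightarrow> 'y" and f g
    by (rule tensor_map_zero[OF that t(2)])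
  have z2: "tensor_map r1 r2 f g t2 = 0"
    if "lin s r1 f" "lin s r2 g" "(\<forall>x\<in>W n. f x = 0) \<or> (\<forall>x\<in>W 0. g x = 0)"
    for r1 :: "'k \<Rightarrow> 'x::ab_group_add \<Rightarrow> 'x" and r2 :: "'k \<Rightarrow> 'y::ab_group_add \<Rightarrow> 'y" and f g
    by (rule tensor_map_zero[OF that t(3)])
  have p0: "\<forall>x\<in>W n. \<pi> 0 x = 0" and p: "\<And>a. a \<ge> 1 \<Longrightarrow> \<forall>x\<in>W 0. \<pi> a x = 0"
    using n by (auto simp: proj_zero_or_same)
  have cc: "\<And>a b. a + b \<ge> 1 \<Longrightarrow> \<forall>x\<in>W 0. comult_comp B a b x = 0"
    by (auto intro!: comult_comp_zero)
  have "t1 \<in> W 0 \<otimes>\<otimes> E_comp B n"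
  proof (rule tensor_E_right[OF t(2)])
    fix a b :: nat assume ab: "a \<ge> 1" "b \<ge> 1" "a + b = n"
    have "tensor_map s tscale id (comult_comp B a b) t1 = tensor_map s tscale (\<pi> 0) (comult_comp B a
      b) t1"
      by (rule tensor_map_eq[OF lid lin_proj lcc lcc _ _ t(2)]) (simp_all add: proj_same)
    also have "\<dots> = tensor_map s tscale (\<pi> 0) (comult_comp B a b) (D x)"
      using p0 by (simp add: split[OF ltm] z2[OF lin_proj lcc])
    also have "\<dots> = tensor_map s tscale (\<pi> 0) (tensor_map s s (\<pi> a) (\<pi> b)) ?R"
      by (rule tensor_map_comp[symmetric, OF lid lin_proj lin_comult lin_tensor_map2 lin_proj lcc _
        _ DxV])
        (simp_all add: comult_comp_def)
    also have "\<dots> = assoc s s s (tensor_map tscale s (tensor_map s s (\<pi> 0) (\<pi> a)) (\<pi> b) ?L)"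
      unfolding LR[symmetric] by (rule assoc_natural[symmetric, OF lin_proj lin_proj lin_proj L])
    also have "tensor_map tscale s (tensor_map s s (\<pi> 0) (\<pi> a)) (\<pi> b) ?L
        = tensor_map tscale s (comult_comp B 0 a) (\<pi> b) (D x)"
      by (rule tensor_map_comp[OF lin_comult lin_tensor_map2 lid lin_proj lcc lin_proj _ _ DxV])
        (simp_all add: comult_comp_def)
    also have "\<dots> = 0"
      using p[OF ab(2)] cc[of 0 a] ab
        by (simp add: split[OF ltm] z1[OF lcc lin_proj] z2[OF lcc lin_proj])
    also have "assoc s s s 0 = 0" by (rule lin_zero[OF lin_assoc[OF lin_ident[OF vs_tensors]]])
    finally show "tensor_map s tscale id (comult_comp B a b) t1 = 0" .
  qed
  then have 1: "t1 \<in> coideal_sum"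
    using tensor_space_mono[OF component_le_carrier E_subset_I[OF n]] by (blast intro: coideal_sumI)
  have "t2 \<in> E_comp B n \<otimes>\<otimes> W 0"
  proof (rule tensor_E_left[OF t(3)])
    fix a b :: nat assume ab: "a \<ge> 1" "b \<ge> 1" "a + b = n"
    have "tensor_map tscale s (comult_comp B a b) id t2 = tensor_map tscale s (comult_comp B a b) (\<pi>
      0) t2"
      by (rule tensor_map_eq[OF lcc lcc lid lin_proj _ _ t(3)]) (simp_all add: proj_same)
    also have "\<dots> = tensor_map tscale s (comult_comp B a b) (\<pi> 0) (D x)"
      using p0 by (simp add: split[OF ltm] z1[OF lcc lin_proj])
    also have "\<dots> = tensor_map tscale s (tensor_map s s (\<pi> a) (\<pi> b)) (\<pi> 0) ?L"
      by (rule tensor_map_comp[symmetric, OF lin_comult lin_tensor_map2 lid lin_proj lcc lin_proj _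
        _ DxV])
        (simp_all add: comult_comp_def)
    also have "\<dots> = assoc_inv s s s (tensor_map s tscale (\<pi> a) (tensor_map s s (\<pi> b) (\<pi> 0)) ?R)"
      unfolding RL[symmetric] by (rule assoc_inv_natural[symmetric, OF lin_proj lin_proj lin_proj R])
    also have "tensor_map s tscale (\<pi> a) (tensor_map s s (\<pi> b) (\<pi> 0)) ?R
        = tensor_map s tscale (\<pi> a) (comult_comp B b 0) (D x)"
      by (rule tensor_map_comp[OF lid lin_proj lin_comult lin_tensor_map2 lin_proj lcc _ _ DxV])
        (simp_all add: comult_comp_def)
    also have "\<dots> = 0"
      using p[OF ab(1)] cc[of b 0] ab
        by (simp add: split[OF ltm] z1[OF lin_proj lcc] z2[OF lin_proj lcc])
    also have "assoc_inv s s s 0 = 0" by (rule lin_zero[OF lin_assoc_inv[OF lin_ident[OF vs_tensors]]])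
    finally show "tensor_map tscale s (comult_comp B a b) id t2 = 0" .
  qed
  then have 2: "t2 \<in> coideal_sum"
    using tensor_space_mono[OF E_subset_I[OF n] component_le_carrier] by (blast intro: coideal_sumI)
  from 1 2 show ?thesis unfolding t(1) by (rule ts.subspace_add[OF coideal_sum_subspace])
qed

text \<open>
  In \<open>\<Delta> (x y) = (m \<otimes> m) (B \<otimes> c \<otimes> B) (\<Delta> x \<otimes> \<Delta> y)\<close> a factor from \<open>I\<close> stays in \<open>I\<close> while the braiding
  moves it to the other side, by \<open>braiding_I\<close>.
\<close>

lemma comult_I:
  assumes "x \<in> I" shows "D x \<in> coideal_sum"
proof -
  let ?J = "{x \<in> I. D x \<in> coideal_sum}"
  have "I \<subseteq> ?J"
  proof (rule I_minimal[OF two_sided_idealI])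
    show "vs.subspace ?J"
      unfolding Collect_conj_eq Collect_mem_eq
      by (intro vs.subspace_inter I_subspace lin_subspace_vimage[OF lin_comult coideal_sum_subspace])
    show "?J \<subseteq> V" using I_carrier by blast
    fix x j y assume x: "x \<in> ?J" and "y \<in> W j"
    then have V: "x \<in> V" "y \<in> V" using I_carrier component_in_carrier by auto
    note br = vs lin_braiding
    have Dy: "D y \<in> V \<otimes>\<otimes> V" by (rule comult_carrier[OF V(2)])
    have Dx: "D x \<in> tspan (I \<otimes>\<otimes> V \<union> V \<otimes>\<otimes> I)" using x by (simp add: coideal_sum_def)
    have "D (m (x \<otimes> y)) = tensor_map s s m m (middle s c (tensor tscale tscale (D x) (D y)))"
      using V by (simp add: comult_mult tensor_in tensor_map_tensor[OF lin_comult lin_comult])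
    also have "\<dots> \<in> coideal_sum"
    proof (rule span_mapI[OF _ coideal_sum_subspace _ Dx])
      fix u assume "u \<in> I \<otimes>\<otimes> V \<union> V \<otimes>\<otimes> I"
      then show "tensor_map s s m m (middle s c (tensor tscale tscale u (D y))) \<in> coideal_sum"
      proof
        assume u: "u \<in> I \<otimes>\<otimes> V"
        show ?thesis
          by (rule coideal_sumI(1), rule tensor_map_in[OF lin_mult lin_mult mult_I_left mult_carrier
                middle_in[OF br braiding_carrier tensor_in[OF u Dy]]])
      next
        assume u: "u \<in> V \<otimes>\<otimes> I"
        show ?thesis
          by (rule coideal_sumI(2), rule tensor_map_in[OF lin_mult lin_mult mult_carrier mult_I_left
                middle_in[OF br braiding_I(1) tensor_in[OF u Dy]]])
      qed
    qed (intro lin_intros lin_ident vs_tensors)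
    finally have 1: "D (m (x \<otimes> y)) \<in> coideal_sum" .
    have "D (m (y \<otimes> x)) = tensor_map s s m m (middle s c (tensor tscale tscale (D y) (D x)))"
      using V by (simp add: comult_mult tensor_in tensor_map_tensor[OF lin_comult lin_comult])
    also have "\<dots> \<in> coideal_sum"
    proof (rule span_mapI[OF _ coideal_sum_subspace _ Dx])
      fix u assume "u \<in> I \<otimes>\<otimes> V \<union> V \<otimes>\<otimes> I"
      then show "tensor_map s s m m (middle s c (tensor tscale tscale (D y) u)) \<in> coideal_sum"
      proof
        assume u: "u \<in> I \<otimes>\<otimes> V"
        show ?thesis
          by (rule coideal_sumI(1), rule tensor_map_in[OF lin_mult lin_mult mult_I_right mult_carrier
                middle_in[OF br braiding_I(2) tensor_in[OF Dy u]]])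
      next
        assume u: "u \<in> V \<otimes>\<otimes> I"
        show ?thesis
          by (rule coideal_sumI(2), rule tensor_map_in[OF lin_mult lin_mult mult_carrier mult_I_right
                middle_in[OF br braiding_carrier tensor_in[OF Dy u]]])
      qed
    qed (intro lin_intros lin_ident vs_tensors)
    finally have 2: "D (m (y \<otimes> x)) \<in> coideal_sum" .
    show "m (x \<otimes> y) \<in> ?J" "m (y \<otimes> x) \<in> ?J"
      using 1 2 x mult_I_elem_left[OF _ V(2)] mult_I_elem_right[OF _ V(2)] by blast+
  next
    fix n :: nat assume "n \<ge> 2"
    then show "E_comp B n \<subseteq> ?J" using E_subset_I comult_E by blast
  qed
  then show ?thesis using assms by blast
qed

lemma mult_coideal_sum: "t \<in> coideal_sum \<Longrightarrow> m t \<in> I"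
  unfolding coideal_sum_def by (erule span_mapI[OF lin_mult I_subspace, rotated]) (auto intro:
    mult_I_left mult_I_right)

lemma braiding_coideal_sum: "t \<in> coideal_sum \<Longrightarrow> c t \<in> coideal_sum"
  unfolding coideal_sum_def
  by (erule span_mapI[OF lin_braiding ts.subspace_span, rotated]) (auto intro: ts.span_base braiding_I)

subsection \<open>The projection onto the quotient\<close>

abbreviation (input) "p \<equiv> S_proj B"
abbreviation (input) "pp \<equiv> tensor_map s s p p"

lemma
  shows lin_p: "lin s s p"
    and p_carrier: "x \<in> V \<Longrightarrow> p x \<in> V"
    and p_diff: "x \<in> V \<Longrightarrow> x - p x \<in> I"
    and p_I: "x \<in> I \<Longrightarrow> p x = 0"
  using quot_proj_spec[OF vs carrier_subspace I_subspace I_carrier] unfolding S_proj_def I_def by blast+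

lemma p_kernel: "x \<in> V \<Longrightarrow> p x = 0 \<longleftrightarrow> x \<in> I"
  using p_diff p_I by force

lemma lin_pp: "lin tscale tscale pp"
  by (rule lin_tensor_map2)

lemma pp_coideal_sum:
  assumes "t \<in> coideal_sum" shows "pp t = 0"
proof -
  have "pp t \<in> {0}"
  proof (rule span_mapI[OF lin_pp ts.subspace_single_0 _ assms[unfolded coideal_sum_def]])
    fix t assume "t \<in> I \<otimes>\<otimes> V \<union> V \<otimes>\<otimes> I"
    then show "pp t \<in> {0}"
      using tensor_map_zero[OF lin_p lin_p, of I V t] tensor_map_zero[OF lin_p lin_p, of V I t] p_I
        by auto
  qed
  then show ?thesis by simp
qed

lemma pp_diff:
  assumes "t \<in> V \<otimes>\<otimes> V" shows "t - pp t \<in> coideal_sum"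
proof (rule tensor_space_mapI[OF _ coideal_sum_subspace _ assms])
  interpret q: vector_space_pair "tscale :: 'k \<Rightarrow> ('k, 'a, 'a) tensors \<Rightarrow> _"
    "tscale :: 'k \<Rightarrow> ('k, 'a, 'a) tensors \<Rightarrow> _" ..
  show "lin tscale tscale (\<lambda>t. t - pp t)"
    by (intro q.linear_compose_sub lin_ident vs_tensors lin_pp)
  fix x y assume V: "x \<in> V" "y \<in> V"
  have "x \<otimes> y - pp (x \<otimes> y) = (x - p x) \<otimes> y + p x \<otimes> (y - p y)"
    by (simp add: tensor_map_tensor[OF lin_p lin_p] lin_diff[OF lin_tensor_left[OF lin_ident[OF vs]]]
        lin_diff[OF lin_tensor_right[OF lin_ident[OF vs]]])
  also have "\<dots> \<in> coideal_sum"
    using V p_diff p_carrier by (intro ts.subspace_add coideal_sum_subspace) (auto intro: coideal_sumI)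
  finally show "x \<otimes> y - pp (x \<otimes> y) \<in> coideal_sum" .
qed

lemma p_mult: "t \<in> V \<otimes>\<otimes> V \<Longrightarrow> p (m (pp t)) = p (m t)"
  using p_I[OF mult_coideal_sum[OF pp_diff]] by (simp add: lin_diff[OF lin_mult] lin_diff[OF lin_p])

lemma pp_comult: "x \<in> V \<Longrightarrow> pp (D (p x)) = pp (D x)"
  using pp_coideal_sum[OF comult_I[OF p_diff]]
    by (simp add: lin_diff[OF lin_comult] lin_diff[OF lin_pp])

lemma pp_braiding: "t \<in> V \<otimes>\<otimes> V \<Longrightarrow> pp (c (pp t)) = pp (c t)"
  using pp_coideal_sum[OF braiding_coideal_sum[OF pp_diff]]
    by (simp add: lin_diff[OF lin_braiding] lin_diff[OF lin_pp])

lemma p_proj: "x \<in> V \<Longrightarrow> p (\<pi> n (p x)) = p (\<pi> n x)"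
  using p_I[OF I_graded[OF p_diff]] by (simp add: lin_diff[OF lin_proj] lin_diff[OF lin_p])

abbreviation (input) "B' \<equiv> S_bialg B"

lemma S_simps:
  "scale B' = s" "carrier B' = p ` V" "mult B' = (\<lambda>t. p (m t))" "comult B' = (\<lambda>x. pp (D x))"
  "braiding B' = (\<lambda>t. pp (c t))" "component B' n = p ` W n"
  by (simp_all add: S_bialg_def Let_def comp_def)

lemma carrier_tensor_image: "p ` V \<otimes>\<otimes> p ` V = pp ` (V \<otimes>\<otimes> V)"
  by (rule tensor_map_image[OF lin_p lin_p])

lemma carrier_tensor3_image:
  "tensor_space tscale s (p ` V \<otimes>\<otimes> p ` V) (p ` V) = tensor_map tscale s pp p ` tensor_space tscale s
    (V \<otimes>\<otimes> V) V"
  unfolding carrier_tensor_image by (rule tensor_map_image[OF lin_pp lin_p])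

text \<open>
  Every tensor over the quotient is the image of a tensor over \<open>B\<close>, and the projection can be
  pulled through each operation in turn. So each identity is the image of the same identity for
  \<open>B\<close>.
\<close>

theorem strong_core_S: "strong_core B'"
  unfolding strong_core_def S_simps
proof (intro conjI allI impI)
  note lid = lin_id[OF vs] and br = vs lin_braiding
  let ?c = "\<lambda>t. pp (c t)" and ?m = "\<lambda>t. p (m t)" and ?D = "\<lambda>x. pp (D x)"
  let ?P3 = "tensor_map tscale s pp p" and ?Q3 = "tensor_map s tscale p pp"
  show lc: "lin tscale tscale ?c" by (rule lin_comp[OF lin_pp lin_braiding])
  show lm: "lin tscale s ?m" by (rule lin_comp[OF lin_p lin_mult])
  show lD: "lin s tscale ?D" by (rule lin_comp[OF lin_pp lin_comult])
  have idb: "\<And>x. x \<in> X \<Longrightarrow> id (p x) = p (id x)" for X by simp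
  have on12n: "on12 s ?c (?P3 t) = ?P3 (on12 s c t)"
    and on23n: "on23 s ?c (?P3 t) = ?P3 (on23 s c t)"
    and on12c: "on12 s c t \<in> tensor_space tscale s (V \<otimes>\<otimes> V) V"
    and on23c: "on23 s c t \<in> tensor_space tscale s (V \<otimes>\<otimes> V) V"
    if "t \<in> tensor_space tscale s (V \<otimes>\<otimes> V) V" for t
    by (rule on12_natural[OF lin_braiding lc lin_p pp_braiding that]
        on23_natural[OF lin_braiding lc lin_p pp_braiding braiding_carrier that]
        on12_in[OF br braiding_carrier that] on23_in[OF br braiding_carrier that]; assumption?)+
  have m_left: "tensor_map s s ?m id (?P3 t) = pp (tensor_map s s m id t)"
    if "t \<in> tensor_space tscale s (V \<otimes>\<otimes> V) V" for t
    by (rule tensor_map_square[OF lin_pp lm lin_mult lin_p lin_p lid lid lin_p p_mult idb that])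
  have m_right: "tensor_map s s id ?m (?Q3 t) = pp (tensor_map s s id m t)"
    if "t \<in> tensor_space s tscale V (V \<otimes>\<otimes> V)" for t
    by (rule tensor_map_square[OF lin_p lid lid lin_p lin_pp lm lin_mult lin_p idb p_mult that])
  have D_left: "tensor_map tscale s ?D id (pp t) = ?P3 (tensor_map tscale s D id t)"
    if "t \<in> V \<otimes>\<otimes> V" for t
    by (rule tensor_map_square[OF lin_p lD lin_comult lin_pp lin_p lid lid lin_p pp_comult idb that])
  have D_right: "tensor_map s tscale id ?D (pp t) = ?Q3 (tensor_map s tscale id D t)"
    if "t \<in> V \<otimes>\<otimes> V" for t
    by (rule tensor_map_square[OF lin_p lid lid lin_p lin_p lD lin_comult lin_pp idb pp_comult that])
  have mi: "tensor_map s s m id t \<in> V \<otimes>\<otimes> V" if "t \<in> tensor_space tscale s (V \<otimes>\<otimes> V) V" for t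
    by (rule tensor_map_in[OF lin_mult lid mult_carrier _ that]) simp_all
  have im: "tensor_map s s id m t \<in> V \<otimes>\<otimes> V" if "t \<in> tensor_space s tscale V (V \<otimes>\<otimes> V)" for t
    by (rule tensor_map_in[OF lid lin_mult _ mult_carrier that]) simp_all
  have Di: "tensor_map tscale s D id t \<in> tensor_space tscale s (V \<otimes>\<otimes> V) V" if "t \<in> V \<otimes>\<otimes> V" for t
    by (rule tensor_map_in[OF lin_comult lid comult_carrier _ that]) simp_all
  have iD: "tensor_map s tscale id D t \<in> tensor_space s tscale V (V \<otimes>\<otimes> V)" if "t \<in> V \<otimes>\<otimes> V" for t
    by (rule tensor_map_in[OF lid lin_comult _ comult_carrier that]) simp_all
  note an = assoc_natural[OF lin_p lin_p lin_p] and ain = assoc_inv_natural[OF lin_p lin_p lin_p]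
  note ai = assoc_in[OF vs vs vs] and aii = assoc_inv_in[OF vs vs vs]
  show "vector_space s" by (rule vs)
  show "vs.subspace (p ` W n)" for n by (rule lin_subspace_image[OF lin_p component_subspace])
  interpret p: Vector_Spaces.linear s s p by (rule lin_p)
  show "p ` V = vs.span (\<Union>n. p ` W n)"
    unfolding carrier_eq p.span_image[symmetric] image_UN ..
  show "\<exists>f. lin s s f \<and> (\<forall>x\<in>p ` W n. f x = x) \<and> (\<forall>k x. k \<noteq> n \<longrightarrow> x \<in> p ` W k \<longrightarrow> f x = 0)" for n
    by (intro exI[of _ "\<lambda>x. p (\<pi> n x)"] conjI lin_comp[OF lin_p lin_proj])
      (auto simp: p_proj component_in_carrier proj_same proj_other lin_zero[OF lin_p])
  have tW: "p ` W i \<otimes>\<otimes> p ` W j = pp ` (W i \<otimes>\<otimes> W j)" for i j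
    by (rule tensor_map_image[OF lin_p lin_p])
  show "?m ` (p ` W i \<otimes>\<otimes> p ` W j) = p ` W (i + j)" for i j
    unfolding tW mult_strong[symmetric] image_image
    by (rule image_cong) (use p_mult tens_carrier in auto)
  show "?D x \<in> tspan (\<Union>a\<le>n. p ` W a \<otimes>\<otimes> p ` W (n - a))" if x: "x \<in> p ` W n" for n x
  proof -
    obtain y where y: "y \<in> W n" "x = p y" using x by blast
    have "pp (D y) \<in> tspan (\<Union>a\<le>n. p ` W a \<otimes>\<otimes> p ` W (n - a))"
      by (rule span_mapI[OF lin_pp ts.subspace_span _ comult_graded[OF y(1)]])
        (auto simp: tW intro!: ts.span_base)
    then show ?thesis using y pp_comult component_in_carrier by simp
  qed
  show "?c t \<in> p ` W b \<otimes>\<otimes> p ` W a" if t: "t \<in> p ` W a \<otimes>\<otimes> p ` W b" for a b t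
  proof -
    obtain u where u: "u \<in> W a \<otimes>\<otimes> W b" "t = pp u" using t unfolding tW by blast
    then have "?c t = pp (c u)" using tens_carrier pp_braiding by blast
    then show ?thesis using braiding_graded[OF u(1)] unfolding tW by blast
  qed
  show "?c (tensor_map s s ?m id t) = tensor_map s s id ?m (assoc s s s (on12 s ?c (on23 s ?c t)))"
    if t: "t \<in> tensor_space tscale s (p ` V \<otimes>\<otimes> p ` V) (p ` V)" for t
  proof -
    obtain u where u: "u \<in> tensor_space tscale s (V \<otimes>\<otimes> V) V" "t = ?P3 u"
      using t unfolding carrier_tensor3_image by blast
    have "?c (tensor_map s s ?m id t) = pp (c (tensor_map s s m id u))"
      unfolding u(2) m_left[OF u(1)] by (rule pp_braiding[OF mi[OF u(1)]])
    also have "\<dots> = pp (tensor_map s s id m (assoc s s s (on12 s c (on23 s c u))))"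
      unfolding braiding_mult_left[OF u(1)] ..
    also have "\<dots> = tensor_map s s id ?m (assoc s s s (on12 s ?c (on23 s ?c t)))"
      unfolding u(2) on23n[OF u(1)] on12n[OF on23c[OF u(1)]] an[OF on12c[OF on23c[OF u(1)]]]
        m_right[OF ai[OF on12c[OF on23c[OF u(1)]]]] ..
    finally show ?thesis .
  qed
  show "?c (tensor_map s s id ?m (assoc s s s t)) = tensor_map s s ?m id (on23 s ?c (on12 s ?c t))"
    if t: "t \<in> tensor_space tscale s (p ` V \<otimes>\<otimes> p ` V) (p ` V)" for t
  proof -
    obtain u where u: "u \<in> tensor_space tscale s (V \<otimes>\<otimes> V) V" "t = ?P3 u"
      using t unfolding carrier_tensor3_image by blast
    have "?c (tensor_map s s id ?m (assoc s s s t)) = pp (c (tensor_map s s id m (assoc s s s u)))"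
      unfolding u(2) an[OF u(1)] m_right[OF ai[OF u(1)]] by (rule pp_braiding[OF im[OF ai[OF u(1)]]])
    also have "\<dots> = pp (tensor_map s s m id (on23 s c (on12 s c u)))"
      unfolding braiding_mult_right[OF u(1)] ..
    also have "\<dots> = tensor_map s s ?m id (on23 s ?c (on12 s ?c t))"
      unfolding u(2) on12n[OF u(1)] on23n[OF on12c[OF u(1)]] m_left[OF on23c[OF on12c[OF u(1)]]] ..
    finally show ?thesis .
  qed
  show "assoc s s s (tensor_map tscale s ?D id (?D x)) = tensor_map s tscale id ?D (?D x)"
    if x: "x \<in> p ` V" for x
  proof -
    obtain y where y: "y \<in> V" "x = p y" using x by blast
    note Dy = comult_carrier[OF y(1)]
    have "?D x = pp (D y)" using y pp_comult by simp
    then show ?thesis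
      by (simp only: D_left[OF Dy] D_right[OF Dy] an[OF Di[OF Dy]] coassociative[OF y(1)])
  qed
  show "tensor_map tscale s ?D id (?c t)
      = on23 s ?c (on12 s ?c (assoc_inv s s s (tensor_map s tscale id ?D t)))"
    if t: "t \<in> p ` V \<otimes>\<otimes> p ` V" for t
  proof -
    obtain u where u: "u \<in> V \<otimes>\<otimes> V" "t = pp u" using t unfolding carrier_tensor_image by blast
    have "tensor_map tscale s ?D id (?c t) = ?P3 (tensor_map tscale s D id (c u))"
      unfolding u(2) pp_braiding[OF u(1)] by (rule D_left[OF braiding_carrier[OF u(1)]])
    also have "\<dots> = ?P3 (on23 s c (on12 s c (assoc_inv s s s (tensor_map s tscale id D u))))"
      unfolding comult_braiding_left[OF u(1)] ..
    also have "\<dots> = on23 s ?c (on12 s ?c (assoc_inv s s s (tensor_map s tscale id ?D t)))"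
      unfolding u(2) D_right[OF u(1)] ain[OF iD[OF u(1)]] on12n[OF aii[OF iD[OF u(1)]]]
        on23n[OF on12c[OF aii[OF iD[OF u(1)]]]] ..
    finally show ?thesis .
  qed
  show "assoc_inv s s s (tensor_map s tscale id ?D (?c t))
      = on12 s ?c (on23 s ?c (tensor_map tscale s ?D id t))"
    if t: "t \<in> p ` V \<otimes>\<otimes> p ` V" for t
  proof -
    obtain u where u: "u \<in> V \<otimes>\<otimes> V" "t = pp u" using t unfolding carrier_tensor_image by blast
    have "assoc_inv s s s (tensor_map s tscale id ?D (?c t)) = ?P3 (assoc_inv s s s (tensor_map s
      tscale id D (c u)))"
      unfolding u(2) pp_braiding[OF u(1)] D_right[OF braiding_carrier[OF u(1)]]
      by (rule ain[OF iD[OF braiding_carrier[OF u(1)]]])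
    also have "\<dots> = ?P3 (on12 s c (on23 s c (tensor_map tscale s D id u)))"
      unfolding comult_braiding_right[OF u(1)] ..
    also have "\<dots> = on12 s ?c (on23 s ?c (tensor_map tscale s ?D id t))"
      unfolding u(2) D_left[OF u(1)] on23n[OF Di[OF u(1)]] on12n[OF on23c[OF Di[OF u(1)]]] ..
    finally show ?thesis .
  qed
  show "?D (?m t) = tensor_map s s ?m ?m (middle s ?c (tensor_map tscale tscale ?D ?D t))"
    if t: "t \<in> p ` V \<otimes>\<otimes> p ` V" for t
  proof -
    obtain u where u: "u \<in> V \<otimes>\<otimes> V" "t = pp u" using t unfolding carrier_tensor_image by blast
    let ?u = "tensor_map tscale tscale D D u"
    have DD: "?u \<in> tensor_space tscale tscale (V \<otimes>\<otimes> V) (V \<otimes>\<otimes> V)"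
      by (rule tensor_map_in[OF lin_comult lin_comult comult_carrier comult_carrier u(1)])
    have "?D (?m t) = pp (D (m u))"
      unfolding u(2) p_mult[OF u(1)] by (rule pp_comult[OF mult_carrier[OF u(1)]])
    also have "\<dots> = pp (tensor_map s s m m (middle s c ?u))"
      unfolding comult_mult[OF u(1)] ..
    also have "\<dots> = tensor_map s s ?m ?m (tensor_map tscale tscale pp pp (middle s c ?u))"
      by (rule tensor_map_square[symmetric, OF lin_pp lm lin_mult lin_p lin_pp lm lin_mult lin_p
        p_mult p_mult
            middle_in[OF br braiding_carrier DD]])
    also have "tensor_map tscale tscale pp pp (middle s c ?u) = middle s ?c (tensor_map tscale
      tscale pp pp ?u)"
      by (rule middle_natural[symmetric, OF lin_braiding lc lin_p pp_braiding braiding_carrier DD])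
    also have "tensor_map tscale tscale pp pp ?u = tensor_map tscale tscale ?D ?D t"
      unfolding u(2)
      by (rule tensor_map_square[symmetric, OF lin_p lD lin_comult lin_pp lin_p lD lin_comult lin_pp
            pp_comult pp_comult u(1)])
    finally show ?thesis .
  qed
qed

lemma proj_S:
  assumes "x \<in> V" shows "hom_proj B' n (p x) = p (\<pi> n x)"
proof -
  interpret S: strong_core B' by (rule strong_core_S)
  have "p (\<pi> n (p x)) = hom_proj B' n (p x)"
    by (rule S.proj_unique[unfolded S_simps, OF lin_comp[OF lin_p lin_proj]])
      (use assms in \<open>auto simp: p_proj component_in_carrier proj_same proj_other lin_zero[OF lin_p]\<close>)
  then show ?thesis using p_proj[OF assms] by simp
qed

text \<open>
  The projection respects the grading, as \<open>I\<close> is a graded ideal, and the coproduct, as \<open>I\<close> is a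
  coideal.
\<close>

lemma comult_comp_S:
  assumes "x \<in> V" shows "comult_comp B' a b (p x) = pp (comult_comp B a b x)"
proof -
  interpret S: strong_core B' by (rule strong_core_S)
  show ?thesis
    unfolding comult_comp_def S_simps pp_comult[OF assms]
    by (rule tensor_map_square[OF lin_p S.lin_proj[unfolded S_simps] lin_proj lin_p
          lin_p S.lin_proj[unfolded S_simps] lin_proj lin_p proj_S proj_S comult_carrier[OF assms]])
qed

lemma p_injective_low_degree:
  assumes d: "d \<ge> 2" and E: "\<And>k. 2 \<le> k \<Longrightarrow> k < d \<Longrightarrow> E_comp B k \<subseteq> {0}"
    and x: "x \<in> W n" "n < d" "p x = 0"
  shows "x = 0"
proof -
  have "x \<in> I" using x p_kernel component_in_carrier by blast
  from I_low_degree(1)[OF d E this x(2)] show ?thesis using proj_same[OF x(1)] by simp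
qed

text \<open>
  The components of \<open>\<Delta> x\<close> that define \<open>E\<^sub>n\<close> have both degrees below \<open>n \<le> d\<close>, where the projection
  is injective. Hence a lift \<open>x\<close> of an element of \<open>E\<^sub>n(B/I)\<close> lies in \<open>E\<^sub>n(B)\<close> and is killed by the
  projection.
\<close>

lemma E_S_zero:
  assumes d: "d \<ge> 2" and E: "\<And>k. 2 \<le> k \<Longrightarrow> k < d \<Longrightarrow> E_comp B k \<subseteq> {0}"
    and n: "2 \<le> n" "n \<le> d"
  shows "E_comp B' n \<subseteq> {0}"
proof
  fix z assume z: "z \<in> E_comp B' n"
  then obtain x where x: "x \<in> W n" "z = p x" by (auto simp: E_comp_def S_simps)
  have "x \<in> E_comp B n"
    unfolding E_comp_def
  proof (intro CollectI conjI allI impI x(1))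
    fix a b :: nat assume ab: "a \<ge> 1" "b \<ge> 1" "a + b = n"
    have xV: "x \<in> V" using x(1) component_in_carrier by blast
    have inj: "\<And>y k. k < n \<Longrightarrow> y \<in> W k \<Longrightarrow> p y = 0 \<Longrightarrow> y = 0"
      using p_injective_low_degree[OF d E] n by simp
    show "comult_comp B a b x = 0"
    proof (rule tensor_map_injective[OF lin_p component_subspace inj lin_p component_subspace inj
          comult_comp_carrier[OF xV]])
      show "pp (comult_comp B a b x) = 0"
        using z ab x(2) comult_comp_S[OF xV] by (auto simp: E_comp_def)
    qed (use ab in auto)
  qed
  then show "z \<in> {0}"
    using E_subset_I[OF n(1)] p_I x(2) by blast
qed

end

section \<open>Graded braided bialgebras as instances\<close>

text \<open>
  The components of an element are linear functions on \<open>V\<close>; to obtain maps of the ambient space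
  they are composed with a linear retraction onto \<open>V\<close>.
\<close>

lemma internal_direct_sum_projections:
  fixes s :: "'k::field \<Rightarrow> 'a::ab_group_add \<Rightarrow> 'a"
  assumes vs: "vector_space s" and V: "module.subspace s V" and ds: "internal_direct_sum s V W"
  shows "V = module.span s (\<Union>n. W n)"
    and "\<exists>f. lin s s f \<and> (\<forall>x\<in>W n. f x = x) \<and> (\<forall>k x. k \<noteq> n \<longrightarrow> x \<in> W k \<longrightarrow> f x = 0)"
proof -
  interpret vector_space s by fact
  have W: "subspace (W n)" "W n \<subseteq> V" for n using ds by (auto simp: internal_direct_sum_def)
  define dec where "dec x f \<longleftrightarrow> (\<forall>n. f n \<in> W n) \<and> finite {n. f n \<noteq> 0} \<and> x = (\<Sum>n | f n \<noteq> 0. f n)" for x f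
  have ex1: "\<exists>!f. dec x f" if "x \<in> V" for x
    using ds that unfolding internal_direct_sum_def dec_def by blast
  have dec_sum: "x = (\<Sum>n\<in>F. f n)" if "dec x f" "finite F" "{n. f n \<noteq> 0} \<subseteq> F" for x f F
    using that unfolding dec_def by (auto intro!: sum.mono_neutral_left)
  have decI: "dec x f" if "\<And>n. f n \<in> W n" "finite F" "\<And>n. n \<notin> F \<Longrightarrow> f n = 0" "x = (\<Sum>n\<in>F. f n)" for x f F
  proof -
    have "{n. f n \<noteq> 0} \<subseteq> F" using that(3) by auto
    then show ?thesis
      unfolding dec_def using that(1,2,4)
      by (auto intro: finite_subset sum.mono_neutral_right)
  qed
  have dec_add: "dec (x + y) (\<lambda>n. f n + g n)" if "dec x f" "dec y g" for x y f g
  proof (rule decI[of _ "{n. f n \<noteq> 0} \<union> {n. g n \<noteq> 0}"])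
    show "x + y = (\<Sum>n\<in>{n. f n \<noteq> 0} \<union> {n. g n \<noteq> 0}. f n + g n)"
      using dec_sum[OF that(1), of "{n. f n \<noteq> 0} \<union> {n. g n \<noteq> 0}"]
        dec_sum[OF that(2), of "{n. f n \<noteq> 0} \<union> {n. g n \<noteq> 0}"] that
      by (simp add: sum.distrib dec_def)
  qed (use that subspace_add[OF W(1)] in \<open>auto simp: dec_def\<close>)
  have dec_scale: "dec (s a x) (\<lambda>n. s a (f n))" if "dec x f" for a x f
    using that subspace_scale[OF W(1)]
    by (intro decI[of _ "{n. f n \<noteq> 0}"]) (auto simp: dec_def scale_sum_right)
  have dec_comp: "dec x (\<lambda>k. if k = n then x else 0)" if "x \<in> W n" for x n
    using that subspace_0[OF W(1)] by (intro decI[of _ "{n}"]) auto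
  define g where "g x = (THE f. dec x f)" for x
  have g: "dec x (g x)" if "x \<in> V" for x
    unfolding g_def using theI'[OF ex1[OF that]] .
  have gI: "g x = f" if "dec x f" "x \<in> V" for x f
    using ex1[OF that(2)] g[OF that(2)] that(1) by blast
  show "V = span (\<Union>n. W n)"
  proof
    show "span (\<Union>n. W n) \<subseteq> V" using W(2) by (intro span_minimal V) blast
    show "V \<subseteq> span (\<Union>n. W n)"
    proof
      fix x assume "x \<in> V"
      from g[OF this] have x: "x = (\<Sum>n | g x n \<noteq> 0. g x n)" and gx: "\<And>n. g x n \<in> W n"
        unfolding dec_def by blast+
      have "(\<Sum>n | g x n \<noteq> 0. g x n) \<in> span (\<Union>n. W n)"
        by (intro span_sum span_base) (use gx in blast)
      with x show "x \<in> span (\<Union>n. W n)" by (rule ssubst)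
    qed
  qed
  \<comment> \<open>identity minus the quotient map by \<open>V\<close> is a retraction onto \<open>V\<close>\<close>
  define r where "r x = x - quot_proj s UNIV V x" for x
  note q = quot_proj_spec[OF vs subspace_UNIV V subset_UNIV]
  have r: "r x \<in> V" for x unfolding r_def by (rule q(3)) simp
  have rV: "r x = x" if "x \<in> V" for x unfolding r_def using q(4)[OF that] by simp
  have lr: "r (x + y) = r x + r y" "r (s a x) = s a (r x)" for x y a
    unfolding r_def by (simp_all add: lin_add[OF q(1)] lin_scale[OF q(1)] scale_right_diff_distrib)
  have g_add: "g (x + y) = (\<lambda>n. g x n + g y n)" if "x \<in> V" "y \<in> V" for x y
    using that by (intro gI dec_add g subspace_add[OF V])
  have g_scale: "g (s a x) = (\<lambda>n. s a (g x n))" if "x \<in> V" for a x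
    using that by (intro gI dec_scale g subspace_scale[OF V])
  show "\<exists>f. lin s s f \<and> (\<forall>x\<in>W n. f x = x) \<and> (\<forall>k x. k \<noteq> n \<longrightarrow> x \<in> W k \<longrightarrow> f x = 0)"
  proof (intro exI[of _ "\<lambda>x. g (r x) n"] conjI ballI allI impI)
    show "lin s s (\<lambda>x. g (r x) n)"
      unfolding Vector_Spaces.linear_iff using vs by (simp add: lr g_add g_scale r)
    have gk: "g (r x) = (\<lambda>i. if i = k then x else 0)" if "x \<in> W k" for x k
      using gI[OF dec_comp[OF that]] rV subsetD[OF W(2) that] by simp
    show "g (r x) n = x" if "x \<in> W n" for x by (simp add: gk[OF that])
    show "g (r x) n = 0" if "k \<noteq> n" "x \<in> W k" for k x using that(1) by (simp add: gk[OF that(2)])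
  qed
qed

lemma strong_coreI:
  assumes g: "graded_braided_bialgebra B" and st: "strongly_graded B"
  shows "strong_core B"
proof -
  have alg: "braided_algebra (scale B) (carrier B) (mult B) (unit_map B) (braiding B)"
    and coalg: "braided_coalgebra (scale B) (carrier B) (comult B) (counit B) (braiding B)"
    using g by (auto simp: graded_braided_bialgebra_def braided_bialgebra_def)
  have vs: "vector_space (scale B)" and V: "module.subspace (scale B) (carrier B)"
    using alg by (auto simp: braided_algebra_def braided_vector_space_def Let_def)
  have ds: "internal_direct_sum (scale B) (carrier B) (component B)"
    using g by (simp add: graded_braided_bialgebra_def)
  note ax = alg[unfolded braided_algebra_def braided_vector_space_def Let_def linear_between_def]
    coalg[unfolded braided_coalgebra_def Let_def linear_between_def]
    g[unfolded graded_braided_bialgebra_def braided_bialgebra_def]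
  show ?thesis
  proof (rule strong_core.intro, goal_cases)
    case 1 show ?case by (rule vs)
  next case 2 show ?case using ds by (simp add: internal_direct_sum_def)
  next case 3 show ?case by (rule internal_direct_sum_projections(1)[OF vs V ds])
  next case 4 show ?case by (rule internal_direct_sum_projections(2)[OF vs V ds])
  next case 5 show ?case using ax(1) by blast
  next case 6 show ?case using ax(2) by blast
  next case 7 show ?case using ax(1) by blast
  next case 8 show ?case using st by (simp add: strongly_graded_def)
  next case 9 then show ?case using ax(3) by blast
  next case 10 then show ?case using ax(3) by blast
  next case 11 then show ?case using ax(1) by blast
  next case 12 then show ?case using ax(1) by blast
  next case 13 then show ?case using ax(2) by blast
  next case 14 then show ?case using ax(2) by blast
  next case 15 then show ?case using ax(2) by blast
  next case 16 then show ?case by (rule ax(3)[THEN conjunct1, THEN conjunct2, THEN conjunct2, THEN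
    conjunct1, rule_format])
  qed
qed

section \<open>Iterating the functor\<close>

lemma S_iter_Suc: "S_iter (Suc k) B = S_bialg (S_iter k B)"
  by (simp add: S_iter_def)

lemma scale_S_iter: "scale (S_iter k B) = scale B"
  by (induction k) (simp_all add: S_iter_Suc S_bialg_def Let_def S_iter_def[of 0])

lemma component_S_iter_Suc: "component (S_iter (Suc k) B) n = S_proj (S_iter k B) ` component
  (S_iter k B) n"
  by (simp add: S_iter_Suc S_bialg_def Let_def)

lemma carrier_S_iter_Suc: "carrier (S_iter (Suc k) B) = S_proj (S_iter k B) ` carrier (S_iter k B)"
  by (simp add: S_iter_Suc S_bialg_def Let_def)

context strong_core
begin

lemma strong_core_S_iter: "strong_core (S_iter k B)"
proof (induction k)
  case 0
  show ?case by (simp add: S_iter_def strong_core_axioms)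
next
  case (Suc k)
  then show ?case unfolding S_iter_Suc by (rule strong_core.strong_core_S)
qed

lemma E_S_iter: "2 \<le> n \<Longrightarrow> n \<le> k + 1 \<Longrightarrow> E_comp (S_iter k B) n \<subseteq> {0}"
proof (induction k arbitrary: n)
  case (Suc k)
  interpret A: strong_core "S_iter k B" by (rule strong_core_S_iter)
  show ?case
    unfolding S_iter_Suc by (rule A.E_S_zero[of "k + 2"]) (use Suc in auto)
qed simp

lemma S_proj_injective:
  assumes "x \<in> component (S_iter k B) n" "n \<le> k + 1" "S_proj (S_iter k B) x = 0"
  shows "x = 0"
proof -
  interpret A: strong_core "S_iter k B" by (rule strong_core_S_iter)
  show ?thesis
    by (rule A.p_injective_low_degree[of "k + 2" x n]) (use assms E_S_iter[of _ k] in auto)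
qed

lemma zero_in_component: "0 \<in> W n"
  by (rule vs.subspace_0[OF component_subspace])

lemma component_zero_above:
  assumes "W N = {0}" "n \<ge> N" shows "W n = {0}"
proof -
  have "W n = m ` (W N \<otimes>\<otimes> W (n - N))" using mult_strong[of N "n - N"] assms(2) by simp
  also have "\<dots> \<subseteq> {0}"
    using tensor_space_zero_left[OF vs, of s "W (n - N)"] lin_zero[OF lin_mult] unfolding assms(1)
      by auto
  finally show ?thesis using zero_in_component by blast
qed

text \<open>
  The ideal is zero, and then the representative \<open>p x\<close> of the coset of \<open>x\<close> is \<open>x\<close> itself: on the
  carrier the projection is the identity map.
\<close>

lemma gbb_iso_S_proj:
  assumes "\<And>n. n \<ge> 2 \<Longrightarrow> E_comp B n \<subseteq> {0}"
  shows "gbb_iso B B' p"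
proof -
  have "two_sided_ideal B {0}"
    by (rule two_sided_idealI)
      (use component_in_carrier[OF zero_in_component] in \<open>auto simp: tensor_zero_left[OF vs]
        tensor_zero_right[OF vs] lin_zero[OF lin_mult]\<close>)
  from I_minimal[OF this] assms have I: "I \<subseteq> {0}" by blast
  have p: "p x = x" if "x \<in> V" for x using p_diff[OF that] I by auto
  have pp: "pp t = t" if "t \<in> V \<otimes>\<otimes> V" for t
    by (rule tensor_map_ident[OF lin_p lin_p p p that])
  have "p ` V = V" using p by force
  moreover have "inj_on p V" using p by (auto intro!: inj_onI)
  ultimately show ?thesis
    unfolding gbb_iso_def gbb_hom_def Let_def bij_betw_def linear_between_def S_simps
    using p pp by (auto simp: S_bialg_def Let_def lin_p)
qed

end

section \<open>The direct limit\<close>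

text \<open>
  \<open>collapse f k\<close> pushes the entries of index at most \<open>k\<close> forward to stage \<open>k\<close> and adds them up
  there. It detects when an element becomes zero in the limit.
\<close>

primrec collapse :: "(nat \<Rightarrow> 'a \<Rightarrow> 'a) \<Rightarrow> nat \<Rightarrow> (nat \<Rightarrow>\<^sub>0 'a::ab_group_add) \<Rightarrow> 'a" where
  "collapse f 0 q = Poly_Mapping.lookup q 0"
| "collapse f (Suc k) q = f k (collapse f k q) + Poly_Mapping.lookup q (Suc k)"

locale direct_system =
  fixes A :: "nat \<Rightarrow> ('k::field, 'a::ab_group_add) gr_brd_bialg" and f :: "nat \<Rightarrow> 'a \<Rightarrow> 'a"
    and s :: "'k \<Rightarrow> 'a \<Rightarrow> 'a"
  assumes vs: "vector_space s" and scale: "scale (A i) = s"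
    and lin: "lin s s (f i)" and sub: "module.subspace s (carrier (A i))"
    and f_carrier: "x \<in> carrier (A i) \<Longrightarrow> f i x \<in> carrier (A (Suc i))"
begin

lemma vs_sum: "vector_space (pm_scale s :: 'k \<Rightarrow> (nat \<Rightarrow>\<^sub>0 'a) \<Rightarrow> _)"
  by (rule vector_space_pm_scale[OF vs])

sublocale vs: vector_space s by (rule vs)
sublocale ps: vector_space "pm_scale s :: 'k \<Rightarrow> (nat \<Rightarrow>\<^sub>0 'a) \<Rightarrow> _" by (rule vs_sum)

lemma lin_collapse: "lin (pm_scale s) s (collapse f k)"
proof (induction k)
  case (Suc k)
  then show ?case
    unfolding Vector_Spaces.linear_iff
    by (simp add: lookup_add lookup_pm_scale[OF vs] lin_add[OF lin] lin_scale[OF lin]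
      vs.scale_right_distrib)
qed (simp add: Vector_Spaces.linear_iff vs vs_sum lookup_add lookup_pm_scale[OF vs])

lemma collapse_single:
  "k < i \<Longrightarrow> collapse f k (Poly_Mapping.single i x) = 0"
  "collapse f i (Poly_Mapping.single i x) = x"
  "i \<le> k \<Longrightarrow> collapse f (Suc k) (Poly_Mapping.single i x) = f k (collapse f k (Poly_Mapping.single i x))"
proof -
  show 1: "collapse f k (Poly_Mapping.single i x) = 0" if "k < i" for k
    using that by (induction k) (auto simp: lookup_single lin_zero[OF lin])
  show "collapse f i (Poly_Mapping.single i x) = x"
    using 1[of "i - 1"] by (cases i) (auto simp: lookup_single lin_zero[OF lin])
  show "i \<le> k \<Longrightarrow> collapse f (Suc k) (Poly_Mapping.single i x)
    = f k (collapse f k (Poly_Mapping.single i x))"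
    by (simp add: lookup_single)
qed

text \<open>
  The two terms of a generating relation cancel from the later stage on.
\<close>

lemma collapse_relations:
  assumes "q \<in> dirlim_relations A f" shows "\<exists>k0. \<forall>k\<ge>k0. collapse f k q = 0"
  using assms unfolding dirlim_relations_def scale
proof (induction rule: ps.span_induct_alt)
  case base
  show ?case by (simp add: lin_zero[OF lin_collapse])
next
  case (step a r q)
  then obtain i x where r: "r = Poly_Mapping.single i x - Poly_Mapping.single (Suc i) (f i x)" by blast
  have "collapse f k r = 0" if "k \<ge> Suc i" for k
    using that
  proof (induction k rule: dec_induct)
    case base
    show ?case
      using collapse_single(3)[of i i x]
        by (simp add: r lin_diff[OF lin_collapse] collapse_single(2) del: collapse.simps)
  next
    case (step k)
    then show ?case
      by (simp add: r lin_diff[OF lin_collapse] collapse_single(3) lin_diff[OF lin, symmetric]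
        lin_zero[OF lin] del: collapse.simps)
  qed
  moreover obtain k0 where "\<forall>k\<ge>k0. collapse f k q = 0" using step by blast
  ultimately show ?case
    by (intro exI[of _ "max (Suc i) k0"]) (simp add: lin_add[OF lin_collapse]
      lin_scale[OF lin_collapse])
qed

lemma sum_subspace: "ps.subspace (dirlim_sum A)"
  unfolding ps.subspace_def dirlim_sum_def
  by (auto simp: lookup_add lookup_pm_scale[OF vs] intro: vs.subspace_add[OF sub]
    vs.subspace_scale[OF sub] vs.subspace_0[OF sub])

lemma relations_subspace: "ps.subspace (dirlim_relations A f)"
  unfolding dirlim_relations_def scale by (rule ps.subspace_span)

lemma single_in_sum: "x \<in> carrier (A i) \<Longrightarrow> Poly_Mapping.single i x \<in> dirlim_sum A"
  by (auto simp: dirlim_sum_def lookup_single when_def vs.subspace_0[OF sub])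

lemma relations_in_sum: "dirlim_relations A f \<subseteq> dirlim_sum A"
  unfolding dirlim_relations_def scale
  by (rule ps.span_minimal[OF _ sum_subspace])
    (auto intro!: ps.subspace_diff[OF sum_subspace] single_in_sum f_carrier)

lemmas proj_spec = quot_proj_spec[OF vs_sum sum_subspace relations_subspace relations_in_sum]

lemma dirlim_inj_zero: "dirlim_inj A f i 0 = 0"
  unfolding dirlim_inj_def dirlim_proj_def scale by (simp add: lin_zero[OF proj_spec(1)])

lemma dirlim_inj_step:
  assumes "x \<in> carrier (A i)" shows "dirlim_inj A f i x = dirlim_inj A f (Suc i) (f i x)"
proof -
  have "Poly_Mapping.single i x - Poly_Mapping.single (Suc i) (f i x) \<in> dirlim_relations A f"
    unfolding dirlim_relations_def scale using assms by (intro ps.span_base) blast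
  from proj_spec(4)[OF this] show ?thesis
    unfolding dirlim_inj_def dirlim_proj_def scale by (simp add: lin_diff[OF proj_spec(1)])
qed

lemma dirlim_inj_kernel:
  assumes x: "x \<in> carrier (A i)" "dirlim_inj A f i x = 0"
  shows "\<exists>k\<ge>i. collapse f k (Poly_Mapping.single i x) = 0"
proof -
  have "Poly_Mapping.single i x \<in> dirlim_relations A f"
    using x(2) quot_proj_kernel[OF vs_sum sum_subspace relations_subspace relations_in_sum
      single_in_sum[OF x(1)]]
    unfolding dirlim_inj_def dirlim_proj_def scale by blast
  from collapse_relations[OF this] obtain k0 where "\<forall>k\<ge>k0. collapse f k (Poly_Mapping.single i x)
    = 0" by blast
  then show ?thesis by (intro exI[of _ "max k0 i"]) simp
qed

end

context strong_core
begin

lemma direct_system: "direct_system (\<lambda>i. S_iter i B) (\<lambda>i. S_proj (S_iter i B)) s"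
proof (rule direct_system.intro)
  fix i x
  interpret A: strong_core "S_iter i B" by (rule strong_core_S_iter)
  show "lin s s (S_proj (S_iter i B))" using A.lin_p by (simp add: scale_S_iter)
  show "vs.subspace (carrier (S_iter i B))" using A.carrier_subspace by (simp add: scale_S_iter)
  show "x \<in> carrier (S_iter i B) \<Longrightarrow> S_proj (S_iter i B) x \<in> carrier (S_iter (Suc i) B)"
    by (simp add: carrier_S_iter_Suc)
qed (simp_all add: vs scale_S_iter)

lemma component_S_infinity:
  "component (S_infinity B) n = (\<Union>i. dirlim_inj (\<lambda>i. S_iter i B) (\<lambda>i. S_proj (S_iter i B)) i `
    component (S_iter i B) n)"
  by (simp add: S_infinity_def dirlim_def Let_def)

text \<open>
  Elements from earlier stages pass through stage \<open>K\<close>, where their degree is gone; at later stages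
  it is gone because the projections are surjective.
\<close>

lemma component_S_infinity_zero:
  assumes K: "component (S_iter K B) n = {0}" shows "component (S_infinity B) n = {0}"
proof -
  interpret L: direct_system "\<lambda>i. S_iter i B" "\<lambda>i. S_proj (S_iter i B)" s by (rule direct_system)
  let ?j = "dirlim_inj (\<lambda>i. S_iter i B) (\<lambda>i. S_proj (S_iter i B))"
  have above: "component (S_iter i B) n = {0}" if "i \<ge> K" for i
    using that by (induction i rule: dec_induct) (simp_all add: K component_S_iter_Suc
      lin_zero[OF L.lin])
  have "?j i x = 0" if "x \<in> component (S_iter i B) n" for i x
  proof (cases "i \<le> K")
    case True
    then show ?thesis using that
    proof (induction i arbitrary: x rule: inc_induct)
      case base
      then show ?case by (simp add: K L.dirlim_inj_zero)
    next
      case (step i)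
      have "x \<in> carrier (S_iter i B)"
        using strong_core.component_in_carrier[OF strong_core_S_iter step.prems] .
      then show ?case using step by (simp add: L.dirlim_inj_step component_S_iter_Suc)
    qed
  next
    case False
    then show ?thesis using above[of i] that by (simp add: L.dirlim_inj_zero)
  qed
  moreover have "0 \<in> component (S_iter K B) n" using K by simp
  ultimately show ?thesis unfolding component_S_infinity by force
qed

text \<open>
  An element that is zero in the limit dies at a finite stage, but from stage \<open>n - 1\<close> on the
  projections are injective in degree \<open>n\<close>.
\<close>

lemma component_S_iter_zero:
  assumes N: "component (S_infinity B) n = {0}" and k: "n \<le> k + 1"
  shows "component (S_iter k B) n = {0}"
proof -
  interpret L: direct_system "\<lambda>i. S_iter i B" "\<lambda>i. S_proj (S_iter i B)" s by (rule direct_system)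
  have "x = 0" if x: "x \<in> component (S_iter k B) n" for x
  proof (rule ccontr)
    assume "x \<noteq> 0"
    have "dirlim_inj (\<lambda>i. S_iter i B) (\<lambda>i. S_proj (S_iter i B)) k x = 0"
      using N x unfolding component_S_infinity by blast
    then obtain l where l: "l \<ge> k" "collapse (\<lambda>i. S_proj (S_iter i B)) l (Poly_Mapping.single k x) = 0"
      using L.dirlim_inj_kernel strong_core.component_in_carrier[OF strong_core_S_iter x] by blast
    have "collapse (\<lambda>i. S_proj (S_iter i B)) l (Poly_Mapping.single k x) \<in> component (S_iter l B) n
      - {0}"
      using l(1)
    proof (induction l rule: dec_induct)
      case base
      then show ?case using x \<open>x \<noteq> 0\<close> by (simp add: L.collapse_single)
    next
      case (step i)
      then show ?case
        using S_proj_injective[of "collapse (\<lambda>i. S_proj (S_iter i B)) i (Poly_Mapping.single k x)" i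
          n] k
        by (auto simp: L.collapse_single(3) component_S_iter_Suc simp del: collapse.simps)
    qed
    then show False using l(2) by simp
  qed
  then show ?thesis using strong_core.zero_in_component[OF strong_core_S_iter] by blast
qed

end

theorem theoremA9:
  fixes B :: "('k::field, 'a::ab_group_add) gr_brd_bialg" and N :: nat
  assumes "graded_braided_bialgebra B"
    and "strongly_graded B"
    and "N \<ge> 1"
  shows "let P1 = (component (S_infinity B) N = {0});
             P2 = (\<forall>n\<ge>N. component (S_infinity B) n = {0});
             P3 = (component (S_iter (N - 1) B) N = {0});
             P4 = (\<forall>n\<ge>N. component (S_iter (N - 1) B) n = {0})
         in (P1 \<longleftrightarrow> P2) \<and> (P1 \<longleftrightarrow> P3) \<and> (P1 \<longleftrightarrow> P4) \<and>
            (P1 \<or> P2 \<or> P3 \<or> P4 \<longrightarrow> sdeg B \<le> enat (N - 1))"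
proof -
  interpret strong_core B by (rule strong_coreI[OF assms(1,2)])
  interpret A: strong_core "S_iter (N - 1) B" by (rule strong_core_S_iter)
  let ?P1 = "component (S_infinity B) N = {0}"
  let ?P2 = "\<forall>n\<ge>N. component (S_infinity B) n = {0}"
  let ?P3 = "component (S_iter (N - 1) B) N = {0}"
  let ?P4 = "\<forall>n\<ge>N. component (S_iter (N - 1) B) n = {0}"
  have 13: "?P3" if "?P1" using component_S_iter_zero[OF that, of "N - 1"] by simp
  have 34: "?P4" if "?P3" using A.component_zero_above[OF that] by blast
  have 42: "?P2" if "?P4" using component_S_infinity_zero that by blast
  have 21: "?P1" if "?P2" using that by blast
  have sd: "sdeg B \<le> enat (N - 1)" if P4: "?P4"
  proof -
    have "E_comp (S_iter (N - 1) B) n \<subseteq> {0}" if "n \<ge> 2" for n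
    proof (cases "n \<le> N")
      case True
      then show ?thesis using E_S_iter[of n "N - 1"] that by simp
    next
      case False
      then show ?thesis using P4 by (auto simp: E_comp_def)
    qed
    from A.gbb_iso_S_proj[OF this]
    have "gbb_iso (S_iter (N - 1) B) (S_iter (Suc (N - 1)) B) (S_proj (S_iter (N - 1) B))"
      unfolding S_iter_Suc by blast
    then show ?thesis unfolding sdeg_def by (intro Inf_lower) blast
  qed
  have logic: "(P1 \<longleftrightarrow> P2) \<and> (P1 \<longleftrightarrow> P3) \<and> (P1 \<longleftrightarrow> P4) \<and> (P1 \<or> P2 \<or> P3 \<or> P4 \<longrightarrow> Q)"
    if "P1 \<Longrightarrow> P3" "P3 \<Longrightarrow> P4" "P4 \<Longrightarrow> P2" "P2 \<Longrightarrow> P1" "P4 \<Longrightarrow> Q" for P1 P2 P3 P4 Q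
    using that by blast
  show ?thesis unfolding Let_def by (rule logic[OF 13 34 42 21 sd])
qed

end
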